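(* Let $r\ge1$, let $n_1,\dots,n_r$ be non-negative integers, and let $a,x_1,\dots,x_r$ be generic nonzero complex parameters. Then $$\sum_{\substack{0\le k_i\le n_i\\ i=1,\dots,r}}\frac{\Delta(\mathbf xq^{3\mathbf k};p)}{\Delta(\mathbf x;p)}q^{|\mathbf k|-2e_2(\mathbf k)}\prod_{1\le i<j\le r}\frac1{(x_ix_j;q^3,p)_{k_i+k_j}}$$ $$\times\prod_{i=1}^r\left(\frac{\theta(ax_iq^{|\mathbf k|+3k_i};p)}{\theta(ax_i;p)}\frac{(ax_i;q,p)_{|\mathbf k|}\,(aq/x_i;q,p)_{|\mathbf k|-k_i}}{(ax_iq^{3n_i+1},aq^{1-3n_i}/x_i;q,p)_{|\mathbf k|}\,(q^{k_i-|\mathbf k|}x_i/a;q,p)_{2k_i}}\right)$$ $$\times\frac{(1/a^2;q,p)_{|\mathbf k|}\,(a^2q;q,p)_{2|\mathbf k|}}{\prod_{i=1}^r(a^3x_iq^3;q^3,p)_{k_i}}\prod_{i,j=1}^r\frac{(q^{-3n_j}x_i/x_j,x_ix_jq^{3n_j};q^3,p)_{k_i}}{(q^3x_i/x_j;q^3,p)_{k_i}}$$ $$=\prod_{i=1}^r\frac{(ax_iq;q,p)_{3n_i}\,(x_i/a^3;q^3,p)_{n_i}}{(x_i/a;q,p)_{3n_i}\,(a^3x_iq^3;q^3,p)_{n_i}}.$$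
   Context: $p,q$ are complex numbers with $|p|<1$, $q\ne0$, and $q^k\notin p^{\mathbb Z}$ for all integers $k>0$ (if $p=0$: $q^k\ne1$). For $x\ne0$, $\theta(x;p)=\prod_{j=0}^\infty(1-p^jx)(1-p^{j+1}/x)$. Elliptic shifted factorials: $(a;q,p)_k=\prod_{j=0}^{k-1}\theta(aq^j;p)$ for $k\in\mathbb Z_{\ge0}$ (similarly with base $q^3$), and $(a_1,\dots,a_m;q,p)_k=(a_1;q,p)_k\cdots(a_m;q,p)_k$. For $\mathbf k=(k_1,\dots,k_r)$, $|\mathbf k|=k_1+\cdots+k_r$ and $e_2(\mathbf k)=\sum_{1\le i<j\le r}k_ik_j$. For $\mathbf x=(x_1,\dots,x_r)$, $\Delta(\mathbf x;p)=\prod_{1\le i<j\le r}x_j\theta(x_i/x_j;p)$, and $\mathbf xq^{3\mathbf k}=(x_1q^{3k_1},\dots,x_rq^{3k_r})$. All parameters are assumed generic so that no denominator vanishes. *)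

theory Defs
  imports "HOL-Analysis.Analysis"
begin

text \<open>Modified Jacobi theta function; meaningful for \<open>norm p < 1\<close> and \<open>x \<noteq> 0\<close>. The nome
  \<open>p = 0\<close> is included: since \<open>0 ^ 0 = 1\<close>, the product is then \<open>1 - x\<close>.\<close>

definition theta :: "complex \<Rightarrow> complex \<Rightarrow> complex" where
  "theta p x = (\<Prod>j. (1 - p ^ j * x) * (1 - p ^ (j + 1) / x))"

definition ell_fact :: "complex \<Rightarrow> complex \<Rightarrow> complex \<Rightarrow> nat \<Rightarrow> complex" where
  "ell_fact q p a k = (\<Prod>j<k. theta p (a * q ^ j))"

text \<open>The multi-parameter symbol \<open>(a\<^sub>1, \<dots>, a\<^sub>m; q, p)\<^sub>k\<close>.\<close>

definition ell_facts :: "complex \<Rightarrow> complex \<Rightarrow> complex list \<Rightarrow> nat \<Rightarrow> complex" where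
  "ell_facts q p as k = (\<Prod>a\<leftarrow>as. ell_fact q p a k)"

text \<open>In what follows, \<open>r\<close>-tuples are functions on \<open>nat\<close> of which only the values on \<open>{1..r}\<close>
  matter.\<close>

definition Delta :: "nat \<Rightarrow> complex \<Rightarrow> (nat \<Rightarrow> complex) \<Rightarrow> complex" where
  "Delta r p x = (\<Prod>i\<in>{1..r}. \<Prod>j\<in>{i<..r}. x j * theta p (x i / x j))"

definition weight :: "nat \<Rightarrow> (nat \<Rightarrow> nat) \<Rightarrow> nat" where
  "weight r k = (\<Sum>i\<in>{1..r}. k i)"

definition e2 :: "nat \<Rightarrow> (nat \<Rightarrow> nat) \<Rightarrow> nat" where
  "e2 r k = (\<Sum>i\<in>{1..r}. \<Sum>j\<in>{i<..r}. k i * k j)"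

definition index_box :: "nat \<Rightarrow> (nat \<Rightarrow> nat) \<Rightarrow> (nat \<Rightarrow> nat) set" where
  "index_box r n = (\<Pi>\<^sub>E i\<in>{1..r}. {0..n i})"

text \<open>Genericity of the parameters: none of the denominators in the summation formula vanishes.\<close>

definition generic ::
    "nat \<Rightarrow> complex \<Rightarrow> complex \<Rightarrow> (nat \<Rightarrow> nat) \<Rightarrow> complex \<Rightarrow> (nat \<Rightarrow> complex) \<Rightarrow> bool" where
  "generic r p q n a x \<longleftrightarrow>
     Delta r p x \<noteq> 0 \<and>
     (\<forall>i\<in>{1..r}. theta p (a * x i) \<noteq> 0 \<and>
        ell_fact q p (x i / a) (3 * n i) \<noteq> 0 \<and>
        ell_fact (q ^ 3) p (a ^ 3 * x i * q ^ 3) (n i) \<noteq> 0) \<and>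
     (\<forall>k\<in>index_box r n.
        (\<forall>i\<in>{1..r}. \<forall>j\<in>{i<..r}. ell_fact (q ^ 3) p (x i * x j) (k i + k j) \<noteq> 0) \<and>
        (\<forall>i\<in>{1..r}.
           ell_facts q p [a * x i * q ^ (3 * n i + 1), a * q powi (1 - 3 * int (n i)) / x i]
             (weight r k) \<noteq> 0 \<and>
           ell_fact q p (q powi (int (k i) - int (weight r k)) * x i / a) (2 * k i) \<noteq> 0 \<and>
           ell_fact (q ^ 3) p (a ^ 3 * x i * q ^ 3) (k i) \<noteq> 0) \<and>
        (\<forall>i\<in>{1..r}. \<forall>j\<in>{1..r}. ell_fact (q ^ 3) p (q ^ 3 * x i / x j) (k i) \<noteq> 0))"

end

theory Submission
  imports Defs "HOL-Complex_Analysis.Complex_Analysis"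
begin

text \<open>
  In logarithmic variables, with \<open>\<sigma> u = exp (- u / 2) * theta p (exp u)\<close>, all powers of \<open>q\<close> in the
  identity cancel. Up to a factor depending only on \<open>n\<close>, the left-hand side is a sum
  \<open>\<Sum>k. G n k * A k\<close>, where \<open>G\<close> is a triangular kernel and \<open>A\<close> does not depend on \<open>n\<close>. The
  kernel has an explicit inverse \<open>F\<close>, so it is enough to evaluate \<open>\<Sum>m. F n m * R m\<close> for the claimed
  value \<open>R\<close>; this is an elliptic Jackson sum of type C in base \<open>q ^ 3\<close>, with parameters
  \<open>a q\<^sup>N, a q\<^sup>N\<^sup>+\<^sup>1, a q\<^sup>N\<^sup>+\<^sup>2, a\<^sup>-\<^sup>3\<close> for \<open>N = |n|\<close>.

  The inverse relation and the zeros of the Jackson sum, as a function of one of its parameters, are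
  both instances of \<open>box_sum_zero\<close>: the summand is a Vandermonde product in the form
  \<open>\<sigma> (x + y) * \<sigma> (x - y)\<close> times one factor for each index, so the sum is an alternating multilinear
  expression in the blocks of points, and it vanishes because the partial fraction expansion over
  the union of all blocks does.

  The argument requires more genericity than assumed. The excluded values on a suitable complex line
  through the given parameters are countable, so continuity gives the general case.
\<close>

section \<open>Skew forms satisfying a three-term relation\<close>

text \<open>On the left-hand side the factorials of |k| and 2|k| couple all indices, so the sum over
  k is not a Vandermonde product times one factor per index. After inversion the sum runs over m
  with n fixed: the coupling enters only through the constant N = |n|, and the claimed value is
  itself a product over the indices, so the required shape is restored. The word cubic refers to two
  step lengths. The points x_i q^(3 k_i) advance by q^3, the poles of the kernel, at a q^t, by q. A
  base-q product of length 3 m_i is three base-q^3 products of length m_i, which produces the three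
  consecutive Jackson parameters; the product of all four parameters is q^(3N+3), so the sum is
  balanced. The inverse matrix is not applied as such: F annihilates the difference of the two
  sides, F n n does not vanish, and induction on |n| finishes. Of theta only oddness, the three-term
  relation and the absence of unwanted zeros enter the algebra, which is therefore done for an
  abstract \<sigma>.\<close>

lemma sum_PiE_Suc:
  fixes f :: "(nat \<Rightarrow> 'b) \<Rightarrow> 'a::comm_monoid_add"
  shows "(\<Sum>k\<in>PiE {1..Suc r} Y. f k) = (\<Sum>k\<in>PiE {1..r} Y. \<Sum>y\<in>Y (Suc r). f (k(Suc r := y)))"
proof -
  have "{1..Suc r} = insert (Suc r) {1..r}" by auto
  then have "(\<Sum>k\<in>PiE {1..Suc r} Y. f k)
      = (\<Sum>k\<in>(\<lambda>(y, k). k(Suc r := y)) ` (Y (Suc r) \<times> PiE {1..r} Y). f k)"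
    by (simp only: PiE_insert_eq)
  also have "\<dots> = (\<Sum>(y, k)\<in>Y (Suc r) \<times> PiE {1..r} Y. f (k(Suc r := y)))"
    by (subst sum.reindex[OF inj_combinator]) (auto simp: split_def)
  also have "\<dots> = (\<Sum>k\<in>PiE {1..r} Y. \<Sum>y\<in>Y (Suc r). f (k(Suc r := y)))"
    by (subst sum.cartesian_product[symmetric]) (rule sum.swap)
  finally show ?thesis .
qed

context comm_monoid_set
begin

lemma pairs_Suc:
  "F (\<lambda>i. F (g i) {i<..Suc r}) {1..Suc r}
    = F (\<lambda>i. F (g i) {i<..r}) {1..r} \<^bold>* F (\<lambda>i. g i (Suc r)) {1..r}"
proof -
  have "F (g i) {i<..Suc r} = F (g i) {i<..r} \<^bold>* g i (Suc r)" if "i \<in> {1..r}" for i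
  proof -
    have "{i<..Suc r} = insert (Suc r) {i<..r}" using that by auto
    then show ?thesis by (simp add: commute)
  qed
  then have "F (\<lambda>i. F (g i) {i<..Suc r}) {1..r} = F (\<lambda>i. F (g i) {i<..r} \<^bold>* g i (Suc r)) {1..r}"
    by (intro cong refl)
  moreover have "{1..Suc r} = insert (Suc r) {1..r}" by auto
  ultimately show ?thesis by (simp add: distrib)
qed

text \<open>A square of indices is its diagonal and two triangles. The monoid is left open for two
  uses: as a product it extracts squared Vandermonde products, as a sum it yields |k|^2 = (sum of
  k_i^2) + 2 e_2(k).\<close>

lemma square_pairs:
  fixes r :: nat
  shows "F (\<lambda>i. F (g i) {1..r}) {1..r}
    = F (\<lambda>i. g i i) {1..r} \<^bold>* F (\<lambda>i. F (\<lambda>j. g i j \<^bold>* g j i) {i<..r}) {1..r}"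
proof (induction r)
  case (Suc r)
  have ins: "{1..Suc r} = insert (Suc r) {1..r}" by auto
  have "F (\<lambda>i. F (g i) {1..Suc r}) {1..Suc r} = F (\<lambda>i. F (g i) {1..r}) {1..r}
     \<^bold>* F (\<lambda>i. g i (Suc r)) {1..r} \<^bold>* F (g (Suc r)) {1..r} \<^bold>* g (Suc r) (Suc r)"
    unfolding ins by (simp add: distrib ac_simps)
  then show ?case
    unfolding Suc.IH pairs_Suc by (simp add: ins distrib ac_simps)
qed simp

end

abbreviation box :: "nat \<Rightarrow> (nat \<Rightarrow> nat) \<Rightarrow> (nat \<Rightarrow> nat) set" where
  "box r n \<equiv> PiE {1..r} (\<lambda>i. {0..n i})"

text \<open>The relation is that of 2 by 2 minors \<open>A x * B y - B x * A y\<close>, so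
  \<open>\<phi> x y\<close> acts as a homogeneous difference of two points on a line. Characteristic
  0 lets a quantity equal to its own negative vanish.\<close>

locale pluecker_form =
  fixes \<phi> :: "'p \<Rightarrow> 'p \<Rightarrow> 'a::field_char_0"
  assumes skew: "\<phi> x y = - \<phi> y x"
    and pluecker: "\<phi> x y * \<phi> u v = \<phi> x u * \<phi> y v - \<phi> x v * \<phi> y u"
begin

lemma phi_self [simp]: "\<phi> x x = 0"
  using skew[of x x] by simp

text \<open>For \<open>\<phi> x y = x - y\<close> this says that a divided difference over |I| nodes
  kills a product of |I| - 2 linear factors. The induction step expands one numerator factor in
  \<open>\<phi> (z a)\<close> and \<open>\<phi> (z b)\<close>; either of these cancels a denominator
  factor and so removes a node.\<close>

lemma partial_fraction:
  fixes z :: "'i \<Rightarrow> 'p" and w :: "'l \<Rightarrow> 'p"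
  assumes "finite L" "finite I" "card I = card L + 2"
    and "\<And>i j. i \<in> I \<Longrightarrow> j \<in> I \<Longrightarrow> i \<noteq> j \<Longrightarrow> \<phi> (z i) (z j) \<noteq> 0"
  shows "(\<Sum>i\<in>I. (\<Prod>l\<in>L. \<phi> (w l) (z i)) / (\<Prod>j\<in>I - {i}. \<phi> (z j) (z i))) = 0"
  using assms
proof (induction L arbitrary: I rule: finite_induct)
  case empty
  then obtain a b where ab: "I = {a, b}" "a \<noteq> b"
    by (metis add_0 card.empty card_2_iff)
  then have "{a, b} - {a} = {b}" "{a, b} - {b} = {a}" by auto
  then show ?case using ab skew[of "z a" "z b"] by simp
next
  case (insert l L)
  have "card I \<ge> 2" using insert.prems(2) by simp
  then obtain a b where ab: "a \<in> I" "b \<in> I" "a \<noteq> b"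
    by (metis Suc_1 Suc_le_mono card_le_Suc0_iff_eq insert.prems(1) not_less_eq_eq numeral_2_eq_2)
  define Q where "Q i = (\<Prod>l\<in>L. \<phi> (w l) (z i))" for i
  define D where "D I i = (\<Prod>j\<in>I - {i}. \<phi> (z j) (z i))" for I i
  have drop: "(\<Sum>i\<in>I. \<phi> (z c) (z i) * Q i / D I i) = 0" if c: "c \<in> I" for c
  proof -
    have "(\<Sum>i\<in>I. \<phi> (z c) (z i) * Q i / D I i) = (\<Sum>i\<in>I - {c}. \<phi> (z c) (z i) * Q i / D I i)"
      using insert.prems(1) c by (subst sum.remove[of _ c]) auto
    also have "\<dots> = (\<Sum>i\<in>I - {c}. Q i / D (I - {c}) i)"
    proof (rule sum.cong)
      fix i assume i: "i \<in> I - {c}"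
      have "I - {i} - {c} = I - {c} - {i}" by auto
      then have "D I i = \<phi> (z c) (z i) * D (I - {c}) i"
        unfolding D_def using i c insert.prems(1)
        by (subst prod.remove[of "I - {i}" c]) auto
      moreover have "\<phi> (z c) (z i) \<noteq> 0" using i c insert.prems(3) by auto
      ultimately show "\<phi> (z c) (z i) * Q i / D I i = Q i / D (I - {c}) i" by simp
    qed simp
    also have "\<dots> = 0"
      unfolding Q_def D_def using insert.prems c insert.hyps
      by (intro insert.IH) auto
    finally show ?thesis .
  qed
  have ne: "\<phi> (z a) (z b) \<noteq> 0" using insert.prems(3) ab by auto
  have "\<phi> (z a) (z b) * (\<Sum>i\<in>I. \<phi> (w l) (z i) * Q i / D I i)
      = (\<Sum>i\<in>I. \<phi> (w l) (z b) * (\<phi> (z a) (z i) * Q i / D I i)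
             - \<phi> (w l) (z a) * (\<phi> (z b) (z i) * Q i / D I i))"
    unfolding sum_distrib_left
  proof (rule sum.cong)
    fix i
    have "\<phi> (z a) (z b) * \<phi> (w l) (z i)
        = \<phi> (w l) (z b) * \<phi> (z a) (z i) - \<phi> (w l) (z a) * \<phi> (z b) (z i)"
      using pluecker[of "w l" "z i" "z a" "z b"] skew[of "z i" "z a"] skew[of "z i" "z b"]
      by (simp add: algebra_simps)
    then show "\<phi> (z a) (z b) * (\<phi> (w l) (z i) * Q i / D I i)
      = \<phi> (w l) (z b) * (\<phi> (z a) (z i) * Q i / D I i)
             - \<phi> (w l) (z a) * (\<phi> (z b) (z i) * Q i / D I i)"
      by (metis (no_types, opaque_lifting) left_diff_distrib diff_divide_distrib
          mult.assoc times_divide_eq_right)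
  qed simp
  also have "\<dots> = 0"
    by (simp only: sum_subtractf sum_distrib_left[symmetric] drop[OF ab(1)] drop[OF ab(2)]) simp
  finally show ?case
    using ne insert.hyps by (simp add: Q_def D_def)
qed

text \<open>A combination of products of |L| factors behaves like a polynomial of degree |L|, so |L|
  + 1 zeros force it to vanish. Partial fractions are taken over these zeros and \<open>v\<close>
  together, and only the term of \<open>v\<close>, labelled \<open>None\<close>, survives.\<close>

lemma product_form_zero:
  fixes y :: "'k \<Rightarrow> 'l \<Rightarrow> 'p" and p :: "'x \<Rightarrow> 'p"
  assumes "finite L" "finite X" "card X = card L + 1"
    and dist: "\<And>i j. i \<in> X \<Longrightarrow> j \<in> X \<Longrightarrow> i \<noteq> j \<Longrightarrow> \<phi> (p i) (p j) \<noteq> 0"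
    and zero: "\<And>i. i \<in> X \<Longrightarrow> (\<Sum>k\<in>A. c k * (\<Prod>l\<in>L. \<phi> (y k l) (p i))) = 0"
    and v: "\<And>i. i \<in> X \<Longrightarrow> \<phi> (p i) v \<noteq> 0"
  shows "(\<Sum>k\<in>A. c k * (\<Prod>l\<in>L. \<phi> (y k l) v)) = 0"
proof -
  define I where "I = insert None (Some ` X)"
  define z where "z = case_option v p"
  define G where "G u = (\<Sum>k\<in>A. c k * (\<Prod>l\<in>L. \<phi> (y k l) u))" for u
  define D where "D i = (\<Prod>j\<in>I - {i}. \<phi> (z j) (z i))" for i
  have "card (Some ` X) = card X" by (simp add: card_image)
  then have I: "finite I" "card I = card L + 2"
    using assms(2,3) by (auto simp: I_def)
  have "\<phi> (z i) (z j) \<noteq> 0" if "i \<in> I" "j \<in> I" "i \<noteq> j" for i j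
    using that dist v skew[of v] by (fastforce simp: I_def z_def)
  then have "(\<Sum>i\<in>I. (\<Prod>l\<in>L. \<phi> (y k l) (z i)) / D i) = 0" for k
    unfolding D_def using I assms(1) by (intro partial_fraction) auto
  then have "0 = (\<Sum>k\<in>A. c k * (\<Sum>i\<in>I. (\<Prod>l\<in>L. \<phi> (y k l) (z i)) / D i))"
    by simp
  also have "\<dots> = (\<Sum>i\<in>I. G (z i) / D i)"
    unfolding G_def sum_distrib_left sum_divide_distrib by (subst sum.swap) simp
  also have "\<dots> = G v / D None"
    using assms(2) zero by (simp add: G_def I_def z_def sum.reindex)
  finally have "G v / D None = 0" by simp
  moreover have "I - {None} = Some ` X" by (auto simp: I_def)
  then have "D None \<noteq> 0"
    unfolding D_def using assms(2) v by (auto simp: z_def)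
  ultimately show ?thesis by (simp add: G_def)
qed

lemma product_form_eq:
  fixes y :: "'k \<Rightarrow> 'l \<Rightarrow> 'p" and p :: "'x \<Rightarrow> 'p" and w :: "'m \<Rightarrow> 'p"
  assumes fin: "finite A" "finite L" "finite X" "finite M"
    and card: "card X = card L + 1" "card M = card L"
    and dist: "\<And>i j. i \<in> X \<Longrightarrow> j \<in> X \<Longrightarrow> i \<noteq> j \<Longrightarrow> \<phi> (p i) (p j) \<noteq> 0"
    and eq: "\<And>i. i \<in> X \<Longrightarrow> (\<Sum>k\<in>A. c k * (\<Prod>l\<in>L. \<phi> (y k l) (p i))) = C * (\<Prod>l\<in>M. \<phi> (w l) (p i))"
    and v: "\<And>i. i \<in> X \<Longrightarrow> \<phi> (p i) v \<noteq> 0"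
  shows "(\<Sum>k\<in>A. c k * (\<Prod>l\<in>L. \<phi> (y k l) v)) = C * (\<Prod>l\<in>M. \<phi> (w l) v)"
proof -
  obtain h where h: "bij_betw h L M"
    using fin card by (metis finite_same_card_bij)
  \<comment> \<open>The right-hand side becomes one more product, labelled \<open>None\<close> and
    with coefficient \<open>- C\<close>; \<open>h\<close> only renames its factors.\<close>
  define B where "B = insert None (Some ` A)"
  define c' where "c' = case_option (- C) c"
  define y' where "y' = case_option (w \<circ> h) y"
  have *: "(\<Sum>k\<in>B. c' k * (\<Prod>l\<in>L. \<phi> (y' k l) u))
      = (\<Sum>k\<in>A. c k * (\<Prod>l\<in>L. \<phi> (y k l) u)) - C * (\<Prod>l\<in>M. \<phi> (w l) u)" for u
    using fin(1) prod.reindex_bij_betw[OF h, of "\<lambda>l. \<phi> (w l) u"]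
    by (simp add: B_def c'_def y'_def sum.reindex)
  have "(\<Sum>k\<in>B. c' k * (\<Prod>l\<in>L. \<phi> (y' k l) v)) = 0"
    by (rule product_form_zero[OF fin(2,3) card(1), of p]) (use dist v eq * in auto)
  then show ?thesis using * by simp
qed

section \<open>Vandermonde products and alternating sums over blocks\<close>

definition vand :: "nat \<Rightarrow> (nat \<Rightarrow> 'p) \<Rightarrow> 'a" where
  "vand r u = (\<Prod>i=1..r. \<Prod>j\<in>{i<..r}. \<phi> (u i) (u j))"

lemma vand_Suc: "vand (Suc r) u = vand r u * (\<Prod>i=1..r. \<phi> (u i) (u (Suc r)))"
  unfolding vand_def by (rule prod.pairs_Suc)

lemma vand_cong: "(\<And>i. i \<in> {1..r} \<Longrightarrow> u i = v i) \<Longrightarrow> vand r u = vand r v"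
  unfolding vand_def by (intro prod.cong) auto

text \<open>The constant \<open>C\<close> absorbs the signs of the pairs in which \<open>j\<close>
  comes first, so that no permutation signs have to be tracked later.\<close>

lemma vand_upd_factor:
  assumes "j \<in> {1..r}"
  shows "\<exists>C. \<forall>v. vand r (u(j := v)) = C * (\<Prod>i\<in>{1..r} - {j}. \<phi> (u i) v)"
  using assms
proof (induction r)
  case (Suc r)
  show ?case
  proof (cases "j = Suc r")
    case True
    have "vand (Suc r) (u(j := v)) = vand r u * (\<Prod>i\<in>{1..Suc r} - {j}. \<phi> (u i) v)" for v
    proof -
      have "vand r (u(j := v)) = vand r u" using True by (intro vand_cong) auto
      moreover have "{1..Suc r} - {j} = {1..r}" using True by auto
      ultimately show ?thesis using True by (auto simp: vand_Suc intro!: prod.cong)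
    qed
    then show ?thesis by blast
  next
    case False
    then have j: "j \<in> {1..r}" using Suc.prems by auto
    then obtain C where C: "vand r (u(j := v)) = C * (\<Prod>i\<in>{1..r} - {j}. \<phi> (u i) v)" for v
      using Suc.IH by blast
    have "vand (Suc r) (u(j := v))
        = - C * (\<Prod>i\<in>{1..r} - {j}. \<phi> (u i) (u (Suc r))) * (\<Prod>i\<in>{1..Suc r} - {j}. \<phi> (u i) v)" for v
    proof -
      have "(\<Prod>i=1..r. \<phi> ((u(j := v)) i) ((u(j := v)) (Suc r)))
          = \<phi> v (u (Suc r)) * (\<Prod>i\<in>{1..r} - {j}. \<phi> (u i) (u (Suc r)))"
        using j by (subst prod.remove[of _ j]) auto
      moreover have "{1..Suc r} - {j} = insert (Suc r) ({1..r} - {j})" using j by auto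
      ultimately show ?thesis
        using C[of v] skew[of v "u (Suc r)"] by (simp add: vand_Suc)
    qed
    then show ?thesis by blast
  qed
qed simp

text \<open>This is the antisymmetry of the Vandermonde product of r + 1 points under exchanging the
  j-th with the last one: \<open>v\<close> moves to position \<open>j\<close> and \<open>u j\<close>
  to the end.\<close>

lemma vand_swap:
  assumes "j \<in> {1..r}"
  shows "vand r (u(j := v)) * (\<Prod>i=1..r. \<phi> ((u(j := v)) i) (u j))
    = - (vand r u * (\<Prod>i=1..r. \<phi> (u i) v))"
proof -
  obtain C where C: "vand r (u(j := v)) = C * (\<Prod>i\<in>{1..r} - {j}. \<phi> (u i) v)" for v
    using vand_upd_factor[OF assms] by blast
  have "vand r u = C * (\<Prod>i\<in>{1..r} - {j}. \<phi> (u i) (u j))"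
    using C[of "u j"] by simp
  then show ?thesis
    using C[of v] assms skew[of v "u j"]
    by (subst (1 2) prod.remove[of _ j]) auto
qed

text \<open>The sum is additive in each block. Replacing the last block by the union of all blocks gives
  \<open>0\<close> by hypothesis, and replacing it by another block gives \<open>0\<close> by antisymmetry.\<close>

lemma alternating_sum_zero:
  fixes g :: "nat \<Rightarrow> 'b \<Rightarrow> 'p" and wt :: "nat \<Rightarrow> 'b \<Rightarrow> 'a"
  assumes fin: "\<And>j. j \<in> {1..Suc r} \<Longrightarrow> finite (Y j)"
    and zero: "\<And>u :: nat \<Rightarrow> 'p. (\<Sum>j=1..Suc r. \<Sum>y\<in>Y j. wt j y * (\<Prod>i=1..r. \<phi> (u i) (g j y))) = 0"
  shows "(\<Sum>k\<in>PiE {1..Suc r} Y. vand (Suc r) (\<lambda>i. g i (k i)) * (\<Prod>i=1..Suc r. wt i (k i))) = 0"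
proof -
  define B where "B = PiE {1..r} Y"
  have finB: "finite B" unfolding B_def using fin by (intro finite_PiE) auto
  define F where "F k j y = vand r (\<lambda>i. g i (k i)) * (\<Prod>i=1..r. wt i (k i))
      * (wt j y * (\<Prod>i=1..r. \<phi> (g i (k i)) (g j y)))" for k j y
  have "(\<Sum>k\<in>PiE {1..Suc r} Y. vand (Suc r) (\<lambda>i. g i (k i)) * (\<Prod>i=1..Suc r. wt i (k i)))
      = (\<Sum>k\<in>B. \<Sum>y\<in>Y (Suc r). F k (Suc r) y)"
    unfolding sum_PiE_Suc B_def[symmetric]
  proof (intro sum.cong refl)
    fix k y
    have "vand r (\<lambda>i. g i ((k(Suc r := y)) i)) = vand r (\<lambda>i. g i (k i))"
      by (intro vand_cong) auto
    moreover have "(\<Prod>i=1..r. wt i ((k(Suc r := y)) i)) = (\<Prod>i=1..r. wt i (k i))"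
      by (intro prod.cong) auto
    moreover have "(\<Prod>i=1..r. \<phi> (g i ((k(Suc r := y)) i)) (g (Suc r) y))
        = (\<Prod>i=1..r. \<phi> (g i (k i)) (g (Suc r) y))"
      by (intro prod.cong) auto
    ultimately show "vand (Suc r) (\<lambda>i. g i ((k(Suc r := y)) i)) * (\<Prod>i=1..Suc r. wt i ((k(Suc r := y)) i))
        = F k (Suc r) y"
      by (simp add: vand_Suc F_def)
  qed
  \<comment> \<open>With the first r points fixed, the sum over the last block is minus the sum over
    the other blocks.\<close>
  also have "\<dots> = (\<Sum>k\<in>B. - (\<Sum>j=1..r. \<Sum>y\<in>Y j. F k j y))"
  proof (rule sum.cong)
    fix k
    have "(\<Sum>j=1..Suc r. \<Sum>y\<in>Y j. F k j y) = 0"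
      unfolding F_def sum_distrib_left[symmetric] using zero[of "\<lambda>i. g i (k i)"] by simp
    then show "(\<Sum>y\<in>Y (Suc r). F k (Suc r) y) = - (\<Sum>j=1..r. \<Sum>y\<in>Y j. F k j y)"
      by (simp add: eq_neg_iff_add_eq_0 add.commute)
  qed simp
  also have "\<dots> = - (\<Sum>j=1..r. \<Sum>k\<in>B. \<Sum>y\<in>Y j. F k j y)"
    unfolding sum_negf by (subst sum.swap) simp
  also have "(\<Sum>j=1..r. \<Sum>k\<in>B. \<Sum>y\<in>Y j. F k j y) = (\<Sum>j=1..r. 0)"
  proof (rule sum.cong)
    fix j assume j: "j \<in> {1..r}"
    define S where "S = (\<Sum>(k, y)\<in>B \<times> Y j. F k j y)"
    \<comment> \<open>Both \<open>k j\<close> and \<open>y\<close> range over block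
      \<open>j\<close>, so exchanging them is an involution of the index set; it reverses the sign
      of \<open>F\<close>.\<close>
    have "S = (\<Sum>(k, y)\<in>B \<times> Y j. F (k(j := y)) j (k j))"
      unfolding S_def
      by (rule sum.reindex_bij_witness[of _ "\<lambda>(k, y). (k(j := y), k j)" "\<lambda>(k, y). (k(j := y), k j)"])
        (use j in \<open>auto simp: B_def PiE_iff extensional_def split: if_splits\<close>)
    also have "\<dots> = (\<Sum>(k, y)\<in>B \<times> Y j. - F k j y)"
    proof (rule sum.cong)
      fix p assume "p \<in> B \<times> Y j"
      obtain k y where p: "p = (k, y)" by (cases p)
      have gu: "(\<lambda>i. g i ((k(j := y)) i)) = (\<lambda>i. g i (k i))(j := g j y)" by auto
      have "(\<Prod>i=1..r. wt i ((k(j := y)) i)) * wt j (k j) = (\<Prod>i=1..r. wt i (k i)) * wt j y"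
        using j by (subst (1 2) prod.remove[of _ j]) (auto simp: mult_ac)
      then have "F (k(j := y)) j (k j) = (\<Prod>i=1..r. wt i (k i)) * wt j y *
          (vand r ((\<lambda>i. g i (k i))(j := g j y)) *
           (\<Prod>i=1..r. \<phi> (((\<lambda>i. g i (k i))(j := g j y)) i) (g j (k j))))"
        unfolding F_def gu[symmetric] by (simp add: mult_ac)
      also have "\<dots> = - F k j y"
        unfolding F_def vand_swap[OF j, of "\<lambda>i. g i (k i)" "g j y"] by (simp add: mult_ac)
      finally show "(case p of (k, y) \<Rightarrow> F (k(j := y)) j (k j)) = (case p of (k, y) \<Rightarrow> - F k j y)"
        using p by simp
    qed simp
    also have "\<dots> = - S" unfolding S_def by (simp add: sum_negf split_def)
    finally have "S = 0" by simp
    then show "(\<Sum>k\<in>B. \<Sum>y\<in>Y j. F k j y) = 0"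
      unfolding S_def by (simp add: sum.cartesian_product)
  qed simp
  finally show ?thesis by simp
qed

text \<open>The denominator that \<open>partial_fraction\<close> attaches to the node
  \<open>(j, s)\<close> when the nodes are all points of all blocks.\<close>

definition grid_den :: "nat \<Rightarrow> (nat \<Rightarrow> nat) \<Rightarrow> (nat \<Rightarrow> nat \<Rightarrow> 'p) \<Rightarrow> nat \<Rightarrow> nat \<Rightarrow> 'a" where
  "grid_den r n z j s = (\<Prod>(i, t)\<in>(SIGMA i:{1..r}. {0..n i}) - {(j, s)}. \<phi> (z i t) (z j s))"

definition grid_distinct :: "nat \<Rightarrow> (nat \<Rightarrow> nat) \<Rightarrow> (nat \<Rightarrow> nat \<Rightarrow> 'p) \<Rightarrow> bool" where
  "grid_distinct r n z \<longleftrightarrow> (\<forall>i\<in>{1..r}. \<forall>t\<in>{0..n i}. \<forall>j\<in>{1..r}. \<forall>s\<in>{0..n j}.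
     (i, t) \<noteq> (j, s) \<longrightarrow> \<phi> (z i t) (z j s) \<noteq> 0)"

lemma grid_den_nz:
  assumes "grid_distinct r n z" "j \<in> {1..r}" "s \<le> n j"
  shows "grid_den r n z j s \<noteq> 0"
proof -
  have s: "s \<in> {0..n j}" using assms by simp
  have "\<phi> (z i t) (z j s) \<noteq> 0" if "i \<in> {1..r}" "t \<in> {0..n i}" "(i, t) \<noteq> (j, s)" for i t
    using assms(1)[unfolded grid_distinct_def, rule_format, OF that(1,2) assms(2) s that(3)] .
  then have "(case p of (i, t) \<Rightarrow> \<phi> (z i t) (z j s)) \<noteq> 0"
    if "p \<in> (SIGMA i:{1..r}. {0..n i}) - {(j, s)}" for p
    using that by (metis (mono_tags, lifting) DiffE SigmaE case_prod_conv insertI1)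
  then show ?thesis
    unfolding grid_den_def by (simp add: prod_zero_iff del: SigmaE)
qed

lemma grid_den_Suc:
  assumes "j \<in> {1..r}"
  shows "grid_den (Suc r) n z j s = grid_den r n z j s * (\<Prod>t=0..n (Suc r). \<phi> (z (Suc r) t) (z j s))"
proof -
  let ?g = "\<lambda>(i, t). \<phi> (z i t) (z j s)"
  have eq: "(SIGMA i:{1..Suc r}. {0..n i}) - {(j, s)}
      = ((SIGMA i:{1..r}. {0..n i}) - {(j, s)}) \<union> {Suc r} \<times> {0..n (Suc r)}"
    using assms by (auto simp: le_Suc_eq)
  have "prod ?g ({Suc r} \<times> {0..n (Suc r)}) = (\<Prod>t=0..n (Suc r). \<phi> (z (Suc r) t) (z j s))"
    by (simp add: prod.cartesian_product[symmetric])
  then show ?thesis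
    unfolding grid_den_def eq by (subst prod.union_disjoint) auto
qed

lemma grid_den_last:
  "grid_den (Suc r) n z (Suc r) s = (\<Prod>i=1..r. \<Prod>t=0..n i. \<phi> (z i t) (z (Suc r) s))
    * (\<Prod>t\<in>{0..n (Suc r)} - {s}. \<phi> (z (Suc r) t) (z (Suc r) s))"
proof -
  let ?g = "\<lambda>(i, t). \<phi> (z i t) (z (Suc r) s)"
  have eq: "(SIGMA i:{1..Suc r}. {0..n i}) - {(Suc r, s)}
      = (SIGMA i:{1..r}. {0..n i}) \<union> {Suc r} \<times> ({0..n (Suc r)} - {s})"
    by (auto simp: le_Suc_eq)
  have "prod ?g ({Suc r} \<times> ({0..n (Suc r)} - {s}))
      = (\<Prod>t\<in>{0..n (Suc r)} - {s}. \<phi> (z (Suc r) t) (z (Suc r) s))"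
    by (simp add: prod.cartesian_product[symmetric])
  moreover have "prod ?g (SIGMA i:{1..r}. {0..n i}) = (\<Prod>i=1..r. \<Prod>t=0..n i. \<phi> (z i t) (z (Suc r) s))"
    by (subst prod.Sigma) auto
  ultimately show ?thesis
    unfolding grid_den_def eq by (subst prod.union_disjoint) auto
qed

text \<open>The count is the one of \<open>partial_fraction\<close>: the union of the blocks has
  (sum of n i) + r nodes, and the numerator has the |L| given factors and r - 1 Vandermonde factors
  joining the free point to the others.\<close>

lemma box_sum_zero:
  fixes w :: "'l \<Rightarrow> 'p"
  assumes "finite L" and card: "card L + 1 = (\<Sum>i=1..r. n i)"
    and dist: "grid_distinct r n z"
  shows "(\<Sum>k\<in>box r n. vand r (\<lambda>i. z i (k i))
      * (\<Prod>j=1..r. (\<Prod>l\<in>L. \<phi> (w l) (z j (k j))) / grid_den r n z j (k j))) = 0"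
proof -
  obtain m where m: "r = Suc m" using card by (cases r) auto
  let ?I = "SIGMA i:{1..r}. {0..n i}"
  have cI: "card ?I = card L + m + 2"
    using card by (subst card_SigmaI) (auto simp: m sum_Suc)
  have "(\<Sum>j=1..Suc m. \<Sum>y=0..n j. (\<Prod>l\<in>L. \<phi> (w l) (z j y)) / grid_den r n z j y
      * (\<Prod>i=1..m. \<phi> (u i) (z j y))) = 0" for u
  proof -
    define L' where "L' = L <+> {1..m}"
    define w' where "w' = case_sum w u"
    have L': "(\<Prod>l\<in>L'. \<phi> (w' l) x) = (\<Prod>l\<in>L. \<phi> (w l) x) * (\<Prod>i=1..m. \<phi> (u i) x)" for x
      unfolding L'_def w'_def using assms(1) by (subst prod.Plus) auto
    have "(\<Sum>q\<in>?I. (\<Prod>l\<in>L'. \<phi> (w' l) (case q of (i, t) \<Rightarrow> z i t))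
        / (\<Prod>p\<in>?I - {q}. \<phi> (case p of (i, t) \<Rightarrow> z i t) (case q of (i, t) \<Rightarrow> z i t))) = 0"
      by (rule partial_fraction)
        (use assms(1) cI dist in \<open>auto simp: L'_def card_Plus grid_distinct_def\<close>)
    then show ?thesis
      unfolding m[symmetric] L' by (subst sum.Sigma) (auto simp: grid_den_def split_def)
  qed
  then show ?thesis
    unfolding m by (intro alternating_sum_zero) auto
qed

end

section \<open>The Jackson sum of type C\<close>

text \<open>Used to compare products whose ranges depend on k: only the ratios of consecutive terms
  have to agree. The conclusion is cross-multiplied so that no initial value has to be
  inverted.\<close>

lemma recurrence_unique:
  fixes f g :: "nat \<Rightarrow> 'a::field"
  assumes "\<And>k. k < n \<Longrightarrow> f (Suc k) * b k = f k * a k"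
    and "\<And>k. k < n \<Longrightarrow> g (Suc k) * b k = g k * a k"
    and "\<And>k. k < n \<Longrightarrow> b k \<noteq> 0" and "k \<le> n"
  shows "f k * g 0 = f 0 * g k"
  using \<open>k \<le> n\<close>
proof (induction k)
  case (Suc k)
  have "f (Suc k) * g 0 * b k = f 0 * g (Suc k) * b k"
    using Suc assms(1)[of k] assms(2)[of k] by (metis Suc_leD Suc_le_lessD mult.assoc mult.commute)
  then show ?case using assms(3)[of k] Suc by simp
qed simp

lemma prod_shift_telescope:
  fixes h :: "nat \<Rightarrow> 'a::comm_monoid_mult"
  shows "(\<Prod>t<n. h (Suc t)) * h 0 = (\<Prod>t<n. h t) * h n"
  by (metis prod.lessThan_Suc prod.lessThan_Suc_shift mult.commute)

text \<open>\<open>three_term\<close> is Weierstrass's addition formula, arranged as the Pluecker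
  relation of \<open>phi\<close>. \<open>K\<close> is the logarithm of the base of the shifted
  factorials; \<open>step_nz\<close> is the additive form of the condition that no nontrivial power
  of the base lies in p^Z.\<close>

locale odd_theta =
  fixes \<sigma> :: "complex \<Rightarrow> complex" and K :: complex
  assumes odd: "\<sigma> (- u) = - \<sigma> u"
    and three_term: "\<sigma> (x + y) * \<sigma> (x - y) * (\<sigma> (u + v) * \<sigma> (u - v))
      = \<sigma> (x + u) * \<sigma> (x - u) * (\<sigma> (y + v) * \<sigma> (y - v))
        - \<sigma> (x + v) * \<sigma> (x - v) * (\<sigma> (y + u) * \<sigma> (y - u))"
    and step_nz: "\<And>t :: int. t \<noteq> 0 \<Longrightarrow> \<sigma> (of_int t * K) \<noteq> 0"
begin

text \<open>Even in both arguments; this invariance under sign changes is what makes the sums type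
  C.\<close>

definition phi :: "complex \<Rightarrow> complex \<Rightarrow> complex" where
  "phi x y = \<sigma> (x + y) * \<sigma> (x - y)"

sublocale pluecker_form phi
proof
  show "phi x y = - phi y x" for x y
    using odd[of "y - x"] by (simp add: phi_def add.commute)
  show "phi x y * phi u v = phi x u * phi y v - phi x v * phi y u" for x y u v
    using three_term[of x y u v] by (simp add: phi_def)
qed

lemma sigma_0 [simp]: "\<sigma> 0 = 0"
  using odd[of 0] by simp

text \<open>Invariant under shifts by multiples of \<open>K\<close>, so that one condition covers
  all factors of a shifted factorial of any length.\<close>

definition regular :: "complex \<Rightarrow> bool" where
  "regular u \<longleftrightarrow> (\<forall>t :: int. \<sigma> (u + of_int t * K) \<noteq> 0)"

lemma regular_of_int: "regular u \<Longrightarrow> \<sigma> (u + of_int t * K) \<noteq> 0"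
  by (simp add: regular_def)

lemma regularD: "regular u \<Longrightarrow> v = u + of_int t * K \<Longrightarrow> \<sigma> v \<noteq> 0"
  by (simp add: regular_def)

lemma regularD_neg: "regular u \<Longrightarrow> v = - (u + of_int t * K) \<Longrightarrow> \<sigma> v \<noteq> 0"
  using odd[of "u + of_int t * K"] by (simp add: regular_def)

section \<open>The single-index factors of the Jackson sum\<close>

definition pt :: "(nat \<Rightarrow> complex) \<Rightarrow> nat \<Rightarrow> nat \<Rightarrow> complex" where
  "pt \<xi> i t = \<xi> i + of_nat t * K"

text \<open>Additive form of \<open>(s x; Q)\<^sub>k / (Q x / s; Q)\<^sub>k\<close> multiplied by its denominator for \<open>k = n\<close>, which keeps
  it entire in \<open>s\<close>.\<close>

definition E :: "complex \<Rightarrow> complex \<Rightarrow> nat \<Rightarrow> nat \<Rightarrow> complex" where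
  "E s x n k = (\<Prod>t<k. \<sigma> (x + s + of_nat t * K)) * (\<Prod>t\<in>{k<..n}. \<sigma> (x - s + of_nat t * K))"

abbreviation EE where
  "EE b c d e x n k \<equiv> E b x n k * E c x n k * E d x n k * E e x n k"

lemma E_Suc:
  assumes "k < n"
  shows "E s x n (Suc k) * \<sigma> (x - s + of_nat (Suc k) * K) = E s x n k * \<sigma> (x + s + of_nat k * K)"
proof -
  have "{k<..n} = insert (Suc k) {Suc k<..n}" using assms by auto
  then show ?thesis by (simp add: E_def)
qed

lemma E_nz:
  assumes "regular (x + s)" "regular (x - s)"
  shows "E s x n k \<noteq> 0"
proof -
  have "\<sigma> (x + s + of_nat t * K) \<noteq> 0" "\<sigma> (x - s + of_nat t * K) \<noteq> 0" for t
    using regularD[OF assms(1), of _ "int t"] regularD[OF assms(2), of _ "int t"] by auto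
  then show ?thesis by (simp add: E_def)
qed

text \<open>If b + d is a multiple of \<open>K\<close>, numerator factors of one quotient meet
  denominator factors of the other, and all but l values of \<open>phi\<close> cancel. This brings
  the summand into the form of \<open>box_sum_zero\<close>.\<close>

lemma E_pair:
  assumes "k \<le> n" "regular (x + b)" "regular (x - b)" and d: "d = of_nat (Suc l) * K - b"
  shows "E b x n k * E d x n k * (\<Prod>m<l. phi (b - of_nat (Suc m) * K) x)
    = E b x n 0 * E d x n 0 * (\<Prod>m<l. phi (b - of_nat (Suc m) * K) (x + of_nat k * K))"
proof -
  define g where "g k = (\<Prod>m<l. phi (b - of_nat (Suc m) * K) (x + of_nat k * K))" for k
  define A where "A k = \<sigma> (x + b + of_nat k * K) * \<sigma> (x + d + of_nat k * K)" for k
  define B where "B k = \<sigma> (x - b + of_nat (Suc k) * K) * \<sigma> (x - d + of_nat (Suc k) * K)" for k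
  have B: "B k \<noteq> 0" for k
    unfolding B_def
    using regularD[OF assms(3), of _ "int (Suc k)"] regularD[OF assms(2), of _ "int k - int l"]
    by (auto simp: d algebra_simps)
  have g: "g (Suc k) * B k = g k * A k" for k
  proof -
    define h1 where "h1 m = \<sigma> (x + b + (of_nat k - of_nat m) * K)" for m :: nat
    define h2 where "h2 m = \<sigma> (b - x - of_nat (Suc (m + k)) * K)" for m :: nat
    have g0: "g k = (\<Prod>m<l. h1 (Suc m)) * (\<Prod>m<l. h2 m)"
      unfolding g_def h1_def h2_def prod.distrib[symmetric] phi_def
      by (intro prod.cong) (auto simp: algebra_simps)
    have g1: "g (Suc k) = (\<Prod>m<l. h1 m) * (\<Prod>m<l. h2 (Suc m))"
      unfolding g_def h1_def h2_def prod.distrib[symmetric] phi_def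
      by (intro prod.cong) (auto simp: algebra_simps)
    have Ak: "A k = - (h1 0 * h2 l)"
      using odd[of "x + d + of_nat k * K"] by (simp add: A_def h1_def h2_def d algebra_simps)
    have Bk: "B k = - (h2 0 * h1 l)"
      using odd[of "x - b + of_nat (Suc k) * K"] by (simp add: B_def h1_def h2_def d algebra_simps)
    show ?thesis
      unfolding g0 g1 Ak Bk
      using prod_shift_telescope[of h1 l] prod_shift_telescope[of h2 l]
      by (simp add: mult_ac)
  qed
  have "(E b x n k * E d x n k) * g 0 = (E b x n 0 * E d x n 0) * g k"
  proof (rule recurrence_unique[of n _ B A])
    fix k assume k: "k < n"
    have "E b x n (Suc k) * E d x n (Suc k) * B k
        = (E b x n (Suc k) * \<sigma> (x - b + of_nat (Suc k) * K)) * (E d x n (Suc k) * \<sigma> (x - d + of_nat (Suc k) * K))"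
      unfolding B_def by (simp only: mult_ac)
    also have "\<dots> = E b x n k * E d x n k * A k"
      unfolding E_Suc[OF k] A_def by (simp only: mult_ac)
    finally show "E b x n (Suc k) * E d x n (Suc k) * B k = E b x n k * E d x n k * A k" .
  qed (use g B assms in auto)
  then show ?thesis by (simp add: g_def)
qed

text \<open>Shifting the parameter by l K changes the quotient by values of \<open>phi\<close> at
  the l points y + t K. In \<open>jackson_reduce\<close> these are the points of the last block
  below its top.\<close>

lemma E_reduce:
  assumes "k \<le> n" "regular (x - y)" "regular (x + y)" and d: "d = y + of_nat l * K"
  shows "E d x n k * ((\<Prod>t<l. phi (y + of_nat t * K) x) * E y x n 0)
    = E d x n 0 * ((\<Prod>t<l. phi (y + of_nat t * K) (x + of_nat k * K)) * E y x n k)"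
proof -
  define g where "g k = (\<Prod>t<l. phi (y + of_nat t * K) (x + of_nat k * K))" for k
  define A where "A k = \<sigma> (x + d + of_nat k * K)" for k
  define B where "B k = \<sigma> (x - d + of_nat (Suc k) * K)" for k
  have B: "B k \<noteq> 0" for k
    unfolding B_def
    using regularD[OF assms(2), of _ "int (Suc k) - int l"]
    by (auto simp: d algebra_simps)
  have g: "(g (Suc k) * E y x n (Suc k)) * B k = (g k * E y x n k) * A k" if "k < n" for k
  proof -
    define h1 where "h1 t = \<sigma> (x + y + of_nat (t + k) * K)" for t :: nat
    define h2 where "h2 t = \<sigma> (y - x + (of_nat t - of_nat (Suc k)) * K)" for t :: nat
    have g0: "g k = (\<Prod>m<l. h1 m) * (\<Prod>m<l. h2 (Suc m))"
      unfolding g_def h1_def h2_def prod.distrib[symmetric] phi_def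
      by (intro prod.cong) (auto simp: algebra_simps)
    have g1: "g (Suc k) = (\<Prod>m<l. h1 (Suc m)) * (\<Prod>m<l. h2 m)"
      unfolding g_def h1_def h2_def prod.distrib[symmetric] phi_def
      by (intro prod.cong) (auto simp: algebra_simps)
    have Ak: "A k = h1 l"
      by (simp add: A_def h1_def d algebra_simps)
    have Bk: "B k = - h2 l"
      using odd[of "x - d + of_nat (Suc k) * K"] by (simp add: B_def h2_def d algebra_simps)
    have h20: "\<sigma> (x - y + of_nat (Suc k) * K) = - h2 0"
      using odd[of "x - y + of_nat (Suc k) * K"] by (simp add: h2_def algebra_simps)
    have h10: "\<sigma> (x + y + of_nat k * K) = h1 0"
      by (simp add: h1_def)
    have ne: "h1 0 \<noteq> 0" "h2 0 \<noteq> 0"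
      using regularD[OF assms(3), of _ "int k"] regularD_neg[OF assms(2), of _ "int (Suc k)"]
      by (auto simp: h1_def h2_def algebra_simps)
    have E1: "E y x n (Suc k) * (- h2 0) = E y x n k * h1 0"
      using E_Suc[OF that, of y x] unfolding h20 h10 .
    have t1: "(\<Prod>m<l. h1 (Suc m)) * h1 0 = (\<Prod>m<l. h1 m) * h1 l"
      and t2: "(\<Prod>m<l. h2 (Suc m)) * h2 0 = (\<Prod>m<l. h2 m) * h2 l"
      by (rule prod_shift_telescope)+
    have "(g (Suc k) * E y x n (Suc k)) * B k * (h1 0 * h2 0)
      = ((\<Prod>m<l. h1 (Suc m)) * h1 0) * ((\<Prod>m<l. h2 m) * h2 l) * (E y x n (Suc k) * (- h2 0))"
      unfolding g1 Bk by (simp add: mult_ac)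
    also have "\<dots> = (g k * E y x n k) * A k * (h1 0 * h2 0)"
      unfolding t1 t2[symmetric] E1 g0 Ak by (simp add: mult_ac)
    finally show ?thesis using ne by simp
  qed
  have "E d x n k * (g 0 * E y x n 0) = E d x n 0 * (g k * E y x n k)"
    by (rule recurrence_unique[of n "\<lambda>k. E d x n k" B A "\<lambda>k. g k * E y x n k"])
      (use g B assms E_Suc[of _ n d x] in \<open>auto simp: A_def B_def\<close>)
  then show ?thesis by (simp add: g_def)
qed

text \<open>With d + e = 2 h fixed, the factors for d and e with the same index combine to one value
  of \<open>phi\<close> at \<delta>. Their number is n for every k, so all terms of the sum have the
  same degree in \<delta>, as interpolation requires.\<close>

lemma E_as_phi:
  assumes "k \<le> n" "d = \<delta> + h" "e = h - \<delta>"
  shows "E d x n k * E e x n k = (\<Prod>t=1..n.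
    phi (if t \<le> k then x + of_nat (t - 1) * K + h else x + of_nat t * K - h) \<delta>)"
proof -
  have split: "(\<Prod>t=1..n. F t) = (\<Prod>t<k. F (Suc t)) * (\<Prod>t\<in>{k<..n}. F t)" for F :: "nat \<Rightarrow> complex"
  proof -
    have "{1..n} = Suc ` {..<k} \<union> {k<..n}" using assms(1)
      by (auto simp: image_iff) (metis Suc_pred less_Suc_eq_le not_le lessThan_iff Suc_le_eq)
    moreover have "Suc ` {..<k} \<inter> {k<..n} = {}" by auto
    ultimately show ?thesis by (simp add: prod.union_disjoint prod.reindex)
  qed
  have 1: "(\<Prod>t<k. \<sigma> (x + d + of_nat t * K)) * (\<Prod>t<k. \<sigma> (x + e + of_nat t * K))
    = (\<Prod>t<k. phi (x + of_nat t * K + h) \<delta>)"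
    unfolding prod.distrib[symmetric] phi_def assms(2,3) by (intro prod.cong) (auto simp: algebra_simps)
  have 2: "(\<Prod>t\<in>{k<..n}. \<sigma> (x - d + of_nat t * K)) * (\<Prod>t\<in>{k<..n}. \<sigma> (x - e + of_nat t * K))
    = (\<Prod>t\<in>{k<..n}. phi (x + of_nat t * K - h) \<delta>)"
    unfolding prod.distrib[symmetric] phi_def assms(2,3) by (intro prod.cong) (auto simp: algebra_simps)
  show ?thesis
    unfolding split E_def using 1 2 by (simp add: mult_ac)
qed

text \<open>The part of the evaluation that is free of b, c, d, e. It is kept on the side of the
  sum, so that neither side has a denominator depending on these parameters.\<close>

definition jackson_den :: "nat \<Rightarrow> (nat \<Rightarrow> complex) \<Rightarrow> (nat \<Rightarrow> nat) \<Rightarrow> complex" where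
  "jackson_den r \<xi> n = (\<Prod>j=1..r. \<Prod>t=1..n j. \<sigma> (of_nat t * K))
    * (\<Prod>i=1..r. \<Prod>j\<in>{i<..r}. (\<Prod>t=0..n j. \<sigma> (\<xi> j - \<xi> i + of_nat t * K))
       * (\<Prod>t=1..n i. \<sigma> (\<xi> i - \<xi> j + of_nat t * K))
       * (\<Prod>t=0..n i + n j. \<sigma> (\<xi> i + \<xi> j + of_nat t * K)))"

definition jackson_sum where
  "jackson_sum r \<xi> n b c d e = (\<Sum>k\<in>box r n. vand r (\<lambda>i. pt \<xi> i (k i))
     * (\<Prod>j=1..r. EE b c d e (\<xi> j) (n j) (k j) / grid_den r n (pt \<xi>) j (k j)))"

definition jackson_prod where
  "jackson_prod N b c d e =
     (\<Prod>l=1..N. \<sigma> (of_nat l * K - b - c) * \<sigma> (of_nat l * K - b - d) * \<sigma> (of_nat l * K - b - e))"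

definition gen_points :: "nat \<Rightarrow> (nat \<Rightarrow> complex) \<Rightarrow> bool" where
  "gen_points r \<xi> \<longleftrightarrow> (\<forall>i\<in>{1..r}. regular (2 * \<xi> i)
      \<and> (\<forall>j\<in>{1..r}. i \<noteq> j \<longrightarrow> regular (\<xi> i + \<xi> j) \<and> regular (\<xi> i - \<xi> j)))"

lemma grid_distinct_pt:
  assumes "gen_points r \<xi>"
  shows "grid_distinct r n (pt \<xi>)"
  unfolding grid_distinct_def
proof (intro ballI impI)
  fix i t j s
  assume *: "i \<in> {1..r}" "t \<in> {0..n i}" "j \<in> {1..r}" "s \<in> {0..n j}" "(i, t) \<noteq> (j, s)"
  have sum: "pt \<xi> i t + pt \<xi> j s = \<xi> i + \<xi> j + of_int (int t + int s) * K"
    and diff: "pt \<xi> i t - pt \<xi> j s = \<xi> i - \<xi> j + of_int (int t - int s) * K"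
    by (simp_all add: pt_def algebra_simps)
  have "\<sigma> (\<xi> i + \<xi> j + of_int (int t + int s) * K) \<noteq> 0"
  proof (cases "i = j")
    case True
    have "regular (2 * \<xi> i)" using assms *(1) unfolding gen_points_def by blast
    then show ?thesis unfolding True mult_2 by (rule regular_of_int)
  next
    case False
    then have "regular (\<xi> i + \<xi> j)" using assms *(1,3) unfolding gen_points_def by blast
    then show ?thesis by (rule regular_of_int)
  qed
  moreover have "\<sigma> (\<xi> i - \<xi> j + of_int (int t - int s) * K) \<noteq> 0"
  proof (cases "i = j")
    case True
    then have "int t - int s \<noteq> 0" using *(5) by simp
    then show ?thesis unfolding True diff_self add_0 by (rule step_nz)
  next
    case False
    then have "regular (\<xi> i - \<xi> j)" using assms *(1,3) unfolding gen_points_def by blast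
    then show ?thesis by (rule regular_of_int)
  qed
  ultimately show "phi (pt \<xi> i t) (pt \<xi> j s) \<noteq> 0"
    unfolding phi_def sum diff by (rule no_zero_divisors)
qed

abbreviation pts where
  "pts \<xi> k \<equiv> (\<lambda>i. pt \<xi> i (k i))"

text \<open>Here b + d = l K and c + e = (N + 1 - l) K. Both pairs collapse by
  \<open>E_pair\<close>, leaving (l - 1) + (N - l) = N - 1 values of \<open>phi\<close> per index,
  exactly the number in \<open>box_sum_zero\<close>.\<close>

lemma jackson_sum_zero:
  assumes pts: "gen_points r \<xi>" and N: "(\<Sum>i=1..r. n i) = N"
    and gb: "\<And>i. i \<in> {1..r} \<Longrightarrow> regular (\<xi> i + b) \<and> regular (\<xi> i - b)"
    and gc: "\<And>i. i \<in> {1..r} \<Longrightarrow> regular (\<xi> i + c) \<and> regular (\<xi> i - c)"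
    and d: "d = of_nat l * K - b" and e: "e = of_nat (Suc N - l) * K - c" and l: "1 \<le> l" "l \<le> N"
  shows "jackson_sum r \<xi> n b c d e = 0"
proof -
  define l1 where "l1 = l - 1"
  define l2 where "l2 = N - l"
  have d': "d = of_nat (Suc l1) * K - b" and e': "e = of_nat (Suc l2) * K - c"
    using l by (simp_all add: d e l1_def l2_def Suc_diff_le)
  define w where "w = case_sum (\<lambda>m. b - of_nat (Suc m) * K) (\<lambda>m. c - of_nat (Suc m) * K)"
  define L where "L = {..<l1} <+> {..<l2}"
  have w: "(\<Prod>m\<in>L. phi (w m) u) = (\<Prod>m<l1. phi (b - of_nat (Suc m) * K) u) * (\<Prod>m<l2. phi (c - of_nat (Suc m) * K) u)" for u
    unfolding L_def w_def by (subst prod.Plus) auto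
  have nz: "(\<Prod>m\<in>L. phi (w m) (\<xi> j)) \<noteq> 0" if j: "j \<in> {1..r}" for j
  proof -
    have "phi (s - of_nat (Suc m) * K) (\<xi> j) \<noteq> 0" if "regular (\<xi> j + s)" "regular (\<xi> j - s)" for s m
    proof -
      have "\<sigma> (s - of_nat (Suc m) * K + \<xi> j) \<noteq> 0"
        by (rule regularD[OF that(1), where t = "- int (Suc m)"]) (simp add: algebra_simps)
      moreover have "\<sigma> (s - of_nat (Suc m) * K - \<xi> j) \<noteq> 0"
        by (rule regularD_neg[OF that(2), where t = "int (Suc m)"]) (simp add: algebra_simps)
      ultimately show ?thesis by (simp add: phi_def)
    qed
    then show ?thesis unfolding w using gb[OF j] gc[OF j] by auto
  qed
  define C where "C j = E b (\<xi> j) (n j) 0 * E d (\<xi> j) (n j) 0 * (E c (\<xi> j) (n j) 0 * E e (\<xi> j) (n j) 0)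
     / (\<Prod>m\<in>L. phi (w m) (\<xi> j))" for j
  have EC: "EE b c d e (\<xi> j) (n j) k
      = C j * (\<Prod>m\<in>L. phi (w m) (pt \<xi> j k))" if j: "j \<in> {1..r}" "k \<le> n j" for j k
  proof -
    have "EE b c d e (\<xi> j) (n j) k * (\<Prod>m\<in>L. phi (w m) (\<xi> j))
      = (E b (\<xi> j) (n j) k * E d (\<xi> j) (n j) k * (\<Prod>m<l1. phi (b - of_nat (Suc m) * K) (\<xi> j)))
        * (E c (\<xi> j) (n j) k * E e (\<xi> j) (n j) k * (\<Prod>m<l2. phi (c - of_nat (Suc m) * K) (\<xi> j)))"
      unfolding w by (simp only: mult_ac)
    also have "\<dots> = C j * (\<Prod>m\<in>L. phi (w m) (pt \<xi> j k)) * (\<Prod>m\<in>L. phi (w m) (\<xi> j))"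
      unfolding E_pair[OF j(2) conjunct1[OF gb[OF j(1)]] conjunct2[OF gb[OF j(1)]] d']
        E_pair[OF j(2) conjunct1[OF gc[OF j(1)]] conjunct2[OF gc[OF j(1)]] e']
      using nz[OF j(1)] by (simp add: C_def w pt_def)
    finally show ?thesis using nz[OF j(1)] by simp
  qed
  have "jackson_sum r \<xi> n b c d e = (\<Prod>j=1..r. C j) * (\<Sum>k\<in>box r n.
     vand r (pts \<xi> k) * (\<Prod>j=1..r. (\<Prod>m\<in>L. phi (w m) (pt \<xi> j (k j))) / grid_den r n (pt \<xi>) j (k j)))"
    unfolding jackson_sum_def sum_distrib_left
  proof (rule sum.cong)
    fix k assume k: "k \<in> box r n"
    have H: "(\<Prod>j=1..r. EE b c d e (\<xi> j) (n j) (k j) / grid_den r n (pt \<xi>) j (k j))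
      = (\<Prod>j=1..r. C j * ((\<Prod>m\<in>L. phi (w m) (pt \<xi> j (k j))) / grid_den r n (pt \<xi>) j (k j)))"
      using k by (intro prod.cong) (auto simp: EC PiE_iff)
    show "vand r (pts \<xi> k)
     * (\<Prod>j=1..r. EE b c d e (\<xi> j) (n j) (k j) / grid_den r n (pt \<xi>) j (k j))
     = (\<Prod>j=1..r. C j) * (vand r (pts \<xi> k) *
       (\<Prod>j=1..r. (\<Prod>m\<in>L. phi (w m) (pt \<xi> j (k j))) / grid_den r n (pt \<xi>) j (k j)))"
      unfolding H prod.distrib by (simp only: mult_ac)
  qed simp
  also have "\<dots> = 0"
    using box_sum_zero[of L n r "pt \<xi>" w] grid_distinct_pt[OF pts] N l
    by (simp add: L_def card_Plus l1_def l2_def)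
  finally show ?thesis .
qed

section \<open>Collapse of the Jackson sum to smaller rank, and its evaluation\<close>

lemma regular_shift: "regular u \<Longrightarrow> v = u + of_int t * K \<Longrightarrow> regular v"
  unfolding regular_def
proof
  fix s assume "\<forall>t::int. \<sigma> (u + of_int t * K) \<noteq> 0" "v = u + of_int t * K"
  then show "\<sigma> (v + of_int s * K) \<noteq> 0"
    by (metis (no_types, opaque_lifting) add.assoc distrib_right of_int_add)
qed

lemma regular_minus: "regular u \<Longrightarrow> regular (- u)"
  unfolding regular_def
proof
  fix s assume *: "\<forall>t::int. \<sigma> (u + of_int t * K) \<noteq> 0"
  have "- u + of_int s * K = - (u + of_int (- s) * K)" by simp
  then show "\<sigma> (- u + of_int s * K) \<noteq> 0"
    using * odd by (metis neg_equal_0_iff_equal)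
qed

lemma regular_minus_shift: "regular u \<Longrightarrow> v = - u + of_int t * K \<Longrightarrow> regular v"
  by (rule regular_shift[OF regular_minus])

abbreviation tail_prod where
  "tail_prod s y b c e \<equiv> (\<Prod>t<s. \<sigma> (y + b + of_nat t * K) * \<sigma> (y + c + of_nat t * K) * \<sigma> (y + e + of_nat t * K))"

text \<open>For the pairs (b, c) and (b, e) the s surplus factors are the last ones, rewritten by
  the balancing condition. For the pair of b and the shifted parameter they are the first ones, read
  backwards, and oddness gives each of them a sign.\<close>

lemma jackson_prod_split:
  assumes "b + c + y + of_nat s * K + e = of_nat (Suc (N + s)) * K"
  shows "jackson_prod (N + s) b c (y + of_nat s * K) e = jackson_prod N b c y e * (- 1) ^ s
    * tail_prod s y b c e"
proof -
  have split1: "(\<Prod>l=1..N + s. f l) = (\<Prod>l=1..N. f l) * (\<Prod>t<s. f (N + Suc t))" for f :: "nat \<Rightarrow> complex"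
  proof -
    have "(\<Prod>l=1..N + s. f l) = (\<Prod>l=1..N. f l) * (\<Prod>l\<in>{N + 1..N + s}. f l)"
      by (rule prod.ub_add_nat) simp
    also have "(\<Prod>l\<in>{N + 1..N + s}. f l) = (\<Prod>l=1..s. f (l + N))"
      using prod.shift_bounds_cl_nat_ivl[of f 1 N s] by (simp add: add.commute)
    also have "\<dots> = (\<Prod>t<s. f (Suc t + N))" by (simp add: prod.atLeast1_atMost_eq)
    finally show ?thesis by (simp add: add.commute)
  qed
  have split2: "(\<Prod>l=1..N + s. f l) = (\<Prod>l=1..N. f (l + s)) * (\<Prod>t<s. f (s - t))" for f :: "nat \<Rightarrow> complex"
  proof -
    have "(\<Prod>l=1..s + N. f l) = (\<Prod>l=1..s. f l) * (\<Prod>l\<in>{s + 1..s + N}. f l)"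
      by (rule prod.ub_add_nat) simp
    also have "(\<Prod>l\<in>{s + 1..s + N}. f l) = (\<Prod>l=1..N. f (l + s))"
      using prod.shift_bounds_cl_nat_ivl[of f 1 s N] by (simp add: add.commute)
    also have "(\<Prod>l=1..s. f l) = (\<Prod>t<s. f (Suc t))" by (simp add: prod.atLeast1_atMost_eq)
    also have "\<dots> = (\<Prod>t<s. f (Suc (s - Suc t)))"
      by (rule prod.nat_diff_reindex[symmetric])
    also have "\<dots> = (\<Prod>t<s. f (s - t))"
      by (intro prod.cong) (auto simp: Suc_diff_Suc)
    finally show ?thesis by (simp add: mult.commute add.commute)
  qed
  have P1: "(\<Prod>l=1..N + s. \<sigma> (of_nat l * K - b - c))
     = (\<Prod>l=1..N. \<sigma> (of_nat l * K - b - c)) * (\<Prod>t<s. \<sigma> (y + e + of_nat t * K))"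
    unfolding split1 using assms by (intro arg_cong2[of _ _ _ _ "(*)"] prod.cong arg_cong[of _ _ \<sigma>]) (auto simp: algebra_simps)
  have P3: "(\<Prod>l=1..N + s. \<sigma> (of_nat l * K - b - e))
     = (\<Prod>l=1..N. \<sigma> (of_nat l * K - b - e)) * (\<Prod>t<s. \<sigma> (y + c + of_nat t * K))"
    unfolding split1 using assms by (intro arg_cong2[of _ _ _ _ "(*)"] prod.cong arg_cong[of _ _ \<sigma>]) (auto simp: algebra_simps)
  have "(\<Prod>t<s. \<sigma> (of_nat (s - t) * K - b - (y + of_nat s * K))) = (\<Prod>t<s. - \<sigma> (y + b + of_nat t * K))"
  proof (rule prod.cong)
    fix t assume "t \<in> {..<s}"
    then have "of_nat (s - t) * K - b - (y + of_nat s * K) = - (y + b + of_nat t * K)"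
      by (simp add: of_nat_diff algebra_simps)
    then show "\<sigma> (of_nat (s - t) * K - b - (y + of_nat s * K)) = - \<sigma> (y + b + of_nat t * K)"
      by (simp only: odd)
  qed simp
  also have "\<dots> = (- 1) ^ s * (\<Prod>t<s. \<sigma> (y + b + of_nat t * K))"
    using prod.distrib[of "\<lambda>_. - 1" "\<lambda>t. \<sigma> (y + b + of_nat t * K)" "{..<s}"] by simp
  finally have P2: "(\<Prod>l=1..N + s. \<sigma> (of_nat l * K - b - (y + of_nat s * K)))
     = (\<Prod>l=1..N. \<sigma> (of_nat l * K - b - y)) * ((- 1) ^ s * (\<Prod>t<s. \<sigma> (y + b + of_nat t * K)))"
    unfolding split2 by (simp add: algebra_simps)
  show ?thesis
    unfolding jackson_prod_def prod.distrib P1 P2 P3 by (simp only: mult_ac)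
qed

lemma jackson_den_Suc:
  "jackson_den (Suc m) \<xi> n = jackson_den m \<xi> n * (\<Prod>t=1..n (Suc m). \<sigma> (of_nat t * K))
    * (\<Prod>i=1..m. (\<Prod>t=0..n (Suc m). \<sigma> (\<xi> (Suc m) - \<xi> i + of_nat t * K))
       * (\<Prod>t=1..n i. \<sigma> (\<xi> i - \<xi> (Suc m) + of_nat t * K))
       * (\<Prod>t=0..n i + n (Suc m). \<sigma> (\<xi> i + \<xi> (Suc m) + of_nat t * K)))"
  unfolding jackson_den_def prod.pairs_Suc
  by (simp only: prod.atLeastAtMost_shift_bounds prod.nat_ivl_Suc' le_add1 plus_1_eq_Suc mult_ac)

text \<open>The values at k = 0 left behind by \<open>E_reduce\<close> recombine with the factors of
  \<open>jackson_den\<close> that pair this index with the last one.\<close>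

lemma jackson_reduce_column:
  fixes x y :: complex
  assumes d: "d = y + of_nat s * K"
  shows "- E d x l 0 * ((\<Prod>t=0..s. \<sigma> (y - x + of_nat t * K)) * (\<Prod>t=1..l. \<sigma> (x - y + of_nat t * K))
        * (\<Prod>t=0..l + s. \<sigma> (x + y + of_nat t * K)))
    = (\<Prod>t=0..l. phi (x + of_nat t * K) d) * ((\<Prod>t<s. phi (y + of_nat t * K) x) * E y x l 0)"
proof -
  have e: "{0<..l} = {1..l}" "{0..s} = insert s {..<s}" "{0..l} = insert 0 {1..l}" by auto
  have E0: "E y x l 0 = (\<Prod>t=1..l. \<sigma> (x - y + of_nat t * K))"
    and Ed: "E d x l 0 = (\<Prod>t=1..l. \<sigma> (x - d + of_nat t * K))" by (simp_all add: E_def e)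
  have a: "(\<Prod>t<s. phi (y + of_nat t * K) x) = (\<Prod>t<s. \<sigma> (x + y + of_nat t * K)) * (\<Prod>t<s. \<sigma> (y - x + of_nat t * K))"
    unfolding phi_def prod.distrib[symmetric] by (intro prod.cong) (auto simp: algebra_simps)
  have b1: "(\<Prod>t=0..l. phi (x + of_nat t * K) d)
      = (\<Prod>t=0..l. \<sigma> (x + d + of_nat t * K)) * (\<Prod>t=0..l. \<sigma> (x - d + of_nat t * K))"
    unfolding phi_def prod.distrib[symmetric] by (intro prod.cong) (auto simp: algebra_simps)
  have b2: "(\<Prod>t=0..l. \<sigma> (x - d + of_nat t * K)) = \<sigma> (x - d) * E d x l 0"
    unfolding Ed e by simp
  have b3: "\<sigma> (x - d) = - \<sigma> (y - x + of_nat s * K)"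
    using odd[of "x - d"] by (simp add: d algebra_simps)
  have c: "(\<Prod>t=0..s. \<sigma> (y - x + of_nat t * K)) = \<sigma> (y - x + of_nat s * K) * (\<Prod>t<s. \<sigma> (y - x + of_nat t * K))"
    unfolding e by simp
  have f: "(\<Prod>t=0..l + s. \<sigma> (x + y + of_nat t * K))
    = (\<Prod>t<s. \<sigma> (x + y + of_nat t * K)) * (\<Prod>t=0..l. \<sigma> (x + d + of_nat t * K))"
  proof -
    have "{0..l + s} = {..<s} \<union> {0 + s..l + s}" by auto
    then have "(\<Prod>t=0..l + s. \<sigma> (x + y + of_nat t * K))
      = (\<Prod>t<s. \<sigma> (x + y + of_nat t * K)) * (\<Prod>t\<in>{0 + s..l + s}. \<sigma> (x + y + of_nat t * K))"
      by (metis (no_types, lifting) prod.union_disjoint finite_lessThan finite_atLeastAtMost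
          ivl_disj_int_one(4) atLeast0LessThan inf_commute add_0 ivl_disj_int_two(7))
    also have "(\<Prod>t\<in>{0 + s..l + s}. \<sigma> (x + y + of_nat t * K)) = (\<Prod>t=0..l. \<sigma> (x + d + of_nat t * K))"
      unfolding prod.shift_bounds_cl_nat_ivl by (simp add: d algebra_simps)
    finally show ?thesis .
  qed
  show ?thesis
    unfolding a b1 b2 b3 c f E0 by (simp only: mult_ac mult_minus_left mult_minus_right)
qed

text \<open>At this \<open>d\<close>, the top point of the last block, the factor of the last index
  vanishes unless that index equals s. The sum collapses to the first m indices, and by
  \<open>E_reduce\<close> the parameter \<open>d\<close> is replaced by \<open>y\<close>
  there.\<close>

lemma jackson_reduce:
  fixes n :: "nat \<Rightarrow> nat"
  assumes pts: "gen_points (Suc m) \<xi>"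
  defines "s \<equiv> n (Suc m)" and "y \<equiv> \<xi> (Suc m)"
  assumes d: "d = y + of_nat s * K"
  shows "jackson_sum (Suc m) \<xi> n b c d e * jackson_den (Suc m) \<xi> n
    = (jackson_sum m \<xi> n b c y e * jackson_den m \<xi> n) * (- 1) ^ s
      * tail_prod s y b c e"
proof -
  let ?D = "grid_den (Suc m) n (pt \<xi>)"
  let ?B = "box m n"
  define T where "T j k = EE b c d e (\<xi> j) (n j) k" for j k
  define T' where "T' j k = EE b c y e (\<xi> j) (n j) k" for j k
  define P where "P i = (\<Prod>t<s. phi (y + of_nat t * K) (\<xi> i)) * E y (\<xi> i) (n i) 0" for i
  define C where "C i = - E d (\<xi> i) (n i) 0 / P i" for i
  define D where "D = ?D (Suc m) s"
  have dist: "grid_distinct (Suc m) n (pt \<xi>)" by (rule grid_distinct_pt[OF pts])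
  have gen_i: "regular (\<xi> i - y)" "regular (\<xi> i + y)" "regular (y - \<xi> i)" if "i \<in> {1..m}" for i
    using pts that unfolding gen_points_def y_def by auto
  have pty: "pt \<xi> (Suc m) s = d" by (simp add: pt_def d y_def)
  have P: "P i \<noteq> 0" if i: "i \<in> {1..m}" for i
  proof -
    have "phi (y + of_nat t * K) (\<xi> i) \<noteq> 0" for t
    proof -
      have "\<sigma> (y + of_nat t * K + \<xi> i) \<noteq> 0"
        by (rule regularD[OF gen_i(2)[OF i], where t = "int t"]) (simp add: algebra_simps)
      moreover have "\<sigma> (y + of_nat t * K - \<xi> i) \<noteq> 0"
        by (rule regularD[OF gen_i(3)[OF i], where t = "int t"]) (simp add: algebra_simps)
      ultimately show ?thesis by (simp add: phi_def)
    qed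
    then show ?thesis
      using E_nz[OF gen_i(2,1)[OF i]] by (simp add: P_def)
  qed
  have col: "phi (pt \<xi> i k) d * (T i k / ?D i k)
      = C i * (T' i k / grid_den m n (pt \<xi>) i k)" if i: "i \<in> {1..m}" and k: "k \<le> n i" for i k
  proof -
    define F where "F = (\<Prod>t<s. phi (y + of_nat t * K) (\<xi> i + of_nat k * K))"
    \<comment> \<open>The last block contributes s + 1 factors to this denominator. The one for its
      top point \<open>d\<close> cancels against the Vandermonde factor
      \<open>phi (pt \<xi> i k) d\<close>; the others, \<open>F\<close>, cancel against the factors
      from \<open>E_reduce\<close>.\<close>
    have "{0..s} = insert s {..<s}" by auto
    then have G: "?D i k = grid_den m n (pt \<xi>) i k * (phi d (pt \<xi> i k) * F)"
      unfolding grid_den_Suc[OF i] s_def[symmetric] F_def pty[symmetric] by (simp add: pt_def y_def)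
    have "?D i k \<noteq> 0"
      using i k by (intro grid_den_nz[OF dist]) auto
    then have ne: "phi d (pt \<xi> i k) \<noteq> 0" "F \<noteq> 0" unfolding G by auto
    have "E d (\<xi> i) (n i) k * P i = E d (\<xi> i) (n i) 0 * (F * E y (\<xi> i) (n i) k)"
      unfolding P_def F_def by (rule E_reduce[OF k gen_i(1,2)[OF i] d])
    then have "E d (\<xi> i) (n i) k / F = - C i * E y (\<xi> i) (n i) k"
      using P[OF i] ne by (simp add: C_def field_simps)
    moreover have "T i k / F = E b (\<xi> i) (n i) k * E c (\<xi> i) (n i) k * (E d (\<xi> i) (n i) k / F) * E e (\<xi> i) (n i) k"
      by (simp add: T_def)
    ultimately have "T i k / F = - C i * T' i k"
      by (simp add: T'_def)
    moreover have "phi (pt \<xi> i k) d * (T i k / ?D i k)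
        = - (T i k / F) / grid_den m n (pt \<xi>) i k"
      unfolding G skew[of "pt \<xi> i k" d] using ne by (simp add: field_simps)
    ultimately show ?thesis by simp
  qed
  have "jackson_sum (Suc m) \<xi> n b c d e
    = (\<Sum>k\<in>?B. (\<Prod>i=1..m. C i) * (T (Suc m) s / D) * (vand m (pts \<xi> k)
        * (\<Prod>i=1..m. T' i (k i) / grid_den m n (pt \<xi>) i (k i))))"
    unfolding jackson_sum_def T_def[symmetric] sum_PiE_Suc
  proof (rule sum.cong)
    fix k assume k: "k \<in> ?B"
    define f where "f q = vand (Suc m) (\<lambda>i. pt \<xi> i ((k(Suc m := q)) i))
      * (\<Prod>i=1..Suc m. T i ((k(Suc m := q)) i) / ?D i ((k(Suc m := q)) i))" for q
    have "f q = 0" if "q \<in> {0..s} - {s}" for q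
    proof -
      \<comment> \<open>For q < s the second product in \<open>E d y s q\<close> contains the factor
        t = s, which is \<sigma> 0.\<close>
      have "\<sigma> (y - d + of_nat s * K) = 0" by (simp add: d)
      then have "E d y s q = 0"
        unfolding E_def using that by (auto simp: prod_zero_iff)
      then have "T (Suc m) q = 0" by (simp add: T_def s_def y_def)
      then show ?thesis by (simp add: f_def)
    qed
    then have "(\<Sum>q=0..s. f q) = f s"
      by (subst sum.remove[of _ s]) auto
    also have "f s = vand m (pts \<xi> k) * (T (Suc m) s / D)
        * (\<Prod>i=1..m. phi (pt \<xi> i (k i)) d * (T i (k i) / ?D i (k i)))"
    proof -
      have "vand m (\<lambda>i. pt \<xi> i ((k(Suc m := s)) i)) = vand m (pts \<xi> k)"
        by (intro vand_cong) auto
      moreover have "(\<Prod>i=1..m. phi (pt \<xi> i ((k(Suc m := s)) i)) (pt \<xi> (Suc m) s)) = (\<Prod>i=1..m. phi (pt \<xi> i (k i)) d)"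
        unfolding pty by (intro prod.cong) auto
      moreover have "(\<Prod>i=1..m. T i ((k(Suc m := s)) i) / ?D i ((k(Suc m := s)) i))
         = (\<Prod>i=1..m. T i (k i) / ?D i (k i))"
        by (intro prod.cong) auto
      ultimately show ?thesis
        unfolding f_def prod.distrib by (simp add: vand_Suc D_def)
    qed
    also have "(\<Prod>i=1..m. phi (pt \<xi> i (k i)) d * (T i (k i) / ?D i (k i)))
        = (\<Prod>i=1..m. C i * (T' i (k i) / grid_den m n (pt \<xi>) i (k i)))"
      using k by (intro prod.cong col) auto
    finally show "(\<Sum>q=0..n (Suc m). vand (Suc m) (\<lambda>i. pt \<xi> i ((k(Suc m := q)) i))
      * (\<Prod>i=1..Suc m. T i ((k(Suc m := q)) i) / ?D i ((k(Suc m := q)) i)))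
      = (\<Prod>i=1..m. C i) * (T (Suc m) s / D) * (vand m (pts \<xi> k)
        * (\<Prod>i=1..m. T' i (k i) / grid_den m n (pt \<xi>) i (k i)))"
      unfolding f_def[symmetric] s_def[symmetric] prod.distrib by (simp only: mult_ac)
  qed simp
  also have "\<dots> = (\<Prod>i=1..m. C i) * (T (Suc m) s / D) * jackson_sum m \<xi> n b c y e"
    unfolding sum_distrib_left[symmetric] jackson_sum_def T'_def by simp
  finally have sum: "jackson_sum (Suc m) \<xi> n b c d e
    = (\<Prod>i=1..m. C i) * (T (Suc m) s / D) * jackson_sum m \<xi> n b c y e" .
  define Q where "Q i = (\<Prod>t=0..s. \<sigma> (y - \<xi> i + of_nat t * K)) * (\<Prod>t=1..n i. \<sigma> (\<xi> i - y + of_nat t * K))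
        * (\<Prod>t=0..n i + s. \<sigma> (\<xi> i + y + of_nat t * K))" for i
  define R where "R i = (\<Prod>t=0..n i. phi (\<xi> i + of_nat t * K) d)" for i
  have CQ: "C i * Q i = R i" if i: "i \<in> {1..m}" for i
    using jackson_reduce_column[OF d, of "\<xi> i" "n i"] P[OF i]
    unfolding C_def Q_def R_def P_def by (simp add: field_simps)
  define S where "S = (\<Prod>t<s. phi (y + of_nat t * K) d)"
  have D: "D = (\<Prod>i=1..m. R i) * S"
  proof -
    have "{0..s} - {s} = {..<s}" by auto
    then show ?thesis
      unfolding D_def grid_den_last pty s_def[symmetric] R_def S_def by (simp add: pt_def y_def)
  qed
  have "D \<noteq> 0" unfolding D_def by (rule grid_den_nz[OF dist]) (auto simp: s_def)
  then have ne: "(\<Prod>i=1..m. R i) \<noteq> 0" "S \<noteq> 0" unfolding D by auto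
  have last: "T (Suc m) s * (\<Prod>t=1..s. \<sigma> (of_nat t * K)) = S * (- 1) ^ s
    * tail_prod s y b c e"
  proof -
    have "(\<Prod>t<s. \<sigma> (y + of_nat t * K - d)) = (\<Prod>t<s. - \<sigma> (of_nat (s - t) * K))"
    proof (rule prod.cong)
      fix t assume "t \<in> {..<s}"
      then have "y + of_nat t * K - d = - (of_nat (s - t) * K)"
        by (simp add: d of_nat_diff algebra_simps)
      then show "\<sigma> (y + of_nat t * K - d) = - \<sigma> (of_nat (s - t) * K)" by (simp only: odd)
    qed simp
    also have "\<dots> = (- 1) ^ s * (\<Prod>t<s. \<sigma> (of_nat (s - t) * K))"
      using prod.distrib[of "\<lambda>_. - 1" "\<lambda>t. \<sigma> (of_nat (s - t) * K)" "{..<s}"] by simp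
    also have "(\<Prod>t<s. \<sigma> (of_nat (s - t) * K)) = (\<Prod>t=1..s. \<sigma> (of_nat t * K))"
    proof -
      have "(\<Prod>t<s. \<sigma> (of_nat (s - t) * K)) = (\<Prod>t<s. \<sigma> (of_nat (Suc (s - Suc t)) * K))"
        by (intro prod.cong) (auto simp: Suc_diff_Suc simp del: of_nat_Suc)
      also have "\<dots> = (\<Prod>t<s. \<sigma> (of_nat (Suc t) * K))"
        by (rule prod.nat_diff_reindex)
      finally show ?thesis by (simp add: prod.atLeast1_atMost_eq)
    qed
    finally have "S = (\<Prod>t<s. \<sigma> (y + d + of_nat t * K)) * ((- 1) ^ s * (\<Prod>t=1..s. \<sigma> (of_nat t * K)))"
      unfolding S_def phi_def prod.distrib by (simp add: algebra_simps)
    then have "S * (- 1) ^ s = (\<Prod>t<s. \<sigma> (y + d + of_nat t * K)) * (\<Prod>t=1..s. \<sigma> (of_nat t * K))"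
      by (simp add: power_mult_distrib[symmetric])
    then show ?thesis
      unfolding T_def E_def s_def[symmetric] y_def[symmetric] prod.distrib by (simp add: mult_ac)
  qed
  have den: "jackson_den (Suc m) \<xi> n = jackson_den m \<xi> n * (\<Prod>t=1..s. \<sigma> (of_nat t * K)) * (\<Prod>i=1..m. Q i)"
    unfolding jackson_den_Suc s_def[symmetric] y_def[symmetric] Q_def ..
  have "(\<Prod>i=1..m. C i) * (\<Prod>i=1..m. Q i) = (\<Prod>i=1..m. R i)"
    unfolding prod.distrib[symmetric] by (intro prod.cong CQ) auto
  then have "jackson_sum (Suc m) \<xi> n b c d e * jackson_den (Suc m) \<xi> n * D
    = (\<Prod>i=1..m. R i) * (T (Suc m) s * (\<Prod>t=1..s. \<sigma> (of_nat t * K))) * (jackson_sum m \<xi> n b c y e * jackson_den m \<xi> n)"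
    unfolding sum den using \<open>D \<noteq> 0\<close> by (simp add: field_simps)
  also have "\<dots> = D * ((jackson_sum m \<xi> n b c y e * jackson_den m \<xi> n) * (- 1) ^ s
      * tail_prod s y b c e)"
    unfolding last D by (simp only: mult_ac)
  finally show ?thesis using \<open>D \<noteq> 0\<close> by simp
qed

text \<open>For fixed \<open>d + e\<close> both sides are combinations of products of \<open>N\<close> values of \<open>phi\<close> at \<open>\<delta> = (d - e) / 2\<close>, so it
  suffices to compare them at \<open>N + 1\<close> points: \<open>N\<close> common zeros and one collapse to rank \<open>r - 1\<close>.\<close>

lemma jackson:
  assumes "gen_points r \<xi>" "(\<Sum>i=1..r. n i) = N" "b + c + d + e = of_nat (Suc N) * K"
    and "regular (b - c)" "regular (b + d)" "regular (b + e)"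
    and "\<And>i. i \<in> {1..r} \<Longrightarrow> regular (\<xi> i + b) \<and> regular (\<xi> i - b)"
    and "\<And>i. i \<in> {1..r} \<Longrightarrow> regular (\<xi> i + c) \<and> regular (\<xi> i - c)"
    and "\<And>i. i \<in> {1..r} \<Longrightarrow> regular (\<xi> i - d) \<and> regular (\<xi> i - e)"
    and "\<And>i j. i \<in> {1..r} \<Longrightarrow> j \<in> {1..r} \<Longrightarrow> i \<noteq> j \<Longrightarrow> regular (\<xi> i + \<xi> j + b + c)"
  shows "jackson_sum r \<xi> n b c d e * jackson_den r \<xi> n = jackson_prod N b c d e"
  using assms
proof (induction r arbitrary: N d e)
  case 0
  then show ?case by (simp add: jackson_sum_def jackson_den_def jackson_prod_def vand_def)
next
  case (Suc m)
  note pts = Suc.prems(1) and N = Suc.prems(2) and bal = Suc.prems(3)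
    and gbc = Suc.prems(4) and gbd = Suc.prems(5) and gbe = Suc.prems(6)
    and gb = Suc.prems(7) and gc = Suc.prems(8) and gde = Suc.prems(9) and gij = Suc.prems(10)
  define s where "s = n (Suc m)"
  define y where "y = \<xi> (Suc m)"
  \<comment> \<open>By the balancing condition this is (d + e) / 2. It stays fixed, and \<delta> is
    the variable in which both sides are compared.\<close>
  define h where "h = (of_nat (Suc N) * K - b - c) / 2"
  have h2: "h + h = of_nat (Suc N) * K - b - c" by (simp add: h_def)
  define \<delta> where "\<delta> = d - h"
  have de: "d = \<delta> + h" "e = h - \<delta>"
  proof -
    have "d + e = (b + c + d + e) - b - c" by simp
    also have "\<dots> = h + h" unfolding bal h2 ..
    finally show "d = \<delta> + h" "e = h - \<delta>" by (simp_all add: \<delta>_def algebra_simps)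
  qed
  define L where "L = (SIGMA j:{1..Suc m}. {1..n j})"
  define cf where "cf k = jackson_den (Suc m) \<xi> n * (vand (Suc m) (pts \<xi> k) * (\<Prod>j=1..Suc m.
      E b (\<xi> j) (n j) (k j) * E c (\<xi> j) (n j) (k j) / grid_den (Suc m) n (pt \<xi>) j (k j)))" for k
  define z where "z k = (\<lambda>(j, t). if t \<le> k j then \<xi> j + of_nat (t - 1) * K + h else \<xi> j + of_nat t * K - h)" for k :: "nat \<Rightarrow> nat"
  define w where "w l = of_nat l * K - b - h" for l :: nat
  \<comment> \<open>For l > 0 these are the zeros of the product side. The point for l = 0 is the
    value of \<delta> at which \<open>d\<close> becomes the top point y + s K of the last
    block.\<close>
  define p where "p l = (if l = 0 then y + of_nat s * K - h else w l)" for l :: nat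
  define C where "C = (\<Prod>l=1..N. \<sigma> (of_nat l * K - b - c))"
  let ?B = "box (Suc m) n"
  have lhs: "jackson_sum (Suc m) \<xi> n b c (u + h) (h - u) * jackson_den (Suc m) \<xi> n
      = (\<Sum>k\<in>?B. cf k * (\<Prod>l\<in>L. phi (z k l) u))" for u
    unfolding jackson_sum_def sum_distrib_right
  proof (rule sum.cong)
    fix k assume k: "k \<in> ?B"
    have "(\<Prod>l\<in>L. phi (z k l) u) = (\<Prod>j=1..Suc m. \<Prod>t=1..n j.
        phi (if t \<le> k j then \<xi> j + of_nat (t - 1) * K + h else \<xi> j + of_nat t * K - h) u)"
      unfolding L_def by (subst prod.Sigma) (auto simp: z_def split_def intro!: prod.cong)
    also have "\<dots> = (\<Prod>j=1..Suc m. E (u + h) (\<xi> j) (n j) (k j) * E (h - u) (\<xi> j) (n j) (k j))"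
      using k by (intro prod.cong refl E_as_phi[symmetric]) auto
    finally have 1: "(\<Prod>l\<in>L. phi (z k l) u) = \<dots>" .
    have 2: "(\<Prod>j=1..Suc m. EE b c (u + h) (h - u) (\<xi> j) (n j) (k j) / grid_den (Suc m) n (pt \<xi>) j (k j))
       = (\<Prod>j=1..Suc m. E b (\<xi> j) (n j) (k j) * E c (\<xi> j) (n j) (k j) / grid_den (Suc m) n (pt \<xi>) j (k j))
          * (\<Prod>j=1..Suc m. E (u + h) (\<xi> j) (n j) (k j) * E (h - u) (\<xi> j) (n j) (k j))"
      unfolding prod.distrib[symmetric] by (intro prod.cong) auto
    show "vand (Suc m) (pts \<xi> k) * (\<Prod>j=1..Suc m. EE b c (u + h) (h - u) (\<xi> j) (n j) (k j) / grid_den (Suc m) n (pt \<xi>) j (k j))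
          * jackson_den (Suc m) \<xi> n = cf k * (\<Prod>l\<in>L. phi (z k l) u)"
      unfolding 1 2 cf_def by (simp only: mult_ac)
  qed simp
  have rhs: "jackson_prod N b c (u + h) (h - u) = C * (\<Prod>l=1..N. phi (w l) u)" for u
    unfolding jackson_prod_def C_def prod.distrib[symmetric] phi_def w_def
    by (intro prod.cong) (auto simp: algebra_simps)
  have "(\<Sum>k\<in>?B. cf k * (\<Prod>l\<in>L. phi (z k l) \<delta>)) = C * (\<Prod>l=1..N. phi (w l) \<delta>)"
  proof (rule product_form_eq[of _ _ "{0..N}" _ p])
    show "finite ?B" by (intro finite_PiE) auto
    show "finite L" unfolding L_def by auto
    have "card L = N" unfolding L_def by (subst card_SigmaI) (use N in auto)
    then show "card {0..N} = card L + 1" "card {1..N} = card L" by auto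
    have ys: "regular (y + b)" "regular (y - b)" "regular (y + c)" "regular (y - c)" "regular (y - d)" "regular (y - e)"
      using gb[of "Suc m"] gc[of "Suc m"] gde[of "Suc m"] by (auto simp: y_def)
    have p0: "phi (p 0) (w l) \<noteq> 0" for l
    proof -
      have "p 0 + w l = y + c + of_int (int s + int l - int (Suc N)) * K"
        using h2 by (simp add: p_def w_def algebra_simps)
      moreover have "p 0 - w l = y + b + of_int (int s - int l) * K"
        by (simp add: p_def w_def algebra_simps)
      ultimately show ?thesis
        unfolding phi_def by (simp only: regular_of_int[OF ys(3)] regular_of_int[OF ys(1)] mult_eq_0_iff simp_thms)
    qed
    show "phi (p i) (p j) \<noteq> 0" if "i \<in> {0..N}" "j \<in> {0..N}" "i \<noteq> j" for i j
    proof -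
      consider "i = 0" "j \<noteq> 0" | "j = 0" "i \<noteq> 0" | "i \<noteq> 0" "j \<noteq> 0" using \<open>i \<noteq> j\<close> by auto
      then show ?thesis
      proof cases
        case 1
        then show ?thesis using p0[of j] by (simp add: p_def)
      next
        case 2
        then show ?thesis using p0[of i] skew[of "p i" "p j"] by (simp add: p_def)
      next
        case 3
        have "w i + w j = - (b - c) + of_int (int i + int j - int (Suc N)) * K"
          using h2 by (simp add: w_def algebra_simps)
        moreover have "w i - w j = of_int (int i - int j) * K"
          by (simp add: w_def algebra_simps)
        moreover have "int i - int j \<noteq> 0" using \<open>i \<noteq> j\<close> by simp
        ultimately have "phi (w i) (w j) \<noteq> 0"
          unfolding phi_def by (simp only: regular_of_int[OF regular_minus[OF gbc]] step_nz mult_eq_0_iff simp_thms)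
        then show ?thesis using 3 by (simp add: p_def)
      qed
    qed
    show "phi (p i) \<delta> \<noteq> 0" if "i \<in> {0..N}" for i
    proof (cases "i = 0")
      case True
      have "p 0 + \<delta> = y - e + of_int (int s) * K" "p 0 - \<delta> = y - d + of_int (int s) * K"
        by (simp_all add: p_def de algebra_simps)
      then show ?thesis
        unfolding True phi_def by (simp only: regular_of_int[OF ys(5)] regular_of_int[OF ys(6)] mult_eq_0_iff simp_thms)
    next
      case False
      have "w i + \<delta> = - (b + e) + of_int (int i) * K" "w i - \<delta> = - (b + d) + of_int (int i) * K"
        by (simp_all add: w_def de algebra_simps)
      then have "phi (w i) \<delta> \<noteq> 0"
        unfolding phi_def by (simp only: regular_of_int[OF regular_minus[OF gbe]] regular_of_int[OF regular_minus[OF gbd]] mult_eq_0_iff simp_thms)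
      then show ?thesis using False by (simp add: p_def)
    qed
    fix i assume i: "i \<in> {0..N}"
    show "(\<Sum>k\<in>?B. cf k * (\<Prod>l\<in>L. phi (z k l) (p i))) = C * (\<Prod>l=1..N. phi (w l) (p i))"
    proof (cases "i = 0")
      case False
      then have "(\<Prod>l=1..N. phi (w l) (p i)) = 0"
        using i by (auto simp: prod_zero_iff p_def intro!: bexI[of _ i])
      moreover have "jackson_sum (Suc m) \<xi> n b c (p i + h) (h - p i) = 0"
      proof (rule jackson_sum_zero[OF pts N gb gc])
        show "p i + h = of_nat i * K - b" using False by (simp add: p_def w_def)
        have "h - p i = (h + h) - of_nat i * K + b" using False by (simp add: p_def w_def)
        also have "\<dots> = of_nat (Suc N - i) * K - c"
          unfolding h2 using i by (simp add: of_nat_diff algebra_simps)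
        finally show "h - p i = of_nat (Suc N - i) * K - c" .
      qed (use i False in auto)
      ultimately show ?thesis using lhs[of "p i"] by simp
    next
      case True
      \<comment> \<open>The collapsed sum has parameters b, c, y, e' and is balanced for M = N - s,
        so the induction hypothesis evaluates it.\<close>
      define e' where "e' = h - p i"
      define M where "M = (\<Sum>i=1..m. n i)"
      have NM: "N = M + s" using N by (simp add: M_def s_def)
      have d': "p i + h = y + of_nat s * K" using True by (simp add: p_def)
      have "e' = (h + h) - y - of_nat s * K" using True by (simp add: p_def e'_def)
      then have e': "e' = of_nat (Suc N) * K - b - c - y - of_nat s * K" unfolding h2 by simp
      have bal': "b + c + y + of_nat s * K + e' = of_nat (Suc (M + s)) * K"
        unfolding e' NM by simp
      have "jackson_sum m \<xi> n b c y e' * jackson_den m \<xi> n = jackson_prod M b c y e'"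
      proof (rule Suc.IH)
        show "gen_points m \<xi>" using pts by (auto simp: gen_points_def)
        show "(\<Sum>i=1..m. n i) = M" by (simp add: M_def)
        show "b + c + y + e' = of_nat (Suc M) * K" unfolding e' NM by (simp add: algebra_simps)
        show "regular (b - c)" by (rule gbc)
        show "regular (b + y)" using ys(1) by (simp add: add.commute)
        show "regular (b + e')"
          by (rule regular_minus_shift[OF ys(3), where t = "int (Suc N) - int s"]) (simp add: e' algebra_simps)
        fix j assume j: "j \<in> {1..m}"
        then have j': "j \<in> {1..Suc m}" "j \<noteq> Suc m" by auto
        show "regular (\<xi> j + b) \<and> regular (\<xi> j - b)" "regular (\<xi> j + c) \<and> regular (\<xi> j - c)"
          using gb[OF j'(1)] gc[OF j'(1)] by auto
        have "regular (\<xi> j - y)"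
          using pts j' unfolding gen_points_def y_def by (metis atLeastAtMost_iff le_add1 order_refl plus_1_eq_Suc)
        \<comment> \<open>Up to a multiple of \<open>K\<close>, \<open>e'\<close> is - (y + b + c).
          The hypothesis on pairs of points is carried through the induction for the sake of this
          step.\<close>
        moreover have "regular (\<xi> j + y + b + c)" using gij[OF j'(1) _ j'(2)] by (simp add: y_def)
        then have "regular (\<xi> j - e')"
          by (rule regular_shift[where t = "int s - int (Suc N)"]) (simp add: e' algebra_simps)
        ultimately show "regular (\<xi> j - y) \<and> regular (\<xi> j - e')" by simp
      next
        fix i j assume "i \<in> {1..m}" "j \<in> {1..m}" "i \<noteq> j"
        then show "regular (\<xi> i + \<xi> j + b + c)" by (intro gij) auto
      qed
      then have "jackson_sum (Suc m) \<xi> n b c (p i + h) e' * jackson_den (Suc m) \<xi> n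
          = jackson_prod N b c (p i + h) e'"
        unfolding d' NM jackson_prod_split[OF bal']
        using jackson_reduce[OF pts, where n = n and d = "y + of_nat s * K" and b = b and c = c and e = e'] by (simp add: s_def y_def)
      then show ?thesis unfolding e'_def lhs rhs .
    qed
  qed auto
  then show ?case unfolding de lhs rhs .
qed

end

section \<open>Inversion of the Jackson sum\<close>

locale cubic_theta = odd_theta \<sigma> "3 * \<eta>" for \<sigma> :: "complex \<Rightarrow> complex" and \<eta> :: complex
begin

abbreviation K :: complex where
  "K \<equiv> 3 * \<eta>"

definition qregular :: "complex \<Rightarrow> bool" where
  "qregular u \<longleftrightarrow> (\<forall>t :: int. \<sigma> (u + of_int t * \<eta>) \<noteq> 0)"

lemma qregularD: "qregular u \<Longrightarrow> v = u + of_int t * \<eta> \<Longrightarrow> \<sigma> v \<noteq> 0"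
  by (simp add: qregular_def)

lemma qregular_minus: "qregular u \<Longrightarrow> qregular (- u)"
  unfolding qregular_def
proof
  fix s assume *: "\<forall>t::int. \<sigma> (u + of_int t * \<eta>) \<noteq> 0"
  have "- u + of_int s * \<eta> = - (u + of_int (- s) * \<eta>)" by simp
  then show "\<sigma> (- u + of_int s * \<eta>) \<noteq> 0"
    using * odd by (metis neg_equal_0_iff_equal)
qed

lemma qregularD_neg: "qregular u \<Longrightarrow> v = - u + of_int t * \<eta> \<Longrightarrow> \<sigma> v \<noteq> 0"
  by (rule qregularD[OF qregular_minus])

lemma qregular_shift: "qregular u \<Longrightarrow> v = u + of_int t * \<eta> \<Longrightarrow> regular v"
  unfolding regular_def
proof
  fix s assume *: "qregular u" "v = u + of_int t * \<eta>"
  show "\<sigma> (v + of_int s * K) \<noteq> 0"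
    by (rule qregularD[OF *(1), where t = "t + 3 * s"]) (simp add: *(2) algebra_simps)
qed

lemma qregular_minus_shift: "qregular u \<Longrightarrow> v = - u + of_int t * \<eta> \<Longrightarrow> regular v"
  by (rule qregular_shift[OF qregular_minus])

section \<open>Shifted factorials and products over integer intervals\<close>

definition poch :: "complex \<Rightarrow> complex \<Rightarrow> nat \<Rightarrow> complex" where
  "poch h u k = (\<Prod>t<k. \<sigma> (u + of_nat t * h))"

lemma poch_0 [simp]: "poch h u 0 = 1"
  by (simp add: poch_def)

lemma poch_Suc: "poch h u (Suc k) = poch h u k * \<sigma> (u + of_nat k * h)"
  by (simp add: poch_def mult.commute)

lemma poch_add: "poch h u (k + l) = poch h u k * poch h (u + of_nat k * h) l"
  by (induction l) (simp_all add: poch_Suc algebra_simps)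

text \<open>With integer limits of either sign, cancellation between base-q factorials with shifts
  by |n| becomes the cutting of one interval at two places. An empty interval gives 1.\<close>

definition run :: "complex \<Rightarrow> int \<Rightarrow> int \<Rightarrow> complex" where
  "run u a b = (\<Prod>t\<in>{a..b}. \<sigma> (u + of_int t * \<eta>))"

lemma run_nz: "qregular u \<Longrightarrow> run u a b \<noteq> 0"
  by (simp add: run_def qregular_def)

lemma poch_K_nz: "qregular u \<Longrightarrow> v = u + of_int t * \<eta> \<Longrightarrow> poch K v k \<noteq> 0"
  unfolding poch_def
proof -
  assume *: "qregular u" "v = u + of_int t * \<eta>"
  have "\<sigma> (v + of_nat s * K) \<noteq> 0" for s
    by (rule qregularD[OF *(1), where t = "t + 3 * int s"]) (simp add: *(2) algebra_simps)
  then show "(\<Prod>t<k. \<sigma> (v + of_nat t * K)) \<noteq> 0" by simp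
qed

lemma run_split: "a \<le> b + 1 \<Longrightarrow> b \<le> c \<Longrightarrow> run u a c = run u a b * run u (b + 1) c"
proof -
  assume "a \<le> b + 1" "b \<le> c"
  then have "{a..c} = {a..b} \<union> {b + 1..c}" "{a..b} \<inter> {b + 1..c} = {}" by auto
  then show ?thesis unfolding run_def by (simp add: prod.union_disjoint)
qed

lemma run_3: "run u a (a + 2) = \<sigma> (u + of_int a * \<eta>) * \<sigma> (u + of_int (a + 1) * \<eta>) * \<sigma> (u + of_int (a + 2) * \<eta>)"
proof -
  have "{a..a + 2} = {a, a + 1, a + 2}" by auto
  then show ?thesis unfolding run_def by simp
qed

lemma poch_run:
  assumes "v = u + of_int a * \<eta>"
  shows "poch \<eta> v k = run u a (a + int k - 1)"
proof -
  have "(\<Prod>t<k. \<sigma> (v + of_nat t * \<eta>)) = (\<Prod>t\<in>{a..a + int k - 1}. \<sigma> (u + of_int t * \<eta>))"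
    by (rule prod.reindex_bij_witness[of _ "\<lambda>t. nat (t - a)" "\<lambda>t. a + int t"])
      (auto simp: assms algebra_simps)
  then show ?thesis by (simp add: poch_def run_def)
qed

lemma poch_run_neg:
  assumes "v = - u - of_int b * \<eta>"
  shows "poch \<eta> v k = (- 1) ^ k * run u (b - int k + 1) b"
proof -
  have "(\<Prod>t<k. \<sigma> (v + of_nat t * \<eta>)) = (\<Prod>t<k. - 1 * \<sigma> (u + of_int (b - int t) * \<eta>))"
  proof (rule prod.cong)
    fix t
    have "v + of_nat t * \<eta> = - (u + of_int (b - int t) * \<eta>)"
      by (simp add: assms algebra_simps)
    then show "\<sigma> (v + of_nat t * \<eta>) = - 1 * \<sigma> (u + of_int (b - int t) * \<eta>)"
      by (simp only: odd mult_minus_left mult_1)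
  qed simp
  also have "\<dots> = (- 1) ^ k * (\<Prod>t<k. \<sigma> (u + of_int (b - int t) * \<eta>))"
    by (simp only: prod.distrib) simp
  also have "(\<Prod>t<k. \<sigma> (u + of_int (b - int t) * \<eta>)) = (\<Prod>t\<in>{b - int k + 1..b}. \<sigma> (u + of_int t * \<eta>))"
    by (rule prod.reindex_bij_witness[of _ "\<lambda>t. nat (b - t)" "\<lambda>t. b - int t"]) auto
  finally show ?thesis by (simp add: poch_def run_def)
qed

lemma prod_nat_run:
  "(\<Prod>t=0..k. \<sigma> (u + of_nat t * h)) = poch h u (Suc k)"
  unfolding poch_def by (intro prod.cong) auto

lemma prod_from1_poch:
  "(\<Prod>t=1..k. \<sigma> (u + of_nat t * h)) = poch h (u + h) k"
  unfolding poch_def prod.atLeast1_atMost_eq One_nat_def by (intro prod.cong) (auto simp: algebra_simps)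

text \<open>One factor of the claimed value. As that value is a product over the indices, it only
  modifies single-index factors in the inverted sum.\<close>

definition cubic_column :: "complex \<Rightarrow> complex \<Rightarrow> nat \<Rightarrow> complex" where
  "cubic_column x \<alpha> s = poch \<eta> (\<alpha> + x + \<eta>) (3 * s) * poch K (x - 3 * \<alpha>) s
     / (poch \<eta> (x - \<alpha>) (3 * s) * poch K (3 * \<alpha> + x + 3 * \<eta>) s)"

text \<open>The logarithms of a q^t. They advance by \<eta>, whereas the block points advance by K =
  3 \<eta>.\<close>

definition anchor :: "complex \<Rightarrow> nat \<Rightarrow> complex" where
  "anchor \<alpha> t = \<alpha> + of_nat t * \<eta>"

text \<open>The single-index factor of the inverted sum: that of \<open>fwd\<close> without
  \<open>grid_den\<close>, times that of the claimed value.\<close>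

definition column where
  "column x \<alpha> M s = (\<Prod>t<M. phi (anchor \<alpha> t) (x + of_nat s * K))
     / phi (anchor \<alpha> 0) (x + of_nat s * K) * cubic_column x \<alpha> s"

text \<open>All factors in x - \<alpha> are gathered into two runs with the same base point, a form
  in which the values at s and s + 1 can be compared by cutting intervals.\<close>

lemma column_closed:
  assumes g: "qregular (\<alpha> + x)" "qregular (x - \<alpha>)"
  shows "column x \<alpha> M s = - ((- 1) ^ M) / \<sigma> (\<alpha> + x) * poch \<eta> (\<alpha> + x) (M + 3 * s)
     * (run (x - \<alpha>) (3 * int s - int M + 1) (3 * int s) / run (x - \<alpha>) 0 (3 * int s))
     * (poch K (x - 3 * \<alpha>) s / poch K (3 * \<alpha> + x + 3 * \<eta>) s)"
proof -
  let ?z = "x + of_nat s * K"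
  define B where "B = x - \<alpha>"
  have P: "(\<Prod>t<M. phi (anchor \<alpha> t) ?z)
      = poch \<eta> (\<alpha> + x + of_nat (3 * s) * \<eta>) M * ((- 1) ^ M * run B (3 * int s - int M + 1) (3 * int s))"
  proof -
    have "(\<Prod>t<M. phi (anchor \<alpha> t) ?z) = poch \<eta> (\<alpha> + x + of_nat (3 * s) * \<eta>) M * poch \<eta> (\<alpha> - ?z) M"
      unfolding poch_def prod.distrib[symmetric] phi_def anchor_def
      by (intro prod.cong) (auto simp: algebra_simps)
    also have "poch \<eta> (\<alpha> - ?z) M = (- 1) ^ M * run B (3 * int s - int M + 1) (3 * int s)"
      by (rule poch_run_neg) (simp add: B_def algebra_simps)
    finally show ?thesis .
  qed
  have Z: "phi (anchor \<alpha> 0) ?z = - \<sigma> (\<alpha> + x + of_nat (3 * s) * \<eta>) * \<sigma> (B + of_int (3 * int s) * \<eta>)"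
    unfolding phi_def anchor_def B_def using odd[of "?z - \<alpha>"] by (simp add: algebra_simps)
  have b0: "poch \<eta> B (3 * s) * \<sigma> (B + of_int (3 * int s) * \<eta>) = run B 0 (3 * int s)"
    using poch_run[of B B 0 "Suc (3 * s)"] unfolding poch_Suc by simp
  have a0: "\<sigma> (\<alpha> + x) * poch \<eta> (\<alpha> + x + \<eta>) (3 * s) = poch \<eta> (\<alpha> + x) (3 * s) * \<sigma> (\<alpha> + x + of_nat (3 * s) * \<eta>)"
    using poch_add[of \<eta> "\<alpha> + x" 1 "3 * s"] poch_Suc[of \<eta> "\<alpha> + x" "3 * s"] by (simp add: poch_Suc)
  have a1: "poch \<eta> (\<alpha> + x) (M + 3 * s) = poch \<eta> (\<alpha> + x) (3 * s) * poch \<eta> (\<alpha> + x + of_nat (3 * s) * \<eta>) M"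
    by (simp only: add.commute[of M] poch_add)
  have ne: "\<sigma> (\<alpha> + x) \<noteq> 0" "\<sigma> (\<alpha> + x + of_nat (3 * s) * \<eta>) \<noteq> 0" 
    using qregularD[OF g(1), of _ 0] qregularD[OF g(1), of _ "int (3 * s)"] by simp_all
  have q: "poch \<eta> (\<alpha> + x + \<eta>) (3 * s) / \<sigma> (\<alpha> + x + of_nat (3 * s) * \<eta>) = poch \<eta> (\<alpha> + x) (3 * s) / \<sigma> (\<alpha> + x)"
    using a0 ne by (simp add: frac_eq_eq mult.commute)
  have col: "column x \<alpha> M s = - ((- 1) ^ M) * poch \<eta> (\<alpha> + x + of_nat (3 * s) * \<eta>) M
     * (poch \<eta> (\<alpha> + x + \<eta>) (3 * s) / \<sigma> (\<alpha> + x + of_nat (3 * s) * \<eta>))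
     * (run B (3 * int s - int M + 1) (3 * int s) / (poch \<eta> B (3 * s) * \<sigma> (B + of_int (3 * int s) * \<eta>)))
     * (poch K (x - 3 * \<alpha>) s / poch K (3 * \<alpha> + x + 3 * \<eta>) s)"
    unfolding column_def cubic_column_def P Z B_def[symmetric] by (simp add: field_simps)
  show ?thesis
    unfolding B_def[symmetric] col q b0 a1 by simp
qed

text \<open>A base-q factorial starting at \<alpha> + M \<eta>, taken three factors at a time,
  consists of three base-q^3 factorials; these give the last three parameters. The first one comes
  from the factors with 3 \<alpha> in \<open>cubic_column\<close>.\<close>

definition E4 where
  "E4 x \<alpha> M n k = E (- 3 * \<alpha>) x n k * E (\<alpha> + of_nat M * \<eta>) x n k
     * E (\<alpha> + of_nat (M + 1) * \<eta>) x n k * E (\<alpha> + of_nat (M + 2) * \<eta>) x n k"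

lemma E4_0: "E4 x \<alpha> M n 0 = poch K (3 * \<alpha> + x + 3 * \<eta>) n * run (x - \<alpha>) (1 - int M) (3 * int n - int M)"
proof (induction n)
  case 0
  then show ?case by (simp add: E4_def E_def run_def)
next
  case (Suc n)
  have step: "E s x (Suc n) 0 = E s x n 0 * \<sigma> (x - s + of_nat (Suc n) * K)" for s
  proof -
    have "{0<..Suc n} = insert (Suc n) {0<..n}" by auto
    then show ?thesis by (simp add: E_def)
  qed
  have r: "run (x - \<alpha>) (1 - int M) (3 * int (Suc n) - int M) = run (x - \<alpha>) (1 - int M) (3 * int n - int M)
     * run (x - \<alpha>) (3 * int n - int M + 1) (3 * int n - int M + 1 + 2)"
    by (subst run_split[where b = "3 * int n - int M"]) (auto simp: algebra_simps)
  show ?case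
    unfolding E4_def step r run_3 poch_Suc
    using Suc.IH[unfolded E4_def] by (simp add: algebra_simps)
qed

text \<open>Both sides satisfy the same first-order recurrence in s, one step of which advances the
  base-q products by three factors. The constant in front is then determined at s = 0.\<close>

lemma column_E4:
  assumes g: "qregular (\<alpha> + x)" "qregular (x - \<alpha>)" "qregular (3 * \<alpha> + x)" and s: "s \<le> k"
  shows "column x \<alpha> M s = - ((- 1) ^ M) * poch \<eta> (\<alpha> + x) M / \<sigma> (\<alpha> + x)
      * (run (x - \<alpha>) (3 * int k - int M + 1) (3 * int k) / run (x - \<alpha>) 0 (3 * int k))
      / poch K (3 * \<alpha> + x + 3 * \<eta>) k * E4 x \<alpha> M k s"
proof -
  define B where "B = x - \<alpha>"
  define C where "C = - ((- 1) ^ M) * poch \<eta> (\<alpha> + x) M / \<sigma> (\<alpha> + x)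
      * (run B (3 * int k - int M + 1) (3 * int k) / run B 0 (3 * int k)) / poch K (3 * \<alpha> + x + 3 * \<eta>) k"
  define b where "b s = \<sigma> (3 * \<alpha> + x + 3 * \<eta> + of_nat s * K) * run B (3 * int s - int M + 1) (3 * int s - int M + 1 + 2)" for s
  define a where "a s = \<sigma> (x - 3 * \<alpha> + of_nat s * K) * (\<sigma> (\<alpha> + x + of_nat (M + 3 * s) * \<eta>)
     * \<sigma> (\<alpha> + x + of_nat (M + 3 * s + 1) * \<eta>) * \<sigma> (\<alpha> + x + of_nat (M + 3 * s + 2) * \<eta>))" for s
  have gB: "qregular B" using g(2) by (simp add: B_def)
  have b: "b s \<noteq> 0" for s
    unfolding b_def using run_nz[OF gB] qregularD[OF g(3), where t = "3 + 3 * int s"]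
    by (simp add: algebra_simps)
  have p3: "poch K (3 * \<alpha> + x + 3 * \<eta>) s \<noteq> 0" for s
    by (rule poch_K_nz[OF g(3), where t = 3]) simp
  have "column x \<alpha> M s * E4 x \<alpha> M k 0 = column x \<alpha> M 0 * E4 x \<alpha> M k s"
  proof (rule recurrence_unique[of k _ b a])
    fix s assume sk: "s < k"
    show "column x \<alpha> M (Suc s) * b s = column x \<alpha> M s * a s"
    proof -
      define r1 where "r1 = run B (3 * int s - int M + 1) (3 * int s)"
      define r2 where "r2 = run B 0 (3 * int s)"
      define r3 where "r3 = run B (3 * int s + 1) (3 * int s + 3)"
      define r4 where "r4 = run B (3 * int s - int M + 1) (3 * int s - int M + 1 + 2)"
      define r5 where "r5 = run B (3 * int (Suc s) - int M + 1) (3 * int (Suc s))"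
      have nz: "r2 \<noteq> 0" "r3 \<noteq> 0" unfolding r2_def r3_def by (rule run_nz[OF gB])+
      have 1: "run B 0 (3 * int (Suc s)) = r2 * r3"
        unfolding r2_def r3_def by (subst run_split[where b = "3 * int s"]) (auto simp: algebra_simps)
      \<comment> \<open>Cutting one interval after 3 s and after 3 s - M + 3 relates the window of
        length M for s to the one for s + 1.\<close>
      have "run B (3 * int s - int M + 1) (3 * int s + 3) = r1 * r3"
        unfolding r1_def r3_def by (rule run_split) auto
      moreover have "run B (3 * int s - int M + 1) (3 * int s + 3) = r4 * r5"
        unfolding r4_def r5_def by (subst run_split[where b = "3 * int s - int M + 1 + 2"]) (auto simp: algebra_simps)
      ultimately have 2: "r5 / (r2 * r3) * r4 = r1 / r2" using nz by (simp add: field_simps)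
      have 3: "poch \<eta> (\<alpha> + x) (M + 3 * Suc s) = poch \<eta> (\<alpha> + x) (M + 3 * s) * (\<sigma> (\<alpha> + x + of_nat (M + 3 * s) * \<eta>)
     * \<sigma> (\<alpha> + x + of_nat (M + 3 * s + 1) * \<eta>) * \<sigma> (\<alpha> + x + of_nat (M + 3 * s + 2) * \<eta>))"
      proof -
        have "M + 3 * Suc s = Suc (Suc (Suc (M + 3 * s)))" by simp
        then show ?thesis by (simp only: poch_Suc) (simp add: algebra_simps)
      qed
      define w where "w = \<sigma> (3 * \<alpha> + x + 3 * \<eta> + of_nat s * K)"
      have w: "w \<noteq> 0" using b[of s] by (auto simp: b_def w_def)
      define u where "u = \<sigma> (x - 3 * \<alpha> + of_nat s * K)"
      define v where "v = (\<sigma> (\<alpha> + x + of_nat (M + 3 * s) * \<eta>)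
     * \<sigma> (\<alpha> + x + of_nat (M + 3 * s + 1) * \<eta>) * \<sigma> (\<alpha> + x + of_nat (M + 3 * s + 2) * \<eta>))"
      have "column x \<alpha> M (Suc s) * b s = - ((- 1) ^ M) / \<sigma> (\<alpha> + x) * (poch \<eta> (\<alpha> + x) (M + 3 * s) * v)
        * (r5 / (r2 * r3) * r4) * (poch K (x - 3 * \<alpha>) s * u / (poch K (3 * \<alpha> + x + 3 * \<eta>) s * w) * w)"
        unfolding column_closed[OF g(1,2)] B_def[symmetric] 1 3 r5_def[symmetric] b_def r4_def[symmetric] poch_Suc
          w_def[symmetric] u_def[symmetric] v_def[symmetric] by (simp only: mult_ac)
      also have "\<dots> = column x \<alpha> M s * a s"
        unfolding 2 column_closed[OF g(1,2)] B_def[symmetric] r1_def[symmetric] r2_def[symmetric] a_def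
          u_def[symmetric] v_def[symmetric] using w by (simp add: mult_ac)
      finally show ?thesis .
    qed
    show "E4 x \<alpha> M k (Suc s) * b s = E4 x \<alpha> M k s * a s"
    proof -
      let ?E = "\<lambda>p. E p x k"
      let ?B = "\<lambda>p. \<sigma> (x - p + of_nat (Suc s) * K)"
      let ?A = "\<lambda>p. \<sigma> (x + p + of_nat s * K)"
      let ?b = "- 3 * \<alpha>" and ?c = "\<alpha> + of_nat M * \<eta>" and ?d = "\<alpha> + of_nat (M + 1) * \<eta>" and ?e = "\<alpha> + of_nat (M + 2) * \<eta>"
      have bs: "b s = ?B ?b * ?B ?c * ?B ?d * ?B ?e"
        unfolding b_def run_3 B_def by (simp add: algebra_simps)
      have as: "a s = ?A ?b * ?A ?c * ?A ?d * ?A ?e"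
        unfolding a_def by (simp add: algebra_simps)
      have "E4 x \<alpha> M k (Suc s) * b s = (?E ?b (Suc s) * ?B ?b) * (?E ?c (Suc s) * ?B ?c) * (?E ?d (Suc s) * ?B ?d) * (?E ?e (Suc s) * ?B ?e)"
        unfolding E4_def bs by (simp only: mult_ac)
      also have "\<dots> = E4 x \<alpha> M k s * a s"
        unfolding E_Suc[OF sk] E4_def as by (simp only: mult_ac)
      finally show ?thesis .
    qed
  qed (use b s in auto)
  moreover have "column x \<alpha> M 0 = C * E4 x \<alpha> M k 0"
  proof -
    define R where "R = run B (1 - int M) 0"
    define S where "S = run B 1 (3 * int k)"
    define T where "T = run B (1 - int M) (3 * int k - int M)"
    define U where "U = run B (3 * int k - int M + 1) (3 * int k)"
    define Z where "Z = run B 0 0"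
    have "run B (1 - int M) (3 * int k) = R * S"
      unfolding R_def S_def by (subst run_split[where b = 0]) auto
    moreover have "run B (1 - int M) (3 * int k) = T * U"
      unfolding T_def U_def by (rule run_split) auto
    ultimately have 1: "R * S = T * U" by simp
    have 2: "run B 0 (3 * int k) = Z * S"
      unfolding Z_def S_def by (subst run_split[where b = 0]) auto
    have nz: "Z \<noteq> 0" "S \<noteq> 0" unfolding Z_def S_def by (rule run_nz[OF gB])+
    have "R / Z = U / (Z * S) * T" using 1 nz by (simp add: field_simps)
    then show ?thesis
      unfolding column_closed[OF g(1,2)] C_def E4_0 B_def[symmetric] 2 U_def[symmetric] T_def[symmetric]
      using p3[of k] by (simp add: R_def Z_def)
  qed
  moreover have "E4 x \<alpha> M k 0 \<noteq> 0"
    unfolding E4_0 using p3 run_nz[OF gB] by (simp add: B_def)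
  ultimately have "column x \<alpha> M s = C * E4 x \<alpha> M k s" by simp
  then show ?thesis by (simp only: C_def B_def)
qed

section \<open>The triangular kernel, its inverse and the remaining coefficients\<close>

abbreviation pair_sign :: "nat \<Rightarrow> complex" where
  "pair_sign r \<equiv> (\<Prod>i=1..r. \<Prod>j\<in>{i<..r}. - 1)"

text \<open>Depends on k through |k| alone. In the inverted identity it is, up to sign, the product
  side of the Jackson sum.\<close>

abbreviation base_factor where
  "base_factor \<alpha> M \<equiv> poch \<eta> (- 2 * \<alpha>) M * poch \<eta> (2 * \<alpha> + \<eta>) (2 * M)"

text \<open>The conditions on 4 \<alpha>, on 2 \<alpha> and on \<xi> i + \<xi> j - 2 \<alpha> are
  those of \<open>jackson\<close> on b - c, on b + d and b + e, and on \<xi> i + \<xi> j + b + c,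
  for the parameters of \<open>E4\<close>. The others keep points, anchors and single-index factors
  away from the zeros of \<sigma>.\<close>

definition gen_params :: "nat \<Rightarrow> (nat \<Rightarrow> complex) \<Rightarrow> complex \<Rightarrow> bool" where
  "gen_params r \<xi> \<alpha> \<longleftrightarrow> qregular (2 * \<alpha>) \<and> qregular (4 * \<alpha>) \<and> (\<forall>i\<in>{1..r}. qregular (2 * \<xi> i) \<and> qregular (\<alpha> + \<xi> i)
     \<and> qregular (\<xi> i - \<alpha>) \<and> qregular (3 * \<alpha> + \<xi> i) \<and> qregular (\<xi> i - 3 * \<alpha>)
     \<and> (\<forall>j\<in>{1..r}. i \<noteq> j \<longrightarrow> qregular (\<xi> i + \<xi> j) \<and> qregular (\<xi> i - \<xi> j) \<and> qregular (\<xi> i + \<xi> j - 2 * \<alpha>)))"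

text \<open>The division by \<sigma> at the difference of anchor and point compensates for one half
  of \<open>phi (anchor \<alpha> M)\<close> in \<open>kern\<close>; the summand contains only the
  other half.\<close>

definition coef_column where
  "coef_column x \<alpha> M k = poch \<eta> (\<alpha> + x) M * poch \<eta> (\<alpha> - x + \<eta>) (M - k)
     / (\<sigma> (\<alpha> + x) * \<sigma> (anchor \<alpha> M - (x + of_nat k * K))
        * poch \<eta> (x - \<alpha> + of_int (int k - int M) * \<eta>) (2 * k))"

definition coef where
  "coef r \<xi> \<alpha> k = (\<Prod>i=1..r. \<Prod>j\<in>{i<..r}. 1 / (\<sigma> (\<xi> i - \<xi> j) * poch K (\<xi> i + \<xi> j) (Suc (k i + k j))))
     * (\<Prod>i=1..r. coef_column (\<xi> i) \<alpha> (weight r k) (k i))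
     * (base_factor \<alpha> (weight r k)
         / (\<Prod>i=1..r. poch K (3 * \<alpha> + \<xi> i + 3 * \<eta>) (k i)))
     * (\<Prod>i=1..r. \<Prod>j=1..r. 1 / poch K (\<xi> i - \<xi> j + 3 * \<eta>) (k i))"

text \<open>The matrix \<open>G\<close> of the overview. It depends on n only through values of
  \<open>phi\<close> at the points \<open>pt \<xi> j (n j)\<close>, with |k| of them in the
  numerator and |k| in the denominator for each j; so sums over n can be treated by partial
  fractions.\<close>

definition kern where
  "kern r \<xi> \<alpha> n k = vand r (pts \<xi> k)
     * (\<Prod>j=1..r. phi (anchor \<alpha> (weight r k)) (pt \<xi> j (k j)) / (\<Prod>t=1..weight r k. phi (anchor \<alpha> t) (pt \<xi> j (n j))))
     * (\<Prod>i=1..r. \<Prod>j=1..r. \<Prod>t<k i. phi (pt \<xi> i t) (pt \<xi> j (n j)))"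

text \<open>The matrix \<open>F\<close> of the overview. Dividing by the anchor t = 0, rather than
  starting the product at t = 1, also gives the right value for |n| = 0, where the product is
  empty.\<close>

definition fwd where
  "fwd r \<xi> \<alpha> n m = vand r (pts \<xi> m)
     * (\<Prod>j=1..r. (\<Prod>t<weight r n. phi (anchor \<alpha> t) (pt \<xi> j (m j))) / phi (anchor \<alpha> 0) (pt \<xi> j (m j))
          / grid_den r n (pt \<xi>) j (m j))"

definition cubic_term where
  "cubic_term r \<xi> \<alpha> n k =
     (\<Prod>i=1..r. \<Prod>j\<in>{i<..r}. \<sigma> (pt \<xi> i (k i) - pt \<xi> j (k j)) / \<sigma> (\<xi> i - \<xi> j))
     * (\<Prod>i=1..r. \<Prod>j\<in>{i<..r}. 1 / poch K (\<xi> i + \<xi> j) (k i + k j))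
     * (\<Prod>i=1..r. \<sigma> (\<alpha> + \<xi> i + of_nat (weight r k + 3 * k i) * \<eta>) / \<sigma> (\<alpha> + \<xi> i)
         * (poch \<eta> (\<alpha> + \<xi> i) (weight r k) * poch \<eta> (\<alpha> - \<xi> i + \<eta>) (weight r k - k i)
            / (poch \<eta> (\<alpha> + \<xi> i + of_nat (3 * n i + 1) * \<eta>) (weight r k)
               * poch \<eta> (\<alpha> - \<xi> i + of_int (1 - 3 * int (n i)) * \<eta>) (weight r k)
               * poch \<eta> (\<xi> i - \<alpha> + of_int (int (k i) - int (weight r k)) * \<eta>) (2 * k i))))
     * (base_factor \<alpha> (weight r k)
         / (\<Prod>i=1..r. poch K (3 * \<alpha> + \<xi> i + 3 * \<eta>) (k i)))
     * (\<Prod>i=1..r. \<Prod>j=1..r. poch K (\<xi> i - \<xi> j - of_nat (n j) * K) (k i)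
          * poch K (\<xi> i + \<xi> j + of_nat (n j) * K) (k i)
          / poch K (\<xi> i - \<xi> j + 3 * \<eta>) (k i))"

lemma qregular_imp_regular: "qregular u \<Longrightarrow> regular u"
  by (erule qregular_shift[where t = 0]) simp

lemma gen_params_points: "gen_params r \<xi> \<alpha> \<Longrightarrow> gen_points r \<xi>"
  unfolding gen_params_def gen_points_def using qregular_imp_regular by blast

lemma phi_anchor_nz:
  assumes "gen_params r \<xi> \<alpha>" "i \<in> {1..r}"
  shows "phi (anchor \<alpha> t) (pt \<xi> i s) \<noteq> 0" "\<sigma> (anchor \<alpha> t - pt \<xi> i s) \<noteq> 0"
proof -
  have g: "qregular (\<alpha> + \<xi> i)" "qregular (\<xi> i - \<alpha>)" using assms by (auto simp: gen_params_def)
  have "\<sigma> (anchor \<alpha> t + pt \<xi> i s) \<noteq> 0"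
    by (rule qregularD[OF g(1), where t = "int t + 3 * int s"]) (unfold anchor_def pt_def, simp add: algebra_simps)
  moreover show "\<sigma> (anchor \<alpha> t - pt \<xi> i s) \<noteq> 0"
    by (rule qregularD_neg[OF g(2), where t = "int t - 3 * int s"]) (unfold anchor_def pt_def, simp add: algebra_simps)
  ultimately show "phi (anchor \<alpha> t) (pt \<xi> i s) \<noteq> 0" by (simp add: phi_def)
qed

text \<open>The factorial in \<xi> i + \<xi> j is lengthened by its next factor, \<sigma> of the sum
  of two points. That factor completes the difference of the points to \<open>phi\<close>, turning
  the type A product \<open>Delta\<close> into a type C Vandermonde product.\<close>

lemma cubic_term_factor:
  assumes g: "gen_params r \<xi> \<alpha>"
  shows "cubic_term r \<xi> \<alpha> n k = kern r \<xi> \<alpha> n k * coef r \<xi> \<alpha> k"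
proof -
  define M where "M = weight r k"
  define G where "G = base_factor \<alpha> M
         / (\<Prod>i=1..r. poch K (3 * \<alpha> + \<xi> i + 3 * \<eta>) (k i))"
  have pair: "\<sigma> (pt \<xi> i (k i) - pt \<xi> j (k j)) / \<sigma> (\<xi> i - \<xi> j) * (1 / poch K (\<xi> i + \<xi> j) (k i + k j))
      = phi (pt \<xi> i (k i)) (pt \<xi> j (k j)) * (1 / (\<sigma> (\<xi> i - \<xi> j) * poch K (\<xi> i + \<xi> j) (Suc (k i + k j))))"
    if "i \<in> {1..r}" "j \<in> {i<..r}" for i j
  proof -
    have "qregular (\<xi> i + \<xi> j)" using g that by (auto simp: gen_params_def)
    then have "\<sigma> (pt \<xi> i (k i) + pt \<xi> j (k j)) \<noteq> 0"
      by (rule qregularD[where t = "3 * int (k i + k j)"]) (unfold pt_def, simp add: algebra_simps)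
    moreover have "poch K (\<xi> i + \<xi> j) (Suc (k i + k j))
        = poch K (\<xi> i + \<xi> j) (k i + k j) * \<sigma> (pt \<xi> i (k i) + pt \<xi> j (k j))"
      unfolding poch_Suc pt_def by (simp add: algebra_simps)
    ultimately show ?thesis by (simp add: phi_def)
  qed
  have col: "\<sigma> (\<alpha> + \<xi> i + of_nat (M + 3 * k i) * \<eta>) / \<sigma> (\<alpha> + \<xi> i)
         * (poch \<eta> (\<alpha> + \<xi> i) M * poch \<eta> (\<alpha> - \<xi> i + \<eta>) (M - k i)
            / (poch \<eta> (\<alpha> + \<xi> i + of_nat (3 * n i + 1) * \<eta>) M
               * poch \<eta> (\<alpha> - \<xi> i + of_int (1 - 3 * int (n i)) * \<eta>) M
               * poch \<eta> (\<xi> i - \<alpha> + of_int (int (k i) - int M) * \<eta>) (2 * k i)))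
      = phi (anchor \<alpha> M) (pt \<xi> i (k i)) / (\<Prod>t=1..M. phi (anchor \<alpha> t) (pt \<xi> i (n i))) * coef_column (\<xi> i) \<alpha> M (k i)"
    if i: "i \<in> {1..r}" for i
  proof -
    have "(\<Prod>t=1..M. phi (anchor \<alpha> t) (pt \<xi> i (n i)))
        = poch \<eta> (\<alpha> + \<xi> i + of_nat (3 * n i + 1) * \<eta>) M * poch \<eta> (\<alpha> - \<xi> i + of_int (1 - 3 * int (n i)) * \<eta>) M"
      unfolding poch_def prod.distrib[symmetric] prod.atLeast1_atMost_eq One_nat_def
      by (intro prod.cong refl) (unfold phi_def anchor_def pt_def, simp add: algebra_simps)
    moreover have "phi (anchor \<alpha> M) (pt \<xi> i (k i))
        = \<sigma> (\<alpha> + \<xi> i + of_nat (M + 3 * k i) * \<eta>) * \<sigma> (anchor \<alpha> M - (\<xi> i + of_nat (k i) * K))"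
      unfolding phi_def anchor_def pt_def by (simp add: algebra_simps)
    moreover have "\<sigma> (anchor \<alpha> M - (\<xi> i + of_nat (k i) * K)) \<noteq> 0"
      using phi_anchor_nz(2)[OF g i, of M "k i"] by (simp add: pt_def)
    ultimately show ?thesis unfolding coef_column_def by simp
  qed
  have sq: "poch K (\<xi> i - \<xi> j - of_nat (n j) * K) (k i)
          * poch K (\<xi> i + \<xi> j + of_nat (n j) * K) (k i)
          / poch K (\<xi> i - \<xi> j + 3 * \<eta>) (k i)
      = (\<Prod>t<k i. phi (pt \<xi> i t) (pt \<xi> j (n j))) * (1 / poch K (\<xi> i - \<xi> j + 3 * \<eta>) (k i))" for i j
  proof -
    have "(\<Prod>t<k i. phi (pt \<xi> i t) (pt \<xi> j (n j))) = poch K (\<xi> i - \<xi> j - of_nat (n j) * K) (k i)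
          * poch K (\<xi> i + \<xi> j + of_nat (n j) * K) (k i)"
      unfolding poch_def prod.distrib[symmetric] by (intro prod.cong refl) (unfold phi_def pt_def, simp add: algebra_simps)
    then show ?thesis by simp
  qed
  have pairs: "(\<Prod>i=1..r. \<Prod>j\<in>{i<..r}. \<sigma> (pt \<xi> i (k i) - pt \<xi> j (k j)) / \<sigma> (\<xi> i - \<xi> j))
     * (\<Prod>i=1..r. \<Prod>j\<in>{i<..r}. 1 / poch K (\<xi> i + \<xi> j) (k i + k j))
     = vand r (pts \<xi> k)
     * (\<Prod>i=1..r. \<Prod>j\<in>{i<..r}. 1 / (\<sigma> (\<xi> i - \<xi> j) * poch K (\<xi> i + \<xi> j) (Suc (k i + k j))))"
    unfolding vand_def prod.distrib[symmetric] by (intro prod.cong refl pair)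
  have cols: "(\<Prod>i=1..r. \<sigma> (\<alpha> + \<xi> i + of_nat (M + 3 * k i) * \<eta>) / \<sigma> (\<alpha> + \<xi> i)
         * (poch \<eta> (\<alpha> + \<xi> i) M * poch \<eta> (\<alpha> - \<xi> i + \<eta>) (M - k i)
            / (poch \<eta> (\<alpha> + \<xi> i + of_nat (3 * n i + 1) * \<eta>) M
               * poch \<eta> (\<alpha> - \<xi> i + of_int (1 - 3 * int (n i)) * \<eta>) M
               * poch \<eta> (\<xi> i - \<alpha> + of_int (int (k i) - int M) * \<eta>) (2 * k i))))
      = (\<Prod>i=1..r. phi (anchor \<alpha> M) (pt \<xi> i (k i)) / (\<Prod>t=1..M. phi (anchor \<alpha> t) (pt \<xi> i (n i))))
        * (\<Prod>i=1..r. coef_column (\<xi> i) \<alpha> M (k i))"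
    unfolding prod.distrib[symmetric] by (intro prod.cong refl col)
  show ?thesis
    unfolding cubic_term_def M_def[symmetric] G_def[symmetric] pairs cols sq
    unfolding kern_def coef_def M_def[symmetric] G_def[symmetric] prod.distrib
    by (simp only: mult_ac)
qed

text \<open>Triangularity: if m i < k i, the factor with t = m i compares a point with
  itself.\<close>

lemma kern_zero:
  assumes "k \<in> box r n" "k \<notin> box r m"
  shows "kern r \<xi> \<alpha> m k = 0"
proof -
  obtain i where i: "i \<in> {1..r}" "m i < k i"
    using assms by (auto simp: PiE_iff not_le)
  then have "(\<Prod>t<k i. phi (pt \<xi> i t) (pt \<xi> i (m i))) = 0"
    by (auto simp: prod_zero_iff intro!: bexI[of _ "m i"])
  then have "(\<Prod>i=1..r. \<Prod>j=1..r. \<Prod>t<k i. phi (pt \<xi> i t) (pt \<xi> j (m j))) = 0"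
    using i(1) by (simp only: prod_zero_iff finite_atLeastAtMost) blast
  then show ?thesis by (simp add: kern_def)
qed

text \<open>The denominator of \<open>kern\<close> cancels the anchors 1, ..., |k| of
  \<open>fwd\<close>, and anchor 0 is divided out. For each index there remain |n| - |k| - 1 anchors
  and the |k| numerator factors of \<open>kern\<close>, together |n| - 1: the count of
  \<open>box_sum_zero\<close>.\<close>

lemma fwd_kern_orth:
  assumes g: "gen_params r \<xi> \<alpha>" and less: "weight r k < weight r n"
  shows "(\<Sum>m\<in>box r n. fwd r \<xi> \<alpha> n m * kern r \<xi> \<alpha> m k) = 0"
proof -
  define M where "M = weight r k"
  define N where "N = weight r n"
  define L where "L = {M<..<N} <+> (SIGMA i:{1..r}. {..<k i})"
  define w where "w = case_sum (anchor \<alpha>) (\<lambda>(i, t). pt \<xi> i t)"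
  have w: "(\<Prod>l\<in>L. phi (w l) u) = (\<Prod>t\<in>{M<..<N}. phi (anchor \<alpha> t) u) * (\<Prod>i=1..r. \<Prod>t<k i. phi (pt \<xi> i t) u)" for u
    unfolding L_def w_def by (subst prod.Plus) (auto simp: prod.Sigma split_def)
  have quot: "(\<Prod>t<N. phi (anchor \<alpha> t) (pt \<xi> j s)) / phi (anchor \<alpha> 0) (pt \<xi> j s) / D
      * (P / (\<Prod>t=1..M. phi (anchor \<alpha> t) (pt \<xi> j s)))
      = P * ((\<Prod>t\<in>{M<..<N}. phi (anchor \<alpha> t) (pt \<xi> j s)) / D)" if j: "j \<in> {1..r}" for j s D P
  proof -
    have "{..<N} = insert 0 {1..M} \<union> {M<..<N}" using less by (auto simp: M_def N_def)
    moreover have "insert 0 {1..M} \<inter> {M<..<N} = {}" by auto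
    ultimately have "(\<Prod>t<N. phi (anchor \<alpha> t) (pt \<xi> j s)) = phi (anchor \<alpha> 0) (pt \<xi> j s)
        * (\<Prod>t=1..M. phi (anchor \<alpha> t) (pt \<xi> j s)) * (\<Prod>t\<in>{M<..<N}. phi (anchor \<alpha> t) (pt \<xi> j s))"
      by (simp add: prod.union_disjoint)
    moreover have "(\<Prod>t=1..M. phi (anchor \<alpha> t) (pt \<xi> j s)) \<noteq> 0"
      using phi_anchor_nz(1)[OF g j] by simp
    ultimately show ?thesis using phi_anchor_nz(1)[OF g j, of 0 s] by simp
  qed
  define C where "C = vand r (pts \<xi> k) * (\<Prod>j=1..r. phi (anchor \<alpha> M) (pt \<xi> j (k j)))"
  have "fwd r \<xi> \<alpha> n m * kern r \<xi> \<alpha> m k = C * (vand r (pts \<xi> m)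
      * (\<Prod>j=1..r. (\<Prod>l\<in>L. phi (w l) (pt \<xi> j (m j))) / grid_den r n (pt \<xi>) j (m j)))" for m
  proof -
    have "(\<Prod>j=1..r. (\<Prod>t<N. phi (anchor \<alpha> t) (pt \<xi> j (m j))) / phi (anchor \<alpha> 0) (pt \<xi> j (m j)) / grid_den r n (pt \<xi>) j (m j))
      * (\<Prod>j=1..r. phi (anchor \<alpha> M) (pt \<xi> j (k j)) / (\<Prod>t=1..M. phi (anchor \<alpha> t) (pt \<xi> j (m j))))
      = (\<Prod>j=1..r. phi (anchor \<alpha> M) (pt \<xi> j (k j)))
        * (\<Prod>j=1..r. (\<Prod>t\<in>{M<..<N}. phi (anchor \<alpha> t) (pt \<xi> j (m j))) / grid_den r n (pt \<xi>) j (m j))"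
      unfolding prod.distrib[symmetric] by (intro prod.cong refl quot)
    moreover have "(\<Prod>i=1..r. \<Prod>j=1..r. \<Prod>t<k i. phi (pt \<xi> i t) (pt \<xi> j (m j)))
       = (\<Prod>j=1..r. \<Prod>i=1..r. \<Prod>t<k i. phi (pt \<xi> i t) (pt \<xi> j (m j)))"
      by (rule prod.swap)
    moreover have "(\<Prod>j=1..r. (\<Prod>l\<in>L. phi (w l) (pt \<xi> j (m j))) / grid_den r n (pt \<xi>) j (m j))
      = (\<Prod>j=1..r. (\<Prod>t\<in>{M<..<N}. phi (anchor \<alpha> t) (pt \<xi> j (m j))) / grid_den r n (pt \<xi>) j (m j))
        * (\<Prod>j=1..r. \<Prod>i=1..r. \<Prod>t<k i. phi (pt \<xi> i t) (pt \<xi> j (m j)))"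
      unfolding w prod.distrib[symmetric] by simp
    ultimately show ?thesis
      unfolding fwd_def kern_def C_def M_def[symmetric] N_def[symmetric] by (simp add: mult_ac)
  qed
  then have "(\<Sum>m\<in>box r n. fwd r \<xi> \<alpha> n m * kern r \<xi> \<alpha> m k)
    = C * (\<Sum>m\<in>box r n. vand r (pts \<xi> m)
      * (\<Prod>j=1..r. (\<Prod>l\<in>L. phi (w l) (pt \<xi> j (m j))) / grid_den r n (pt \<xi>) j (m j)))"
    by (simp add: sum_distrib_left)
  also have "\<dots> = 0"
  proof -
    have "card (SIGMA i:{1..r}. {..<k i}) = M"
      by (subst card_SigmaI) (auto simp: M_def weight_def)
    then have "card L + 1 = (\<Sum>i=1..r. n i)"
      using less by (simp add: L_def card_Plus M_def N_def weight_def)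
    then have "(\<Sum>m\<in>box r n. vand r (pts \<xi> m)
      * (\<Prod>j=1..r. (\<Prod>l\<in>L. phi (w l) (pt \<xi> j (m j))) / grid_den r n (pt \<xi>) j (m j))) = 0"
      by (intro box_sum_zero grid_distinct_pt[OF gen_params_points[OF g]]) (auto simp: L_def)
    then show ?thesis by simp
  qed
  finally show ?thesis .
qed

lemma vand_nz:
  assumes "gen_params r \<xi> \<alpha>"
  shows "vand r (pts \<xi> n) \<noteq> 0"
proof -
  have d: "grid_distinct r n (pt \<xi>)" by (rule grid_distinct_pt[OF gen_params_points[OF assms]])
  have "phi (pt \<xi> i (n i)) (pt \<xi> j (n j)) \<noteq> 0" if "i \<in> {1..r}" "j \<in> {i<..r}" for i j
    using that by (intro d[unfolded grid_distinct_def, rule_format]) auto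
  then show ?thesis unfolding vand_def by (simp add: prod_zero_iff)
qed

lemma fwd_nz:
  assumes "gen_params r \<xi> \<alpha>"
  shows "fwd r \<xi> \<alpha> n n \<noteq> 0"
  unfolding fwd_def
  using vand_nz[OF assms] phi_anchor_nz(1)[OF assms]
    grid_den_nz[OF grid_distinct_pt[OF gen_params_points[OF assms]]]
  by (simp add: prod_zero_iff)

text \<open>The anchors cancel, and so do the points below the tops of the blocks. What is left of
  \<open>grid_den\<close> are the pairs of top points in both orders, which is the squared
  Vandermonde product with one sign per pair. The same sign reappears in
  \<open>inverse_jackson_den\<close>.\<close>

lemma fwd_kern_diag:
  assumes g: "gen_params r \<xi> \<alpha>"
  shows "fwd r \<xi> \<alpha> n n * kern r \<xi> \<alpha> n n = pair_sign r"
proof -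
  define N where "N = weight r n"
  define z where "z j = pt \<xi> j (n j)" for j
  define a where "a j = (\<Prod>t<N. phi (anchor \<alpha> t) (z j)) / phi (anchor \<alpha> 0) (z j)" for j
  define b where "b j = phi (anchor \<alpha> N) (z j) / (\<Prod>t=1..N. phi (anchor \<alpha> t) (z j))" for j
  define d where "d j = grid_den r n (pt \<xi>) j (n j)" for j
  define q where "q j = (\<Prod>i=1..r. \<Prod>t<n i. phi (pt \<xi> i t) (z j))" for j
  \<comment> \<open>The diagonal value 1 replaces \<open>phi\<close> at equal points, which is 0 and
    is excluded from \<open>grid_den\<close>; this makes \<open>square_pairs\<close>
    applicable.\<close>
  define e where "e i j = (if i = j then 1 else phi (z i) (z j))" for i j
  have ab: "a j * b j = 1" if j: "j \<in> {1..r}" for j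
  proof -
    have "{..<Suc N} = insert 0 {1..N}" by auto
    then have "(\<Prod>t<N. phi (anchor \<alpha> t) (z j)) * phi (anchor \<alpha> N) (z j) = phi (anchor \<alpha> 0) (z j) * (\<Prod>t=1..N. phi (anchor \<alpha> t) (z j))"
      using prod.lessThan_Suc[of "\<lambda>t. phi (anchor \<alpha> t) (z j)" N] by simp
    moreover have "(\<Prod>t=1..N. phi (anchor \<alpha> t) (z j)) \<noteq> 0"
      unfolding z_def using phi_anchor_nz(1)[OF g j] by simp
    ultimately show ?thesis
      using phi_anchor_nz(1)[OF g j, of 0 "n j"] by (simp add: a_def b_def z_def)
  qed
  have d: "d j = q j * (\<Prod>i=1..r. e i j)" if j: "j \<in> {1..r}" for j
  proof -
    have "d j = (\<Prod>i=1..r. \<Prod>t\<in>{0..n i} - (if i = j then {n i} else {}). phi (pt \<xi> i t) (z j))"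
      unfolding d_def grid_den_def z_def
      by (subst prod.Sigma) (auto intro!: prod.cong split: if_splits)
    also have "\<dots> = (\<Prod>i=1..r. (\<Prod>t<n i. phi (pt \<xi> i t) (z j)) * e i j)"
    proof (rule prod.cong)
      fix i
      show "(\<Prod>t\<in>{0..n i} - (if i = j then {n i} else {}). phi (pt \<xi> i t) (z j)) = (\<Prod>t<n i. phi (pt \<xi> i t) (z j)) * e i j"
      proof (cases "i = j")
        case True
        have "{0..n j} - {n j} = {..<n j}" by auto
        then show ?thesis using True by (simp add: e_def)
      next
        case False
        have "{0..n i} = insert (n i) {..<n i}" by auto
        then show ?thesis using False by (simp add: e_def z_def)
      qed
    qed simp
    finally show ?thesis by (simp add: q_def prod.distrib)
  qed
  have dnz: "d j \<noteq> 0" if j: "j \<in> {1..r}" for j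
    unfolding d_def by (rule grid_den_nz[OF grid_distinct_pt[OF gen_params_points[OF g]] j]) simp
  define V where "V = vand r z"
  have V: "V = (\<Prod>i=1..r. \<Prod>j\<in>{i<..r}. e i j)"
    unfolding V_def vand_def e_def by (intro prod.cong) auto
  have "(\<Prod>j=1..r. \<Prod>i=1..r. e i j) = (\<Prod>i=1..r. \<Prod>j\<in>{i<..r}. e j i * e i j)"
    using prod.square_pairs[of "\<lambda>j i. e i j" r] by (simp add: e_def)
  also have "\<dots> = (\<Prod>i=1..r. \<Prod>j\<in>{i<..r}. (- 1) * (e i j * e i j))"
  proof (intro prod.cong refl)
    fix i j assume "j \<in> {i<..r}"
    then show "e j i * e i j = (- 1) * (e i j * e i j)"
      using skew[of "z j" "z i"] by (simp add: e_def)
  qed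
  also have "\<dots> = pair_sign r * (V * V)"
    unfolding V prod.distrib ..
  finally have ee: "(\<Prod>j=1..r. \<Prod>i=1..r. e i j) = pair_sign r * (V * V)" .
  have sq1: "pair_sign r * pair_sign r = (1 :: complex)"
    unfolding prod.distrib[symmetric] by simp
  have "fwd r \<xi> \<alpha> n n = V * (\<Prod>j=1..r. a j / d j)"
    unfolding fwd_def N_def[symmetric] V_def a_def d_def z_def by simp
  moreover have "kern r \<xi> \<alpha> n n = V * (\<Prod>j=1..r. b j) * (\<Prod>j=1..r. q j)"
    unfolding kern_def N_def[symmetric] V_def b_def q_def z_def
    by (subst (3) prod.swap) simp
  ultimately have "fwd r \<xi> \<alpha> n n * kern r \<xi> \<alpha> n n = V * V * (\<Prod>j=1..r. a j * b j * (q j / d j))"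
    by (simp add: prod.distrib prod_dividef)
  also have "(\<Prod>j=1..r. a j * b j * (q j / d j)) = (\<Prod>j=1..r. 1 / (\<Prod>i=1..r. e i j))"
    using dnz by (intro prod.cong) (auto simp: ab d)
  also have "\<dots> = 1 / (pair_sign r * (V * V))"
    unfolding prod_dividef ee by simp
  also have "V * V * \<dots> = pair_sign r"
  proof -
    have "V \<noteq> 0" unfolding V_def z_def by (rule vand_nz[OF g])
    then show ?thesis using sq1 by (simp add: field_simps)
  qed
  finally show ?thesis .
qed

text \<open>Identifies the constant of \<open>column_E4\<close>, up to its last denominator. The
  interval from k - M to 3 k is cut after -1 and after 3 k - M, which turns one quotient of runs
  into the other.\<close>

lemma coef_column_run:
  assumes g: "qregular (x - \<alpha>)" and k: "k \<le> M"
  shows "- ((- 1) ^ M) * poch \<eta> (\<alpha> + x) M / \<sigma> (\<alpha> + x)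
      * (run (x - \<alpha>) (3 * int k - int M + 1) (3 * int k) / run (x - \<alpha>) 0 (3 * int k))
    = (- 1) ^ k * coef_column x \<alpha> M k"
proof -
  define B where "B = x - \<alpha>"
  have gB: "qregular B" using g by (simp add: B_def)
  define r0 where "r0 = run B 0 (3 * int k)"
  define r1 where "r1 = run B (3 * int k - int M + 1) (3 * int k)"
  define r2 where "r2 = run B (int k - int M) (- 1)"
  define r3 where "r3 = run B (int k - int M) (3 * int k - int M)"
  have nz: "r0 \<noteq> 0" "r3 \<noteq> 0" unfolding r0_def r3_def by (rule run_nz[OF gB])+
  have "run B (int k - int M) (3 * int k) = r3 * r1"
    unfolding r1_def r3_def by (rule run_split) (use k in auto)
  moreover have "run B (int k - int M) (3 * int k) = r2 * r0"
    unfolding r2_def r0_def by (subst run_split[where b = "- 1"]) (use k in auto)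
  ultimately have r: "r1 / r0 = r2 / r3" using nz by (simp add: field_simps)
  have p1: "poch \<eta> (\<alpha> - x + \<eta>) (M - k) = (- 1) ^ (M - k) * r2"
    using poch_run_neg[of "\<alpha> - x + \<eta>" B "- 1" "M - k"] k by (simp add: B_def r2_def of_nat_diff)
  have p2: "\<sigma> (anchor \<alpha> M - (x + of_nat k * K)) * poch \<eta> (B + of_int (int k - int M) * \<eta>) (2 * k) = - r3"
  proof -
    have "\<sigma> (anchor \<alpha> M - (x + of_nat k * K)) = - \<sigma> (B + of_int (int k - int M) * \<eta> + of_nat (2 * k) * \<eta>)"
      using odd[of "anchor \<alpha> M - (x + of_nat k * K)"] by (simp add: anchor_def B_def algebra_simps)
    then have "\<sigma> (anchor \<alpha> M - (x + of_nat k * K)) * poch \<eta> (B + of_int (int k - int M) * \<eta>) (2 * k)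
        = - poch \<eta> (B + of_int (int k - int M) * \<eta>) (Suc (2 * k))"
      by (simp add: poch_Suc)
    also have "\<dots> = - r3"
      unfolding r3_def by (subst poch_run[OF refl]) (simp add: algebra_simps)
    finally show ?thesis .
  qed
  have sg: "(- 1) ^ k * (- 1) ^ (M - k) = ((- 1) ^ M :: complex)"
    using k by (simp add: power_add[symmetric])
  have "coef_column x \<alpha> M k = poch \<eta> (\<alpha> + x) M * ((- 1) ^ (M - k) * r2) / (\<sigma> (\<alpha> + x) * (- r3))"
    unfolding coef_column_def B_def[symmetric] mult.assoc[of "\<sigma> (\<alpha> + x)"] p2 p1 ..
  then have "(- 1) ^ k * coef_column x \<alpha> M k
      = - ((- 1) ^ k * (- 1) ^ (M - k)) * poch \<eta> (\<alpha> + x) M / \<sigma> (\<alpha> + x) * (r2 / r3)"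
    by simp
  then show ?thesis
    unfolding B_def[symmetric] r0_def[symmetric] r1_def[symmetric] r sg by simp
qed

text \<open>For each l the three arguments are consecutive in steps of \<eta>, so the whole product
  is a single run from 1 - M to 2 M; cutting it after 0 gives the two factors.\<close>

lemma jackson_prod_cubic:
  "jackson_prod M (- 3 * \<alpha>) (\<alpha> + of_nat M * \<eta>) (\<alpha> + of_nat (M + 1) * \<eta>) (\<alpha> + of_nat (M + 2) * \<eta>)
    = (- 1) ^ M * (base_factor \<alpha> M)"
proof -
  \<comment> \<open>The upper limit N is separated from the shift M to make induction
    possible.\<close>
  have "(\<Prod>l=1..N. \<sigma> (of_nat l * K - (- 3 * \<alpha>) - (\<alpha> + of_nat M * \<eta>))
       * \<sigma> (of_nat l * K - (- 3 * \<alpha>) - (\<alpha> + of_nat (M + 1) * \<eta>))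
       * \<sigma> (of_nat l * K - (- 3 * \<alpha>) - (\<alpha> + of_nat (M + 2) * \<eta>)))
     = run (2 * \<alpha>) (1 - int M) (3 * int N - int M)" for N
  proof (induction N)
    case 0
    then show ?case by (simp add: run_def)
  next
    case (Suc N)
    have r: "run (2 * \<alpha>) (1 - int M) (3 * int (Suc N) - int M) = run (2 * \<alpha>) (1 - int M) (3 * int N - int M)
       * run (2 * \<alpha>) (3 * int N - int M + 1) (3 * int N - int M + 1 + 2)"
      by (subst run_split[where b = "3 * int N - int M"]) (auto simp: algebra_simps)
    have "{1..Suc N} = insert (Suc N) {1..N}" by auto
    then show ?case
      unfolding r run_3 Suc.IH[symmetric] by (simp add: algebra_simps)
  qed
  then have "jackson_prod M (- 3 * \<alpha>) (\<alpha> + of_nat M * \<eta>) (\<alpha> + of_nat (M + 1) * \<eta>) (\<alpha> + of_nat (M + 2) * \<eta>)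
    = run (2 * \<alpha>) (1 - int M) (2 * int M)"
    by (simp add: jackson_prod_def)
  also have "\<dots> = run (2 * \<alpha>) (1 - int M) 0 * run (2 * \<alpha>) 1 (2 * int M)"
    by (subst run_split[where b = 0]) auto
  also have "run (2 * \<alpha>) 1 (2 * int M) = poch \<eta> (2 * \<alpha> + \<eta>) (2 * M)"
    by (subst poch_run[where u = "2 * \<alpha>" and a = 1]) auto
  also have "run (2 * \<alpha>) (1 - int M) 0 = (- 1) ^ M * poch \<eta> (- 2 * \<alpha>) M"
    by (subst poch_run_neg[where u = "2 * \<alpha>" and b = 0]) (auto simp: power_add[symmetric] mult.assoc[symmetric] algebra_simps)
  finally show ?thesis by simp
qed

text \<open>For each pair, the product starting at t = 0 supplies \<sigma> (\<xi> i - \<xi> j) with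
  a minus sign, hence \<open>pair_sign\<close>; the remaining factors fill the square array of
  factorials in \<open>coef\<close>.\<close>

lemma inverse_jackson_den:
  assumes g: "gen_params r \<xi> \<alpha>"
  shows "1 / jackson_den r \<xi> n = pair_sign r
    * (\<Prod>i=1..r. \<Prod>j\<in>{i<..r}. 1 / (\<sigma> (\<xi> i - \<xi> j) * poch K (\<xi> i + \<xi> j) (Suc (n i + n j))))
    * (\<Prod>i=1..r. \<Prod>j=1..r. 1 / poch K (\<xi> i - \<xi> j + 3 * \<eta>) (n i))"
proof -
  define p where "p i j = poch K (\<xi> i - \<xi> j + 3 * \<eta>) (n i)" for i j
  define P where "P i j = poch K (\<xi> i + \<xi> j) (Suc (n i + n j))" for i j
  have A: "(\<Prod>t=1..n j. \<sigma> (of_nat t * K)) = p j j" for j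
    using prod_from1_poch[of 0 "3 * \<eta>" "n j"] by (simp add: p_def)
  have B: "(\<Prod>t=0..n j. \<sigma> (\<xi> j - \<xi> i + of_nat t * K)) = - \<sigma> (\<xi> i - \<xi> j) * p j i" for i j
  proof -
    have "poch K (\<xi> j - \<xi> i) (1 + n j) = \<sigma> (\<xi> j - \<xi> i) * p j i"
      unfolding poch_add by (simp add: p_def poch_Suc)
    then show ?thesis
      unfolding prod_nat_run using odd[of "\<xi> i - \<xi> j"] by simp
  qed
  have "1 / jackson_den r \<xi> n = (\<Prod>j=1..r. 1 / p j j)
      * (\<Prod>i=1..r. \<Prod>j\<in>{i<..r}. 1 / (- \<sigma> (\<xi> i - \<xi> j) * p j i * p i j * P i j))"
    unfolding jackson_den_def A B
    unfolding prod_nat_run prod_from1_poch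
    unfolding p_def[symmetric] P_def[symmetric] prod_dividef prod.neutral_const by simp
  also have "\<dots> = (\<Prod>j=1..r. 1 / p j j) * (\<Prod>i=1..r. \<Prod>j\<in>{i<..r}. - 1 * (1 / (\<sigma> (\<xi> i - \<xi> j) * P i j)) * ((1 / p i j) * (1 / p j i)))"
    by (simp add: mult_ac)
  also have "\<dots> = pair_sign r * (\<Prod>i=1..r. \<Prod>j\<in>{i<..r}. 1 / (\<sigma> (\<xi> i - \<xi> j) * P i j))
     * (\<Prod>i=1..r. \<Prod>j=1..r. 1 / p i j)"
    unfolding prod.square_pairs[of "\<lambda>i j. 1 / p i j"] prod.distrib by (simp only: mult_ac)
  finally show ?thesis by (simp only: p_def P_def)
qed

lemma jackson_den_nz:
  assumes g: "gen_params r \<xi> \<alpha>"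
  shows "jackson_den r \<xi> n \<noteq> 0"
proof -
  have "\<sigma> (of_nat t * K) \<noteq> 0" if "t \<in> {1..n j}" for t j
    using step_nz[of "int t"] that by simp
  moreover have "\<sigma> (\<xi> j - \<xi> i + of_nat t * K) \<noteq> 0" "\<sigma> (\<xi> i - \<xi> j + of_nat t * K) \<noteq> 0"
    "\<sigma> (\<xi> i + \<xi> j + of_nat t * K) \<noteq> 0" if "i \<in> {1..r}" "j \<in> {i<..r}" for i j t
  proof -
    have "qregular (\<xi> j - \<xi> i)" "qregular (\<xi> i - \<xi> j)" "qregular (\<xi> i + \<xi> j)"
      using g that by (auto simp: gen_params_def)
    note gens = this[THEN qregular_imp_regular]
    show "\<sigma> (\<xi> j - \<xi> i + of_nat t * K) \<noteq> 0" "\<sigma> (\<xi> i - \<xi> j + of_nat t * K) \<noteq> 0"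
      "\<sigma> (\<xi> i + \<xi> j + of_nat t * K) \<noteq> 0"
      using regular_of_int[OF gens(1), of "int t"] regular_of_int[OF gens(2), of "int t"] regular_of_int[OF gens(3), of "int t"] by simp_all
  qed
  ultimately show ?thesis
    unfolding jackson_den_def by auto
qed

text \<open>The inverted identity. By \<open>column_E4\<close> its left-hand side is a Jackson sum;
  it is balanced because \<alpha> cancels and the three shifts add up to (3 M + 3) \<eta> = (M + 1)
  K.\<close>

lemma fwd_cubic_column:
  assumes g: "gen_params r \<xi> \<alpha>"
  shows "(\<Sum>m\<in>box r n. fwd r \<xi> \<alpha> n m * (\<Prod>j=1..r. cubic_column (\<xi> j) \<alpha> (m j)))
    = pair_sign r * coef r \<xi> \<alpha> n"
proof -
  define M where "M = weight r n"
  define p where "p j = poch K (3 * \<alpha> + \<xi> j + 3 * \<eta>) (n j)" for j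
  define C where "C j = (- 1) ^ n j * coef_column (\<xi> j) \<alpha> M (n j) / p j" for j
  define b where "b = - 3 * \<alpha>"
  define c where "c = \<alpha> + of_nat M * \<eta>"
  define d where "d = \<alpha> + of_nat (M + 1) * \<eta>"
  define e where "e = \<alpha> + of_nat (M + 2) * \<eta>"
  let ?B = "box r n"
  have gx: "qregular (\<alpha> + \<xi> j)" "qregular (\<xi> j - \<alpha>)" "qregular (3 * \<alpha> + \<xi> j)" "qregular (\<xi> j - 3 * \<alpha>)" if "j \<in> {1..r}" for j
    using g that by (auto simp: gen_params_def)
  have nM: "n j \<le> M" if "j \<in> {1..r}" for j
    unfolding M_def weight_def using that by (intro member_le_sum) auto
  have col: "column (\<xi> j) \<alpha> M s = C j * E4 (\<xi> j) \<alpha> M (n j) s" if j: "j \<in> {1..r}" and s: "s \<le> n j" for j s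
    unfolding column_E4[OF gx(1-3)[OF j] s] coef_column_run[OF gx(2)[OF j] nM[OF j]] C_def p_def ..
  have "(\<Sum>m\<in>?B. fwd r \<xi> \<alpha> n m * (\<Prod>j=1..r. cubic_column (\<xi> j) \<alpha> (m j)))
    = (\<Sum>m\<in>?B. (\<Prod>j=1..r. C j) * (vand r (pts \<xi> m)
        * (\<Prod>j=1..r. E4 (\<xi> j) \<alpha> M (n j) (m j) / grid_den r n (pt \<xi>) j (m j))))"
  proof (rule sum.cong)
    fix m assume m: "m \<in> ?B"
    have "(\<Prod>j=1..r. (\<Prod>t<M. phi (anchor \<alpha> t) (pt \<xi> j (m j))) / phi (anchor \<alpha> 0) (pt \<xi> j (m j))
          / grid_den r n (pt \<xi>) j (m j)) * (\<Prod>j=1..r. cubic_column (\<xi> j) \<alpha> (m j))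
       = (\<Prod>j=1..r. column (\<xi> j) \<alpha> M (m j) / grid_den r n (pt \<xi>) j (m j))"
      unfolding prod.distrib[symmetric] column_def pt_def by (intro prod.cong) auto
    also have "\<dots> = (\<Prod>j=1..r. C j * (E4 (\<xi> j) \<alpha> M (n j) (m j) / grid_den r n (pt \<xi>) j (m j)))"
    proof (intro prod.cong refl)
      fix j assume j: "j \<in> {1..r}"
      have le: "m j \<le> n j" using m j by (auto simp: PiE_iff)
      show "column (\<xi> j) \<alpha> M (m j) / grid_den r n (pt \<xi>) j (m j) = C j * (E4 (\<xi> j) \<alpha> M (n j) (m j) / grid_den r n (pt \<xi>) j (m j))"
        unfolding col[OF j le] by simp
    qed
    finally have 1: "(\<Prod>j=1..r. (\<Prod>t<M. phi (anchor \<alpha> t) (pt \<xi> j (m j))) / phi (anchor \<alpha> 0) (pt \<xi> j (m j))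
          / grid_den r n (pt \<xi>) j (m j)) * (\<Prod>j=1..r. cubic_column (\<xi> j) \<alpha> (m j)) = \<dots>" .
    show "fwd r \<xi> \<alpha> n m * (\<Prod>j=1..r. cubic_column (\<xi> j) \<alpha> (m j))
      = (\<Prod>j=1..r. C j) * (vand r (pts \<xi> m)
        * (\<Prod>j=1..r. E4 (\<xi> j) \<alpha> M (n j) (m j) / grid_den r n (pt \<xi>) j (m j)))"
      unfolding fwd_def M_def[symmetric] mult.assoc 1 prod.distrib by (simp only: mult_ac)
  qed simp
  also have "\<dots> = (\<Prod>j=1..r. C j) * jackson_sum r \<xi> n b c d e"
    unfolding jackson_sum_def sum_distrib_left E4_def b_def c_def d_def e_def ..
  also have "jackson_sum r \<xi> n b c d e = jackson_prod M b c d e / jackson_den r \<xi> n"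
  proof -
    have "jackson_sum r \<xi> n b c d e * jackson_den r \<xi> n = jackson_prod M b c d e"
    proof (rule jackson)
      show "gen_points r \<xi>" by (rule gen_params_points[OF g])
      show "(\<Sum>i=1..r. n i) = M" by (simp add: M_def weight_def)
      show "b + c + d + e = of_nat (Suc M) * K"
        by (simp add: b_def c_def d_def e_def algebra_simps)
      have g2: "qregular (2 * \<alpha>)" "qregular (4 * \<alpha>)" using g by (auto simp: gen_params_def)
      show "regular (b - c)"
        by (rule qregular_minus_shift[OF g2(2), where t = "- int M"]) (simp add: b_def c_def algebra_simps)
      show "regular (b + d)"
        by (rule qregular_minus_shift[OF g2(1), where t = "int (M + 1)"]) (simp add: b_def d_def algebra_simps)
      show "regular (b + e)"
        by (rule qregular_minus_shift[OF g2(1), where t = "int (M + 2)"]) (simp add: b_def e_def algebra_simps)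
    next
      fix i assume i: "i \<in> {1..r}"
      have "regular (\<xi> i + b)"
        by (rule qregular_shift[OF gx(4)[OF i], where t = 0]) (simp add: b_def)
      moreover have "regular (\<xi> i - b)"
        by (rule qregular_shift[OF gx(3)[OF i], where t = 0]) (simp add: b_def)
      ultimately show "regular (\<xi> i + b) \<and> regular (\<xi> i - b)" ..
      have "regular (\<xi> i + c)"
        by (rule qregular_shift[OF gx(1)[OF i], where t = "int M"]) (simp add: c_def)
      moreover have "regular (\<xi> i - c)"
        by (rule qregular_shift[OF gx(2)[OF i], where t = "- int M"]) (simp add: c_def)
      ultimately show "regular (\<xi> i + c) \<and> regular (\<xi> i - c)" ..
      have "regular (\<xi> i - d)"
        by (rule qregular_shift[OF gx(2)[OF i], where t = "- int (M + 1)"]) (simp add: d_def algebra_simps)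
      moreover have "regular (\<xi> i - e)"
        by (rule qregular_shift[OF gx(2)[OF i], where t = "- int (M + 2)"]) (simp add: e_def algebra_simps)
      ultimately show "regular (\<xi> i - d) \<and> regular (\<xi> i - e)" ..
    next
      fix i j assume "i \<in> {1..r}" "j \<in> {1..r}" "i \<noteq> j"
      then have "qregular (\<xi> i + \<xi> j - 2 * \<alpha>)" using g by (auto simp: gen_params_def)
      then show "regular (\<xi> i + \<xi> j + b + c)"
        by (rule qregular_shift[where t = "int M"]) (simp add: b_def c_def algebra_simps)
    qed
    then show ?thesis using jackson_den_nz[OF g, of n] by (simp add: field_simps)
  qed
  also have "(\<Prod>j=1..r. C j) = (- 1) ^ M * (\<Prod>j=1..r. coef_column (\<xi> j) \<alpha> M (n j)) / (\<Prod>j=1..r. p j)"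
    unfolding C_def prod_dividef prod.distrib by (simp add: power_sum M_def weight_def)
  also have "jackson_prod M b c d e = (- 1) ^ M * (base_factor \<alpha> M)"
    unfolding b_def c_def d_def e_def by (rule jackson_prod_cubic)
  also have "(- 1) ^ M * (\<Prod>j=1..r. coef_column (\<xi> j) \<alpha> M (n j)) / (\<Prod>j=1..r. p j)
      * ((- 1) ^ M * (base_factor \<alpha> M) / jackson_den r \<xi> n)
     = ((- 1) ^ M * (- 1) ^ M) * ((\<Prod>j=1..r. coef_column (\<xi> j) \<alpha> M (n j))
       * (base_factor \<alpha> M / (\<Prod>j=1..r. p j)) * (1 / jackson_den r \<xi> n))"
    by (simp add: mult_ac)
  also have "(- 1) ^ M * (- 1) ^ M = (1 :: complex)"
    by (simp add: power_mult_distrib[symmetric])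
  also have "1 * ((\<Prod>j=1..r. coef_column (\<xi> j) \<alpha> M (n j))
       * (base_factor \<alpha> M / (\<Prod>j=1..r. p j)) * (1 / jackson_den r \<xi> n))
     = pair_sign r * coef r \<xi> \<alpha> n"
    unfolding inverse_jackson_den[OF g] coef_def M_def[symmetric] p_def[symmetric] by (simp only: mult_ac mult_1)
  finally show ?thesis .
qed

text \<open>By orthogonality and triangularity the sum of F S over m reduces to a diagonal term, and
  the Jackson sum gives the same value for F R. In the resulting sum of F (S - R) the induction
  hypothesis kills all terms but m = n. The tuple is extensional so that it is an element of its own
  box.\<close>

theorem cubic_sum_generic:
  assumes g: "gen_params r \<xi> \<alpha>" and ext: "n \<in> extensional {1..r}"
  shows "(\<Sum>k\<in>box r n. cubic_term r \<xi> \<alpha> n k) = (\<Prod>j=1..r. cubic_column (\<xi> j) \<alpha> (n j))"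
  using ext
proof (induction "weight r n" arbitrary: n rule: less_induct)
  case less
  define S where "S m = (\<Sum>k\<in>box r m. cubic_term r \<xi> \<alpha> m k)" for m :: "nat \<Rightarrow> nat"
  define R where "R m = (\<Prod>j=1..r. cubic_column (\<xi> j) \<alpha> (m j))" for m :: "nat \<Rightarrow> nat"
  define F where "F = fwd r \<xi> \<alpha> n"
  let ?B = "box r n"
  have fin: "finite ?B" by (intro finite_PiE) auto
  have nB: "n \<in> ?B" using less.prems by (auto simp: PiE_iff)
  have smaller: "weight r m < weight r n" if "m \<in> ?B" "m \<noteq> n" for m
  proof -
    have le: "m i \<le> n i" if "i \<in> {1..r}" for i using \<open>m \<in> ?B\<close> that by (auto simp: PiE_iff)
    have "\<exists>i\<in>{1..r}. m i \<noteq> n i"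
    proof (rule ccontr)
      assume "\<not> ?thesis"
      then have "m = n" using that(1) less.prems by (intro extensionalityI[of m "{1..r}"]) (auto simp: PiE_iff)
      then show False using that(2) by simp
    qed
    then obtain i where "i \<in> {1..r}" "m i < n i" using le by (metis order_le_neq_trans)
    then show ?thesis unfolding weight_def using le by (intro sum_strict_mono_ex1) auto
  qed
  have S: "S m = (\<Sum>k\<in>?B. kern r \<xi> \<alpha> m k * coef r \<xi> \<alpha> k)" if m: "m \<in> ?B" for m
  proof -
    have "box r m \<subseteq> ?B" using m by (intro PiE_mono) (auto simp: PiE_iff)
    then show ?thesis
      unfolding S_def cubic_term_factor[OF g]
    proof (intro sum.mono_neutral_left fin ballI)
      fix k assume "k \<in> ?B - box r m"
      then show "kern r \<xi> \<alpha> m k * coef r \<xi> \<alpha> k = 0" using kern_zero[of k r n m] by simp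
    qed
  qed
  have "(\<Sum>m\<in>?B. F m * S m) = (\<Sum>m\<in>?B. \<Sum>k\<in>?B. F m * kern r \<xi> \<alpha> m k * coef r \<xi> \<alpha> k)"
    by (simp add: S sum_distrib_left mult.assoc)
  also have "\<dots> = (\<Sum>k\<in>?B. (\<Sum>m\<in>?B. F m * kern r \<xi> \<alpha> m k) * coef r \<xi> \<alpha> k)"
    by (subst sum.swap) (simp add: sum_distrib_right)
  also have "\<dots> = (\<Sum>m\<in>?B. F m * kern r \<xi> \<alpha> m n) * coef r \<xi> \<alpha> n"
  proof -
    have "(\<Sum>m\<in>?B. F m * kern r \<xi> \<alpha> m k) = 0" if "k \<in> ?B - {n}" for k
      unfolding F_def using that by (intro fwd_kern_orth[OF g] smaller) auto
    then show ?thesis by (subst sum.remove[OF fin nB]) simp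
  qed
  also have "(\<Sum>m\<in>?B. F m * kern r \<xi> \<alpha> m n) = F n * kern r \<xi> \<alpha> n n"
  proof -
    have "kern r \<xi> \<alpha> m n = 0" if m: "m \<in> ?B - {n}" for m
    proof (rule kern_zero[OF nB])
      show "n \<notin> box r m"
      proof
        assume "n \<in> box r m"
        then have "weight r n \<le> weight r m" unfolding weight_def by (intro sum_mono) (auto simp: PiE_iff)
        then show False using smaller[of m] m by auto
      qed
    qed
    then show ?thesis by (subst sum.remove[OF fin nB]) simp
  qed
  also have "F n * kern r \<xi> \<alpha> n n * coef r \<xi> \<alpha> n = (\<Sum>m\<in>?B. F m * R m)"
    unfolding F_def R_def fwd_kern_diag[OF g] fwd_cubic_column[OF g] ..
  finally have "(\<Sum>m\<in>?B. F m * (S m - R m)) = 0"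
    by (simp add: right_diff_distrib sum_subtractf)
  moreover have "S m - R m = 0" if "m \<in> ?B - {n}" for m
    unfolding S_def R_def using less.hyps[of m] smaller[of m] that by (auto simp: PiE_iff)
  ultimately have "F n * (S n - R n) = 0"
    by (subst (asm) sum.remove[OF fin nB]) simp
  then show ?case
    unfolding F_def using fwd_nz[OF g] by (simp add: S_def R_def)
qed

end

section \<open>The theta function\<close>

definition qprod :: "complex \<Rightarrow> complex \<Rightarrow> complex" where
  "qprod p x = (\<Prod>j. 1 - p ^ j * x)"

lemma abs_convergent_qprod:
  fixes p x :: complex
  assumes "norm p < 1"
  shows "abs_convergent_prod (\<lambda>j. 1 - p ^ j * x)"
proof -
  have "summable (\<lambda>j. norm p ^ j * norm x)"
    using assms by (intro summable_mult2 summable_geometric) simp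
  then show ?thesis
    by (intro summable_imp_abs_convergent_prod) (simp add: norm_mult norm_power)
qed

lemma convergent_qprod: "norm p < 1 \<Longrightarrow> convergent_prod (\<lambda>j. 1 - p ^ j * x)" for p x :: complex
  by (rule abs_convergent_prod_imp_convergent_prod[OF abs_convergent_qprod])

lemma qprod_eq_0_iff: "norm p < 1 \<Longrightarrow> qprod p x = 0 \<longleftrightarrow> (\<exists>j. p ^ j * x = 1)"
  using has_prod_eq_0_iff[OF convergent_prod_has_prod[OF convergent_qprod[of p x]]]
  unfolding qprod_def image_iff by (metis (no_types, lifting) UNIV_I eq_iff_diff_eq_0)

lemma qprod_unfold:
  assumes "norm p < 1"
  shows "qprod p x = (1 - x) * qprod p (p * x)"
proof (cases "x = 1")
  case True
  have "qprod p x = 0" unfolding qprod_eq_0_iff[OF assms] using True by (intro exI[of _ 0]) simp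
  then show ?thesis using True by simp
next
  case False
  then have "(\<Prod>j. 1 - p ^ Suc j * x) = qprod p x / (1 - x)"
    unfolding qprod_def using prodinf_split_head[OF convergent_qprod[OF assms, of x]] by simp
  moreover have "(\<lambda>j. 1 - p ^ Suc j * x) = (\<lambda>j. 1 - p ^ j * (p * x))"
    by (simp add: mult_ac)
  ultimately show ?thesis using False by (simp add: qprod_def)
qed

lemma qprod_0 [simp]: "qprod p 0 = 1"
  by (simp add: qprod_def)

lemma qprod_holomorphic:
  assumes p: "norm p < 1"
  shows "qprod p holomorphic_on UNIV"
proof (rule holomorphic_uniform_sequence[where f = "\<lambda>N x. \<Prod>j<N. 1 - p ^ j * x"])
  fix x :: complex
  let ?C = "cball x 1"
  have "uniformly_convergent_on ?C (\<lambda>N y. \<Sum>n<N. norm (p ^ n * y))"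
  proof (rule Weierstrass_m_test'[where M = "\<lambda>n. norm p ^ n * (norm x + 1)"])
    show "summable (\<lambda>n. norm p ^ n * (norm x + 1))"
      using p by (intro summable_mult2 summable_geometric) simp
    fix n y assume "y \<in> ?C"
    then have "norm y \<le> norm x + 1"
      using norm_triangle_ineq2[of y x] by (simp add: dist_norm norm_minus_commute)
    then show "norm (norm (p ^ n * y)) \<le> norm p ^ n * (norm x + 1)"
      by (simp add: norm_mult norm_power mult_left_mono)
  qed
  then have "uniformly_convergent_on ?C (\<lambda>N y. \<Prod>j<N. 1 - p ^ j * y)"
    by (intro uniformly_convergent_on_prod') (auto intro!: continuous_intros)
  then obtain l where l: "uniform_limit ?C (\<lambda>N y. \<Prod>j<N. 1 - p ^ j * y) l sequentially"
    unfolding uniformly_convergent_on_def by blast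
  have "l y = qprod p y" if "y \<in> ?C" for y
  proof (rule LIMSEQ_unique)
    show "(\<lambda>N. \<Prod>j<N. 1 - p ^ j * y) \<longlonglongrightarrow> l y"
      by (rule tendsto_uniform_limitI[OF l that])
    show "(\<lambda>N. \<Prod>j<N. 1 - p ^ j * y) \<longlonglongrightarrow> qprod p y"
      unfolding qprod_def using convergent_prod_LIMSEQ[OF convergent_qprod[OF p, of y]]
      by (simp add: LIMSEQ_lessThan_iff_atMost)
  qed
  then have "uniform_limit ?C (\<lambda>N y. \<Prod>j<N. 1 - p ^ j * y) (qprod p) sequentially"
    using l by (subst uniform_limit_cong'[where i = l]) auto
  then show "\<exists>d>0. cball x d \<subseteq> UNIV \<and> uniform_limit (cball x d) (\<lambda>N y. \<Prod>j<N. 1 - p ^ j * y) (qprod p) sequentially"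
    by (intro exI[of _ 1]) auto
qed (auto intro!: holomorphic_intros)

lemma theta_qprod: "norm p < 1 \<Longrightarrow> theta p x = qprod p x * qprod p (p / x)"
  unfolding theta_def qprod_def
  by (subst prodinf_mult[OF convergent_qprod convergent_qprod]) (simp_all add: mult_ac)

lemma theta_eq_0:
  assumes p: "norm p < 1" and x: "x \<noteq> 0" and "theta p x = 0"
  shows "\<exists>m. x = p powi m"
proof -
  consider j where "p ^ j * x = 1" | j where "p ^ j * (p / x) = 1"
    using assms(3) unfolding theta_qprod[OF p] by (auto simp: qprod_eq_0_iff[OF p])
  then show ?thesis
  proof cases
    case 1
    then have "x = p powi (- int j)"
      using inverse_unique[of "p ^ j" x] by (simp add: power_int_minus)
    then show ?thesis by blast
  next
    case 2
    then have "x = p ^ Suc j"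
      using x by (simp add: field_simps)
    then have "x = p powi int (Suc j)"
      by (simp only: power_int_of_nat)
    then show ?thesis by blast
  qed
qed

lemma theta_inverse:
  assumes p: "norm p < 1" and x: "x \<noteq> 0"
  shows "x * theta p (1 / x) = - theta p x"
proof -
  have "qprod p (1 / x) = (1 - 1 / x) * qprod p (p / x)"
    using qprod_unfold[OF p, of "1 / x"] by simp
  then have *: "x * qprod p (1 / x) = (x - 1) * qprod p (p / x)"
    using x by (simp add: field_simps)
  have "x * theta p (1 / x) = (x * qprod p (1 / x)) * qprod p (p * x)"
    by (simp add: theta_qprod[OF p] mult_ac)
  also have "\<dots> = - theta p x"
    unfolding * theta_qprod[OF p] qprod_unfold[OF p, of x] by (simp add: algebra_simps)
  finally show ?thesis .
qed

lemma theta_shift: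
  assumes p: "norm p < 1" "p \<noteq> 0" and x: "x \<noteq> 0"
  shows "x * theta p (p * x) = - theta p x"
proof -
  have "theta p (p * x) = theta p (1 / x)"
    using p by (simp add: theta_qprod[OF p(1)] mult_ac)
  then show ?thesis using theta_inverse[OF p(1) x] by simp
qed

lemma isCont_qprod: "norm p < 1 \<Longrightarrow> isCont (qprod p) x"
  using holomorphic_on_imp_continuous_on[OF qprod_holomorphic] by (simp add: continuous_on_eq_continuous_at)

lemma isCont_theta:
  assumes "norm p < 1" "isCont f z" "f z \<noteq> 0"
  shows "isCont (\<lambda>w. theta p (f w)) z"
  unfolding theta_qprod[OF assms(1)]
  using assms by (intro isCont_mult isCont_o2[OF _ isCont_qprod] isCont_divide continuous_const)

text \<open>The exponential factor makes the function odd. The price is a sign under translation by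
  2 pi \<i>, which drops out in products of two values.\<close>

definition theta_add :: "complex \<Rightarrow> complex \<Rightarrow> complex" where
  "theta_add p w = exp (- w / 2) * theta p (exp w)"

lemma theta_add_odd:
  assumes "norm p < 1"
  shows "theta_add p (- w) = - theta_add p w"
proof -
  have e: "exp (w / 2) = exp (- w / 2) * exp w"
    unfolding exp_add[symmetric] by (rule arg_cong[of _ _ exp]) (simp add: field_simps)
  have "theta_add p (- w) = exp (- w / 2) * (exp w * theta p (1 / exp w))"
    by (simp only: theta_add_def exp_minus[of w] inverse_eq_divide minus_minus e mult.assoc)
  also have "\<dots> = - theta_add p w"
    using theta_inverse[OF assms, of "exp w"] by (simp add: theta_add_def)
  finally show ?thesis .
qed

lemma theta_add_holomorphic:
  assumes "norm p < 1"
  shows "theta_add p holomorphic_on UNIV"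
proof -
  have *: "qprod p holomorphic_on S" for S
    using qprod_holomorphic[OF assms] holomorphic_on_subset by blast
  have 1: "(qprod p \<circ> exp) holomorphic_on UNIV"
    by (intro holomorphic_on_compose * holomorphic_intros)
  have 2: "(qprod p \<circ> (\<lambda>w. p / exp w)) holomorphic_on UNIV"
    by (intro holomorphic_on_compose * holomorphic_intros) auto
  have "(\<lambda>w. exp (- w / 2) * ((qprod p \<circ> exp) w * (qprod p \<circ> (\<lambda>w. p / exp w)) w)) holomorphic_on UNIV"
    by (intro holomorphic_intros 1 2) auto
  then show ?thesis
    unfolding theta_add_def[abs_def] theta_qprod[OF assms] by simp
qed

lemma theta_add_eq_0:
  assumes "norm p < 1" "theta_add p w = 0"
  shows "\<exists>m. exp w = p powi m"
  using theta_eq_0[OF assms(1), of "exp w"] assms(2) by (simp add: theta_add_def)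

section \<open>Simple zeros, Liouville's theorem and the three-term relation\<close>

lemma shift_invariant_int:
  fixes \<omega> :: complex
  assumes "\<And>w. P (w + \<omega>) \<longleftrightarrow> P w"
  shows "P (w + of_int m * \<omega>) \<longleftrightarrow> P w"
proof (induction m rule: int_induct[where k = 0])
  case (step1 m)
  then show ?case using assms[of "w + of_int m * \<omega>"] by (simp add: algebra_simps)
next
  case (step2 m)
  then show ?case using assms[of "w + of_int (m - 1) * \<omega>"] by (simp add: algebra_simps)
qed simp

text \<open>Since Re \<tau> is nonzero, \<tau> and 2 pi \<i> are independent over the reals, so
  every value is attained on a compact period parallelogram.\<close>

lemma doubly_periodic_bounded:
  fixes H :: "complex \<Rightarrow> complex" and \<tau> :: complex
  assumes cont: "continuous_on UNIV H" and \<tau>: "Re \<tau> \<noteq> 0"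
    and per1: "\<And>w. H (w + 2 * pi * \<i>) = H w" and per2: "\<And>w. H (w + \<tau>) = H w"
  shows "bounded (range H)"
proof -
  define L where "L = (\<lambda>(s, t). complex_of_real s * (2 * pi * \<i>) + complex_of_real t * \<tau>)"
  define D where "D = L ` ({0..1} \<times> {0..1})"
  have "compact D"
    unfolding D_def L_def split_def
    by (intro compact_continuous_image continuous_intros compact_Times compact_Icc)
  then have "compact (H ` D)"
    using cont by (intro compact_continuous_image) (auto intro: continuous_on_subset)
  moreover have "range H \<subseteq> H ` D"
  proof
    fix y assume "y \<in> range H"
    then obtain w where y: "y = H w" by auto
    define t where "t = Re w / Re \<tau>"
    define s where "s = (Im w - t * Im \<tau>) / (2 * pi)"
    have w: "w = L (s, t)"
      using \<tau> by (intro complex_eqI) (simp_all add: L_def t_def s_def)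
    define w' where "w' = L (frac s, frac t)"
    have "w' \<in> D" unfolding D_def w'_def
      by (auto simp: frac_ge_0 less_imp_le[OF frac_lt_1])
    have fr: "s = frac s + of_int \<lfloor>s\<rfloor>" "t = frac t + of_int \<lfloor>t\<rfloor>" by (simp_all add: frac_def)
    have "complex_of_real s = complex_of_real (frac s) + of_int \<lfloor>s\<rfloor>"
      "complex_of_real t = complex_of_real (frac t) + of_int \<lfloor>t\<rfloor>"
      by (subst fr, simp)+
    then have "w = (w' + of_int \<lfloor>s\<rfloor> * (2 * pi * \<i>)) + of_int \<lfloor>t\<rfloor> * \<tau>"
      unfolding w w'_def L_def by (simp add: algebra_simps)
    then have "H w = H w'"
      using shift_invariant_int[of "\<lambda>v. H v = H w'" \<tau>] shift_invariant_int[of "\<lambda>v. H v = H w'" "2 * pi * \<i>"]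
        per1 per2 by metis
    then show "y \<in> H ` D" using y \<open>w' \<in> D\<close> by blast
  qed
  ultimately show ?thesis
    using compact_imp_bounded bounded_subset by blast
qed

text \<open>The quotient f / g extends over the simple zeros of g to an entire function; the common
  multiplier cancels, so it is doubly periodic, hence bounded and constant.\<close>

lemma quasi_periodic_proportional:
  fixes f g :: "complex \<Rightarrow> complex" and \<tau> :: complex
  assumes f: "f holomorphic_on UNIV" and g: "g holomorphic_on UNIV" and \<tau>: "Re \<tau> \<noteq> 0"
    and f1: "\<And>w. f (w + 2 * pi * \<i>) = f w" and g1: "\<And>w. g (w + 2 * pi * \<i>) = g w"
    and f2: "\<And>w. f (w + \<tau>) = \<mu> w * f w" and g2: "\<And>w. g (w + \<tau>) = \<mu> w * g w"
    and \<mu>: "\<And>w. \<mu> w \<noteq> 0"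
    and zeros: "\<And>w. g w = 0 \<Longrightarrow> f w = 0 \<and> deriv g w \<noteq> 0"
  shows "\<exists>c. \<forall>w. f w = c * g w"
proof -
  \<comment> \<open>At a zero of g the value is the limit given by l'Hopital's rule, which makes H
    continuous and the zeros removable.\<close>
  define H where "H w = (if g w = 0 then deriv f w / deriv g w else f w / g w)" for w
  have df: "(f has_field_derivative deriv f w) (at w)" and dg: "(g has_field_derivative deriv g w) (at w)" for w
    using f g holomorphic_derivI[OF _ open_UNIV UNIV_I] by blast+
  have iso: "eventually (\<lambda>w. g w \<noteq> 0) (at w0)" for w0
  proof (cases "g w0 = 0")
    case True
    have "((\<lambda>w. (g w - g w0) / (w - w0)) \<longlongrightarrow> deriv g w0) (at w0)"
      using dg has_field_derivative_iff by blast
    then have "eventually (\<lambda>w. (g w - g w0) / (w - w0) \<noteq> 0) (at w0)"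
      using zeros[OF True] by (intro tendsto_imp_eventually_ne) auto
    then show ?thesis by eventually_elim (use True in auto)
  next
    case False
    have "isCont g w0" using dg DERIV_isCont by blast
    then show ?thesis using False by (intro tendsto_imp_eventually_ne[of g "g w0"]) (simp_all add: isCont_def)
  qed
  have lim: "(H \<longlongrightarrow> H w0) (at w0)" for w0
  proof -
    have "((\<lambda>w. f w / g w) \<longlongrightarrow> H w0) (at w0)"
    proof (cases "g w0 = 0")
      case True
      then show ?thesis
        using zeros[OF True] lhopital_complex_simple[OF df dg _ True _ refl] by (simp add: H_def)
    next
      case False
      have "isCont (\<lambda>w. f w / g w) w0"
        using False DERIV_isCont[OF df] DERIV_isCont[OF dg] by (intro isCont_divide) auto
      then show ?thesis using False by (simp add: H_def isCont_def)
    qed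
    moreover have "eventually (\<lambda>w. f w / g w = H w) (at w0)"
      using iso by eventually_elim (simp add: H_def)
    ultimately show ?thesis by (rule Lim_transform_eventually)
  qed
  then have contH: "continuous_on UNIV H" by (simp add: continuous_on_def)
  have "H holomorphic_on UNIV"
  proof -
    have "\<exists>e>0. H holomorphic_on ball w0 e" for w0
    proof -
      obtain e where e: "e > 0" "\<And>w. w \<in> ball w0 e \<Longrightarrow> w \<noteq> w0 \<Longrightarrow> g w \<noteq> 0"
        using iso[of w0] unfolding eventually_at by (auto simp: dist_commute)
      have "(\<lambda>w. f w / g w) holomorphic_on (ball w0 e - {w0})"
        using e f g by (intro holomorphic_on_divide) (auto intro: holomorphic_on_subset)
      then have "H holomorphic_on (ball w0 e - {w0})"
        by (rule holomorphic_transform) (use e in \<open>auto simp: H_def\<close>)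
      then have "H holomorphic_on ball w0 e"
        by (rule no_isolated_singularity[OF continuous_on_subset[OF contH subset_UNIV] _ open_ball]) simp
      then show ?thesis using e by blast
    qed
    then show ?thesis
      unfolding holomorphic_on_def by (metis UNIV_I centre_in_ball at_within_open open_ball)
  qed
  moreover have "bounded (range H)"
  proof (rule doubly_periodic_bounded[OF contH \<tau>])
    \<comment> \<open>Periodicity is immediate where g is nonzero; the zeros are isolated, and
      continuity of H extends it to them.\<close>
    have per: "H (w + \<omega>) = H w" if *: "\<And>w. g w \<noteq> 0 \<Longrightarrow> H (w + \<omega>) = H w" for \<omega> w
    proof (rule tendsto_unique[of "at w"])
      have "((\<lambda>v. H (v + \<omega>)) \<longlongrightarrow> H (w + \<omega>)) (at w)"
        using contH by (intro isCont_tendsto_compose[of _ H]) (auto simp: continuous_on_eq_continuous_at intro!: tendsto_intros)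
      moreover have "eventually (\<lambda>v. H (v + \<omega>) = H v) (at w)"
        using iso[of w] by eventually_elim (rule *)
      ultimately show "(H \<longlongrightarrow> H (w + \<omega>)) (at w)" by (rule Lim_transform_eventually)
    qed (use lim in auto)
    show "H (w + 2 * pi * \<i>) = H w" for w
      by (rule per) (simp only: H_def f1 g1 if_False)
    show "H (w + \<tau>) = H w" for w
      by (rule per) (simp add: H_def f2 g2 \<mu>)
  qed
  ultimately obtain c where c: "\<And>w. H w = c"
    using Liouville_theorem unfolding constant_on_def by blast
  have "f w = c * g w" for w
    using c[of w] zeros[of w] by (cases "g w = 0") (auto simp: H_def field_simps)
  then show ?thesis by blast
qed

lemma theta_add_shift:
  assumes "norm p < 1" "exp \<tau> = p"
  shows "theta_add p (w + \<tau>) = - exp (- \<tau> / 2 - w) * theta_add p w"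
proof -
  have "p \<noteq> 0" using assms(2) exp_not_eq_zero by metis
  have "theta p (exp (w + \<tau>)) = exp (- w) * (exp w * theta p (p * exp w))"
    by (simp add: exp_add assms(2) mult_ac exp_minus)
  also have "\<dots> = - exp (- w) * theta p (exp w)"
    using theta_shift[OF assms(1) \<open>p \<noteq> 0\<close>, of "exp w"] by simp
  finally have 1: "theta p (exp (w + \<tau>)) = - exp (- w) * theta p (exp w)" .
  have "exp (- (w + \<tau>) / 2) * exp (- w) = exp (- \<tau> / 2 - w) * exp (- w / 2)"
    unfolding exp_add[symmetric] by (rule arg_cong[of _ _ exp]) (simp add: field_simps)
  then show ?thesis unfolding theta_add_def 1 by (simp add: mult_ac)
qed

lemma theta_add_2pi: "theta_add p (w + 2 * pi * \<i>) = - theta_add p w"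
proof -
  have "exp (- (w + 2 * pi * \<i>) / 2) = exp (- w / 2 - pi * \<i>)"
    by (rule arg_cong[of _ _ exp]) (simp add: field_simps)
  then have "exp (- (w + 2 * pi * \<i>) / 2) = - exp (- w / 2)"
    by (simp add: exp_diff)
  moreover have "exp (w + 2 * pi * \<i>) = exp w" by (simp add: exp_add)
  ultimately show ?thesis by (simp add: theta_add_def)
qed

text \<open>Differentiating the relation at a zero of f leaves
  \<open>deriv f (w + \<omega>) = deriv f w * \<mu> w\<close>.\<close>

lemma simple_zero_shift:
  fixes f \<mu> :: "complex \<Rightarrow> complex"
  assumes f: "f holomorphic_on UNIV" and \<mu>: "\<mu> holomorphic_on UNIV" "\<And>w. \<mu> w \<noteq> 0"
    and eq: "\<And>w. f (w + \<omega>) = \<mu> w * f w"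
  shows "f (w + \<omega>) = 0 \<and> deriv f (w + \<omega>) \<noteq> 0 \<longleftrightarrow> f w = 0 \<and> deriv f w \<noteq> 0"
proof (cases "f w = 0")
  case True
  have df: "(f has_field_derivative deriv f v) (at v)" and dm: "(\<mu> has_field_derivative deriv \<mu> v) (at v)" for v
    using f \<mu> holomorphic_derivI[OF _ open_UNIV UNIV_I] by blast+
  have "((\<lambda>v. f (v + \<omega>)) has_field_derivative deriv f (w + \<omega>)) (at w)"
    using df[of "w + \<omega>"] DERIV_shift[of f "deriv f (w + \<omega>)" w \<omega>] by simp
  moreover have "((\<lambda>v. f (v + \<omega>)) has_field_derivative (deriv \<mu> w * f w + deriv f w * \<mu> w)) (at w)"
    unfolding eq by (rule DERIV_mult[OF dm df])
  ultimately have "deriv f (w + \<omega>) = deriv f w * \<mu> w"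
    using True DERIV_unique by fastforce
  then show ?thesis using True \<mu>(2) by (simp add: eq)
qed (simp add: eq \<mu>(2))

text \<open>The zero comes from the factor 1 - exp w, split off from the product. The cofactor is
  nonzero at 0 because no positive power of p equals 1.\<close>

lemma theta_add_simple_zero_0:
  assumes p: "norm p < 1"
  shows "theta_add p 0 = 0 \<and> deriv (theta_add p) 0 \<noteq> 0"
proof -
  define B where "B w = qprod p (p * exp w) * qprod p (p / exp w)" for w
  have eq: "theta_add p w = (exp (- w / 2) * (1 - exp w)) * B w" for w
    by (simp add: theta_add_def B_def theta_qprod[OF p] qprod_unfold[OF p, of "exp w"])
  have dq: "(qprod p has_field_derivative deriv (qprod p) x) (at x)" for x
    by (rule holomorphic_derivI[OF qprod_holomorphic[OF p] open_UNIV UNIV_I])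
  have "((\<lambda>w. qprod p (p * exp w)) has_field_derivative deriv (qprod p) p * p) (at 0)"
    by (rule DERIV_chain2[of "qprod p"]) (auto intro!: derivative_eq_intros dq)
  moreover have "((\<lambda>w. qprod p (p / exp w)) has_field_derivative deriv (qprod p) p * (- p)) (at 0)"
    by (rule DERIV_chain2[of "qprod p"]) (auto intro!: derivative_eq_intros dq)
  ultimately obtain B' where "(B has_field_derivative B') (at 0)"
    unfolding B_def[abs_def] using DERIV_mult by blast
  moreover have "((\<lambda>w. exp (- w / 2) * (1 - exp w)) has_field_derivative - 1) (at (0 :: complex))"
    by (auto intro!: derivative_eq_intros)
  ultimately have "((\<lambda>w. (exp (- w / 2) * (1 - exp w)) * B w) has_field_derivative - B 0) (at 0)"
    using DERIV_mult by fastforce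
  then have "deriv (theta_add p) 0 = - B 0"
    unfolding eq by (rule DERIV_imp_deriv)
  moreover have "qprod p p \<noteq> 0"
  proof
    assume "qprod p p = 0"
    then obtain j where "p ^ j * p = 1" by (auto simp: qprod_eq_0_iff[OF p])
    then have "norm p ^ Suc j = 1" by (metis norm_one norm_power power_Suc2)
    then show False using p power_less_one_iff[of "norm p" "Suc j"] by simp
  qed
  ultimately show ?thesis by (simp add: eq B_def)
qed

text \<open>At a zero, exp w is a power of p, which places w on the lattice spanned by Ln p and 2 pi
  \<i>. The two quasi-period relations carry the simple zero at 0 to every lattice point.\<close>

lemma theta_add_simple_zero:
  assumes p: "norm p < 1" "p \<noteq> 0" and "theta_add p w = 0"
  shows "deriv (theta_add p) w \<noteq> 0" "\<exists>m n. w = of_int m * Ln p + of_int n * (2 * pi * \<i>)"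
proof -
  define \<tau> where "\<tau> = Ln p"
  have \<tau>: "exp \<tau> = p" using p by (simp add: \<tau>_def)
  obtain m where m: "exp w = p powi m" using theta_add_eq_0[OF p(1) assms(3)] by blast
  have "exp w = exp (of_int m * \<tau>)" unfolding m \<tau>[symmetric] by (simp add: exp_power_int)
  then obtain n :: int where n: "w = of_int m * \<tau> + (of_int (2 * n) * pi) * \<i>"
    by (auto simp: exp_eq)
  then show ex: "\<exists>m n. w = of_int m * Ln p + of_int n * (2 * pi * \<i>)"
    unfolding \<tau>_def[symmetric] by (intro exI[of _ m] exI[of _ n]) (simp add: mult_ac)
  have w: "w = (0 + of_int m * \<tau>) + of_int n * (2 * pi * \<i>)" using n by (simp add: mult_ac)
  let ?Z = "\<lambda>w. theta_add p w = 0 \<and> deriv (theta_add p) w \<noteq> 0"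
  have 1: "?Z (v + \<tau>) \<longleftrightarrow> ?Z v" for v
    by (rule simple_zero_shift[OF theta_add_holomorphic[OF p(1)] _ _ theta_add_shift[OF p(1) \<tau>]])
      (auto intro!: holomorphic_intros)
  have neg: "theta_add p (v + 2 * pi * \<i>) = (\<lambda>_. - 1) v * theta_add p v" for v
    by (simp only: theta_add_2pi mult_minus1)
  have 2: "?Z (v + 2 * pi * \<i>) \<longleftrightarrow> ?Z v" for v
    by (rule simple_zero_shift[OF theta_add_holomorphic[OF p(1)] _ _ neg]) auto
  have "?Z w"
    unfolding w shift_invariant_int[of ?Z, OF 2] shift_invariant_int[of ?Z, OF 1]
    by (rule theta_add_simple_zero_0[OF p(1)])
  then show "deriv (theta_add p) w \<noteq> 0" by simp
qed

lemma rank_two_three_term: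
  fixes \<Phi> :: "'b \<Rightarrow> 'b \<Rightarrow> 'a::field"
  assumes "\<And>x y. k * \<Phi> x y = A x * B y - B x * A y" "k \<noteq> 0"
  shows "\<Phi> x y * \<Phi> u v = \<Phi> x u * \<Phi> y v - \<Phi> x v * \<Phi> y u"
proof -
  have "(k * \<Phi> x y) * (k * \<Phi> u v) = (k * \<Phi> x u) * (k * \<Phi> y v) - (k * \<Phi> x v) * (k * \<Phi> y u)"
    unfolding assms(1) by (simp add: algebra_simps)
  then have "(k * k) * (\<Phi> x y * \<Phi> u v) = (k * k) * (\<Phi> x u * \<Phi> y v - \<Phi> x v * \<Phi> y u)"
    by (simp add: algebra_simps)
  then show ?thesis using assms(2) by simp
qed

text \<open>By Liouville, \<open>\<Phi> x y\<close> is for fixed \<open>y\<close> a combination of \<open>\<Phi> x a\<close> and \<open>\<Phi> x 0\<close>, where \<open>a = pi * \<i> / 2\<close> is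
  chosen so that \<open>\<Phi> x a\<close> has simple zeros.\<close>

lemma theta_add_three_term:
  assumes p: "norm p < 1"
  shows "theta_add p (x + y) * theta_add p (x - y) * (theta_add p (u + v) * theta_add p (u - v))
    = theta_add p (x + u) * theta_add p (x - u) * (theta_add p (y + v) * theta_add p (y - v))
      - theta_add p (x + v) * theta_add p (x - v) * (theta_add p (y + u) * theta_add p (y - u))"
proof -
  let ?s = "theta_add p"
  define \<Phi> where "\<Phi> x y = ?s (x + y) * ?s (x - y)" for x y
  have odd: "?s (- w) = - ?s w" for w by (rule theta_add_odd[OF p])
  have even: "\<Phi> (- x) y = \<Phi> x y" for x y
    using odd[of "x + y"] odd[of "x - y"] by (simp add: \<Phi>_def)
  have skew: "\<Phi> y x = - \<Phi> x y" for x y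
    using odd[of "x - y"] by (simp add: \<Phi>_def add.commute)
  have "\<exists>k A B. k \<noteq> 0 \<and> (\<forall>x y. k * \<Phi> x y = A x * B y - B x * A y)"
  proof (cases "p = 0")
    \<comment> \<open>Here the function is -2 sinh (w / 2) and \<Phi> x y = 2 cosh x - 2 cosh y, a
      minor with second function 1.\<close>
    case True
    have q: "qprod 0 x = 1 - x" for x
      using qprod_unfold[of 0 x] by simp
    define c where "c w = exp w + exp (- w)" for w :: complex
    have "\<Phi> x y = c x - c y" for x y
    proof -
      have s: "?s w = exp (- w / 2) - exp (w / 2)" for w
      proof -
        have "exp (w / 2) = exp (- w / 2) * exp w"
          unfolding exp_add[symmetric] by (rule arg_cong[of _ _ exp]) (simp add: field_simps)
        then show ?thesis using True by (simp add: theta_add_def theta_qprod q algebra_simps)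
      qed
      have e: "exp a * exp b = exp (a + b)" for a b :: complex by (simp add: exp_add)
      show ?thesis unfolding \<Phi>_def s c_def left_diff_distrib right_diff_distrib e
        by (simp add: field_simps)
    qed
    then show ?thesis by (intro exI[of _ 1] exI[of _ c] exI[of _ "\<lambda>_. 1"]) simp
  next
    case False
    define \<tau> where "\<tau> = Ln p"
    have \<tau>: "exp \<tau> = p" using False by (simp add: \<tau>_def)
    have "Re \<tau> < 0"
      using p False by (simp add: \<tau>_def ln_less_zero)
    then have Re: "Re \<tau> \<noteq> 0" by simp
    \<comment> \<open>exp a = \<i> and exp (2 a) = -1 have norm 1 but differ from 1, so they are not
      powers of p. The first makes \<Phi> a 0 nonzero, the second keeps the zeros at a and - a apart
      modulo the periods.\<close>
    define a where "a = complex_of_real (pi / 2) * \<i>"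
    have norm1: "p powi m \<noteq> z" if "norm z = 1" "z \<noteq> 1" for z m
    proof
      assume *: "p powi m = z"
      then have "norm p powi m = 1" using that(1) by (simp add: norm_power_int[symmetric])
      then have "norm p ^ nat \<bar>m\<bar> = 1"
        by (cases "m \<ge> 0") (auto simp: power_int_def power_inverse)
      then have "m = 0" using p power_less_one_iff[of "norm p" "nat \<bar>m\<bar>"] by auto
      then show False using * that(2) by simp
    qed
    have sa: "?s a \<noteq> 0"
    proof
      assume "?s a = 0"
      then obtain m where "exp a = p powi m" using theta_add_eq_0[OF p] by blast
      moreover have "exp a = \<i>" by (simp add: a_def exp_eq_polar cis_conv_exp[symmetric])
      ultimately show False using norm1[of \<i> m] by simp
    qed
    have \<Phi>1: "\<Phi> (w + 2 * pi * \<i>) y = \<Phi> w y" for w y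
    proof -
      have "w + 2 * pi * \<i> + y = (w + y) + 2 * pi * \<i>" "w + 2 * pi * \<i> - y = (w - y) + 2 * pi * \<i>" by simp_all
      then show ?thesis unfolding \<Phi>_def by (simp only: theta_add_2pi minus_mult_minus)
    qed
    have \<Phi>2: "\<Phi> (w + \<tau>) y = exp (- \<tau> - 2 * w) * \<Phi> w y" for w y
    proof -
      have m: "w + \<tau> + y = (w + y) + \<tau>" "w + \<tau> - y = (w - y) + \<tau>" by simp_all
      have e: "exp (- \<tau> - 2 * w) = exp (- \<tau> / 2 - (w + y)) * exp (- \<tau> / 2 - (w - y))"
        unfolding exp_add[symmetric] by (rule arg_cong[of _ _ exp]) (simp add: field_simps)
      show ?thesis
        unfolding \<Phi>_def m e theta_add_shift[OF p \<tau>] by simp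
    qed
    have hol: "(\<lambda>w. \<Phi> w y) holomorphic_on UNIV" for y
    proof -
      have *: "?s holomorphic_on S" for S
        using theta_add_holomorphic[OF p] holomorphic_on_subset by blast
      have "(?s \<circ> (\<lambda>w. w + y)) holomorphic_on UNIV" "(?s \<circ> (\<lambda>w. w - y)) holomorphic_on UNIV"
        by (intro holomorphic_on_compose * holomorphic_intros)+
      then have "(\<lambda>w. (?s \<circ> (\<lambda>w. w + y)) w * (?s \<circ> (\<lambda>w. w - y)) w) holomorphic_on UNIV"
        by (rule holomorphic_on_mult)
      then show ?thesis by (simp add: \<Phi>_def)
    qed
    have simple: "deriv (\<lambda>w. \<Phi> w a) w \<noteq> 0 \<and> (\<exists>e\<in>{a, - a}. \<exists>m n. w = (e + of_int m * \<tau>) + of_int n * (2 * pi * \<i>))"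
      if zero: "\<Phi> w a = 0" for w
    proof -
      have ds: "(?s has_field_derivative deriv ?s v) (at v)" for v
        by (rule holomorphic_derivI[OF theta_add_holomorphic[OF p] open_UNIV UNIV_I])
      have "((\<lambda>w. \<Phi> w a) has_field_derivative deriv ?s (w + a) * ?s (w - a) + deriv ?s (w - a) * ?s (w + a)) (at w)"
        unfolding \<Phi>_def
        using ds[of "w + a"] ds[of "w - a"] DERIV_shift[of ?s _ w a] DERIV_shift[of ?s _ w "- a"]
        by (intro DERIV_mult) simp_all
      then have D: "deriv (\<lambda>w. \<Phi> w a) w = deriv ?s (w + a) * ?s (w - a) + deriv ?s (w - a) * ?s (w + a)"
        by (rule DERIV_imp_deriv)
      have notboth: "\<not> (?s (w + a) = 0 \<and> ?s (w - a) = 0)"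
      proof
        assume "?s (w + a) = 0 \<and> ?s (w - a) = 0"
        then obtain m n where "exp (w + a) = p powi m" "exp (w - a) = p powi n"
          using theta_add_eq_0[OF p] by blast
        then have "exp (w + a) / exp (w - a) = p powi (m - n)"
          using False by (simp add: power_int_diff)
        moreover have "exp (w + a) / exp (w - a) = - 1"
          unfolding exp_diff[symmetric] by (simp add: a_def)
        moreover have "p powi (m - n) \<noteq> - 1" by (rule norm1) auto
        ultimately show False by metis
      qed
      consider "?s (w + a) = 0" "?s (w - a) \<noteq> 0" | "?s (w - a) = 0" "?s (w + a) \<noteq> 0"
        using zero notboth by (auto simp: \<Phi>_def)
      then show ?thesis
      proof cases
        case 1
        obtain m n where "w + a = of_int m * \<tau> + of_int n * (2 * pi * \<i>)"
          using theta_add_simple_zero(2)[OF p False 1(1)] unfolding \<tau>_def by blast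
        then have "w = (- a + of_int m * \<tau>) + of_int n * (2 * pi * \<i>)"
          by (simp only: eq_diff_eq[symmetric]) (simp add: algebra_simps)
        then show ?thesis
          using D 1 theta_add_simple_zero(1)[OF p False 1(1)] by auto
      next
        case 2
        obtain m n where "w - a = of_int m * \<tau> + of_int n * (2 * pi * \<i>)"
          using theta_add_simple_zero(2)[OF p False 2(1)] unfolding \<tau>_def by blast
        then have "w = (a + of_int m * \<tau>) + of_int n * (2 * pi * \<i>)"
          by (simp only: diff_eq_eq) (simp add: algebra_simps)
        then show ?thesis
          using D 2 theta_add_simple_zero(1)[OF p False 2(1)] by auto
      qed
    qed
    have s0: "?s 0 = 0" using odd[of 0] by simp
    define k where "k = \<Phi> a 0"
    have k: "k \<noteq> 0" using sa by (simp add: k_def \<Phi>_def)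
    have "k * \<Phi> x y = \<Phi> x a * \<Phi> y 0 - \<Phi> x 0 * \<Phi> y a" for x y
    proof -
      \<comment> \<open>The coefficients are chosen so that f vanishes at w = a; evenness in w adds
        the zero at - a.\<close>
      define f where "f w = k * \<Phi> w y + \<Phi> y a * \<Phi> w 0" for w
      have f1: "f (w + 2 * pi * \<i>) = f w" for w
        unfolding f_def by (simp only: \<Phi>1)
      have f2: "f (w + \<tau>) = exp (- \<tau> - 2 * w) * f w" for w
        unfolding f_def \<Phi>2 by (simp add: algebra_simps)
      have fa: "f e = 0" if "e \<in> {a, - a}" for e
        using that skew[of y a] by (auto simp: f_def k_def even)
      have "\<exists>c. \<forall>w. f w = c * \<Phi> w a"
      proof (rule quasi_periodic_proportional[OF _ hol Re f1 \<Phi>1 f2 \<Phi>2])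
        show "f holomorphic_on UNIV"
          unfolding f_def[abs_def] by (intro holomorphic_intros hol)
        fix w assume "\<Phi> w a = 0"
        note s = simple[OF this]
        then obtain e m n where e: "e \<in> {a, - a}" and w: "w = (e + of_int m * \<tau>) + of_int n * (2 * pi * \<i>)" by blast
        have "f w = 0"
          unfolding w
          using shift_invariant_int[of "\<lambda>w. f w = 0" "2 * pi * \<i>" "e + of_int m * \<tau>" n]
            shift_invariant_int[of "\<lambda>w. f w = 0" \<tau> e m] f1 f2 fa[OF e] by simp
        then show "f w = 0 \<and> deriv (\<lambda>w. \<Phi> w a) w \<noteq> 0" using s by blast
      qed simp
      then obtain c where c: "\<And>w. f w = c * \<Phi> w a" by blast
      \<comment> \<open>The constant c is read off at w = 0, where the second term of f
        vanishes.\<close>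
      have "\<Phi> 0 0 = 0" using s0 by (simp add: \<Phi>_def)
      then have "k * \<Phi> 0 y = c * \<Phi> 0 a" using c[of 0] by (simp add: f_def)
      then have "c = \<Phi> y 0"
        using k skew[of 0 a] skew[of 0 y] by (simp add: k_def)
      then show ?thesis using c[of x] by (simp add: f_def algebra_simps)
    qed
    then show ?thesis using k
      by (intro exI[of _ k] exI[of _ "\<lambda>x. \<Phi> x a"] exI[of _ "\<lambda>x. \<Phi> x 0"]) simp
  qed
  then obtain k A B where "k \<noteq> 0" "\<And>x y. k * \<Phi> x y = A x * B y - B x * A y" by blast
  then have "\<Phi> x y * \<Phi> u v = \<Phi> x u * \<Phi> y v - \<Phi> x v * \<Phi> y u"
    by (intro rank_two_three_term) auto
  then show ?thesis by (simp only: \<Phi>_def)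
qed

section \<open>The cubic summation\<close>

definition summand where
  "summand r p q n a x k =
      Delta r p (\<lambda>i. x i * q ^ (3 * k i)) / Delta r p x
      * q powi (int (weight r k) - 2 * int (e2 r k))
      * (\<Prod>i=1..r. \<Prod>j\<in>{i<..r}. 1 / ell_fact (q ^ 3) p (x i * x j) (k i + k j))
      * (\<Prod>i=1..r.
          theta p (a * x i * q ^ (weight r k + 3 * k i)) / theta p (a * x i)
          * (ell_fact q p (a * x i) (weight r k) * ell_fact q p (a * q / x i) (weight r k - k i)
             / (ell_facts q p [a * x i * q ^ (3 * n i + 1), a * q powi (1 - 3 * int (n i)) / x i]
                  (weight r k)
                * ell_fact q p (q powi (int (k i) - int (weight r k)) * x i / a) (2 * k i))))
      * (ell_fact q p (1 / a ^ 2) (weight r k) * ell_fact q p (a ^ 2 * q) (2 * weight r k)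
         / (\<Prod>i=1..r. ell_fact (q ^ 3) p (a ^ 3 * x i * q ^ 3) (k i)))
      * (\<Prod>i=1..r. \<Prod>j=1..r.
          ell_facts (q ^ 3) p [q powi (- 3 * int (n j)) * x i / x j, x i * x j * q ^ (3 * n j)] (k i)
          / ell_fact (q ^ 3) p (q ^ 3 * x i / x j) (k i))"

definition sum_value where
  "sum_value r p q n a x = (\<Prod>i=1..r.
        ell_fact q p (a * x i * q) (3 * n i) * ell_fact (q ^ 3) p (x i / a ^ 3) (n i)
        / (ell_fact q p (x i / a) (3 * n i) * ell_fact (q ^ 3) p (a ^ 3 * x i * q ^ 3) (n i)))"

locale cubic_nome =
  fixes p \<eta> :: complex
  assumes p: "norm p < 1"
    and nonper: "\<And>t :: int. t \<noteq> 0 \<Longrightarrow> theta_add p (of_int t * \<eta>) \<noteq> 0"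
begin

sublocale cubic_theta "theta_add p" \<eta>
proof
  show "theta_add p (- u) = - theta_add p u" for u by (rule theta_add_odd[OF p])
  show "theta_add p (x + y) * theta_add p (x - y) * (theta_add p (u + v) * theta_add p (u - v))
    = theta_add p (x + u) * theta_add p (x - u) * (theta_add p (y + v) * theta_add p (y - v))
      - theta_add p (x + v) * theta_add p (x - v) * (theta_add p (y + u) * theta_add p (y - u))" for x y u v
    by (rule theta_add_three_term[OF p])
  show "theta_add p (of_int t * (3 * \<eta>)) \<noteq> 0" if "t \<noteq> 0" for t
    using nonper[of "3 * t"] that by (simp add: mult_ac)
qed

lemma theta_exp: "theta p (exp w) = exp (w / 2) * theta_add p w"
  unfolding theta_add_def mult.assoc[symmetric] exp_add[symmetric] by simp

text \<open>Half the sum of u + t h over t < k: the exponent by which a theta factorial differs from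
  \<open>poch\<close>.\<close>

definition gauge :: "nat \<Rightarrow> complex \<Rightarrow> complex \<Rightarrow> complex" where
  "gauge k u h = (of_nat k * u + of_nat k * (of_nat k - 1) / 2 * h) / 2"

lemma ell_fact_exp: "ell_fact (exp h) p (exp u) k = exp (gauge k u h) * poch h u k"
proof (induction k)
  case 0
  then show ?case by (simp add: ell_fact_def gauge_def)
next
  case (Suc k)
  have "exp u * exp h ^ k = exp (u + of_nat k * h)"
    by (simp add: exp_add exp_of_nat_mult)
  then have "ell_fact (exp h) p (exp u) (Suc k)
      = ell_fact (exp h) p (exp u) k * (exp ((u + of_nat k * h) / 2) * theta_add p (u + of_nat k * h))"
    by (simp add: ell_fact_def theta_exp mult.commute)
  also have "\<dots> = (exp (gauge k u h) * exp ((u + of_nat k * h) / 2)) * poch h u (Suc k)"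
    unfolding Suc.IH poch_Suc by (simp add: mult_ac)
  also have "exp (gauge k u h) * exp ((u + of_nat k * h) / 2) = exp (gauge (Suc k) u h)"
    unfolding exp_add[symmetric] by (rule arg_cong[of _ _ exp]) (simp add: gauge_def field_simps)
  finally show ?case .
qed

lemma Delta_exp:
  "Delta r p (\<lambda>i. exp (u i)) = (\<Prod>i=1..r. \<Prod>j\<in>{i<..r}. exp ((u i + u j) / 2) * theta_add p (u i - u j))"
  unfolding Delta_def
proof (intro prod.cong refl)
  fix i j
  have "exp (u j) * exp ((u i - u j) / 2) = exp ((u i + u j) / 2)"
    unfolding exp_add[symmetric] by (rule arg_cong[of _ _ exp]) (simp add: field_simps)
  then show "exp (u j) * theta p (exp (u i) / exp (u j)) = exp ((u i + u j) / 2) * theta_add p (u i - u j)"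
    unfolding exp_diff[symmetric] theta_exp by (simp add: mult.assoc[symmetric])
qed

lemma exp_eqI: "u = v \<Longrightarrow> exp u = exp (v :: complex)"
  by simp

text \<open>Every theta value contributes half its argument to the exponent \<open>T\<close>. There
  \<xi>, \<alpha> and n cancel, and the rest, including the explicit power of q, is a multiple of
  |k|^2 - (sum of k_i^2) - 2 e_2(k), which is 0.\<close>

lemma summand_exp:
  fixes \<xi> :: "nat \<Rightarrow> complex"
  shows "summand r p (exp \<eta>) n (exp \<alpha>) (\<lambda>i. exp (\<xi> i)) k = cubic_term r \<xi> \<alpha> n k"
proof -
  let ?P = "\<lambda>s :: nat \<Rightarrow> nat \<Rightarrow> complex. \<Sum>i=1..r. \<Sum>j\<in>{i<..r}. s i j"
  define M where "M = weight r k"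
  have kM: "k i \<le> M" if "i \<in> {1..r}" for i
    unfolding M_def weight_def using that by (intro member_le_sum) auto
  have e3: "exp \<eta> ^ 3 = exp K" by (simp add: exp_of_nat_mult[symmetric])
  define s1 where "s1 i j = (of_nat (k i) + of_nat (k j)) * K / 2" for i j
  have P1: "Delta r p (\<lambda>i. exp (\<xi> i) * exp \<eta> ^ (3 * k i)) / Delta r p (\<lambda>i. exp (\<xi> i))
    = exp (?P s1)
      * (\<Prod>i=1..r. \<Prod>j\<in>{i<..r}. theta_add p (pt \<xi> i (k i) - pt \<xi> j (k j)) / theta_add p (\<xi> i - \<xi> j))"
  proof -
    have "exp (\<xi> i) * exp \<eta> ^ (3 * k i) = exp (pt \<xi> i (k i))" for i
      unfolding pt_def exp_of_nat_mult[symmetric] exp_add[symmetric] by (rule exp_eqI) simp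
    moreover have "exp ((pt \<xi> i (k i) + pt \<xi> j (k j)) / 2) = exp (s1 i j) * exp ((\<xi> i + \<xi> j) / 2)" for i j
      unfolding exp_add[symmetric] s1_def pt_def by (rule exp_eqI) (simp add: field_simps)
    ultimately show ?thesis
      unfolding Delta_exp exp_sum[OF finite_atLeastAtMost] exp_sum[OF finite_greaterThanAtMost]
        prod_dividef[symmetric] prod.distrib[symmetric] by (simp add: Delta_exp prod_dividef prod.distrib)
  qed
  define s2 where "s2 i j = - gauge (k i + k j) (\<xi> i + \<xi> j) K" for i j
  have s2: "exp (s2 i j) = 1 / exp (gauge (k i + k j) (\<xi> i + \<xi> j) K)" for i j
    unfolding s2_def exp_minus inverse_eq_divide ..
  have P2: "(\<Prod>i=1..r. \<Prod>j\<in>{i<..r}. 1 / ell_fact (exp \<eta> ^ 3) p (exp (\<xi> i) * exp (\<xi> j)) (k i + k j))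
    = exp (?P s2) * (\<Prod>i=1..r. \<Prod>j\<in>{i<..r}. 1 / poch K (\<xi> i + \<xi> j) (k i + k j))"
    unfolding e3 exp_add[symmetric] ell_fact_exp exp_sum[OF finite_atLeastAtMost] exp_sum[OF finite_greaterThanAtMost]
      prod.distrib[symmetric] s2 by simp
  define u0 where "u0 i = \<alpha> + \<xi> i + of_nat (M + 3 * k i) * \<eta>" for i
  define u4 where "u4 i = \<alpha> + \<xi> i + of_nat (3 * n i + 1) * \<eta>" for i
  define u5 where "u5 i = \<alpha> - \<xi> i + of_int (1 - 3 * int (n i)) * \<eta>" for i
  define u6 where "u6 i = \<xi> i - \<alpha> + of_int (int (k i) - int M) * \<eta>" for i
  define s3 where "s3 i = u0 i / 2 - (\<alpha> + \<xi> i) / 2 + gauge M (\<alpha> + \<xi> i) \<eta> + gauge (M - k i) (\<alpha> - \<xi> i + \<eta>) \<eta>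
      - gauge M (u4 i) \<eta> - gauge M (u5 i) \<eta> - gauge (2 * k i) (u6 i) \<eta>" for i
  have P3: "theta p (exp \<alpha> * exp (\<xi> i) * exp \<eta> ^ (M + 3 * k i)) / theta p (exp \<alpha> * exp (\<xi> i))
          * (ell_fact (exp \<eta>) p (exp \<alpha> * exp (\<xi> i)) M * ell_fact (exp \<eta>) p (exp \<alpha> * exp \<eta> / exp (\<xi> i)) (M - k i)
             / (ell_facts (exp \<eta>) p [exp \<alpha> * exp (\<xi> i) * exp \<eta> ^ (3 * n i + 1), exp \<alpha> * exp \<eta> powi (1 - 3 * int (n i)) / exp (\<xi> i)] M
                * ell_fact (exp \<eta>) p (exp \<eta> powi (int (k i) - int M) * exp (\<xi> i) / exp \<alpha>) (2 * k i)))
      = exp (s3 i) * (theta_add p (u0 i) / theta_add p (\<alpha> + \<xi> i)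
         * (poch \<eta> (\<alpha> + \<xi> i) M * poch \<eta> (\<alpha> - \<xi> i + \<eta>) (M - k i)
            / (poch \<eta> (u4 i) M * poch \<eta> (u5 i) M * poch \<eta> (u6 i) (2 * k i))))" for i
  proof -
    have 0: "exp \<alpha> * exp (\<xi> i) = exp (\<alpha> + \<xi> i)" by (simp add: exp_add)
    have 1: "exp (\<alpha> + \<xi> i) * exp \<eta> ^ (M + 3 * k i) = exp (u0 i)" "exp (\<alpha> + \<xi> i) * exp \<eta> ^ (3 * n i + 1) = exp (u4 i)"
      unfolding u0_def u4_def by (simp_all only: exp_add exp_of_nat_mult)
    have 2: "exp \<alpha> * exp \<eta> / exp (\<xi> i) = exp (\<alpha> - \<xi> i + \<eta>)"
      by (simp add: exp_add exp_diff)
    have 3: "exp \<alpha> * exp \<eta> powi (1 - 3 * int (n i)) / exp (\<xi> i) = exp (u5 i)"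
      "exp \<eta> powi (int (k i) - int M) * exp (\<xi> i) / exp \<alpha> = exp (u6 i)"
      unfolding u5_def u6_def by (simp_all only: exp_add exp_diff exp_power_int) simp_all
    show ?thesis
      unfolding ell_facts_def list.map prod_list.Cons prod_list.Nil 0 1 2 3 ell_fact_exp theta_exp
      unfolding s3_def exp_add[of "_ - _"] exp_add[of "_ + _"] exp_diff[of "_ - _"] exp_diff[of "_ + _"] exp_diff[of "_ / _"]
      by (simp add: mult_ac)
  qed
  define s4 where "s4 = gauge M (- 2 * \<alpha>) \<eta> + gauge (2 * M) (2 * \<alpha> + \<eta>) \<eta>
      - (\<Sum>i=1..r. gauge (k i) (3 * \<alpha> + \<xi> i + 3 * \<eta>) K)"
  have P4: "ell_fact (exp \<eta>) p (1 / exp \<alpha> ^ 2) M * ell_fact (exp \<eta>) p (exp \<alpha> ^ 2 * exp \<eta>) (2 * M)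
         / (\<Prod>i=1..r. ell_fact (exp \<eta> ^ 3) p (exp \<alpha> ^ 3 * exp (\<xi> i) * exp \<eta> ^ 3) (k i))
     = exp s4 * (base_factor \<alpha> M
         / (\<Prod>i=1..r. poch K (3 * \<alpha> + \<xi> i + 3 * \<eta>) (k i)))"
  proof -
    have 0: "exp \<alpha> ^ 3 * exp (\<xi> i) * exp K = exp (3 * \<alpha> + \<xi> i + 3 * \<eta>)" for i
      by (simp add: exp_add exp_of_nat_mult[symmetric])
    have 1: "1 / exp \<alpha> ^ 2 = exp (- 2 * \<alpha>)"
      by (simp add: exp_minus inverse_eq_divide exp_of_nat_mult[symmetric])
    have 2: "exp \<alpha> ^ 2 * exp \<eta> = exp (2 * \<alpha> + \<eta>)"
      by (simp add: exp_add exp_of_nat_mult[symmetric])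
    show ?thesis
      unfolding e3 0 1 2 ell_fact_exp prod.distrib
      unfolding s4_def exp_diff[of "_ + _"] exp_add[of "gauge _ _ _"]
        exp_sum[OF finite_atLeastAtMost] by (simp add: mult_ac)
  qed
  define s5 where "s5 i j = gauge (k i) (\<xi> i - \<xi> j - of_nat (n j) * K) K
     + gauge (k i) (\<xi> i + \<xi> j + of_nat (n j) * K) K - gauge (k i) (\<xi> i - \<xi> j + 3 * \<eta>) K" for i j
  have P5: "ell_facts (exp \<eta> ^ 3) p [exp \<eta> powi (- 3 * int (n j)) * exp (\<xi> i) / exp (\<xi> j), exp (\<xi> i) * exp (\<xi> j) * exp \<eta> ^ (3 * n j)] (k i)
          / ell_fact (exp \<eta> ^ 3) p (exp \<eta> ^ 3 * exp (\<xi> i) / exp (\<xi> j)) (k i)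
      = exp (s5 i j) * (poch K (\<xi> i - \<xi> j - of_nat (n j) * K) (k i)
          * poch K (\<xi> i + \<xi> j + of_nat (n j) * K) (k i)
          / poch K (\<xi> i - \<xi> j + 3 * \<eta>) (k i))" for i j
  proof -
    have 0: "exp \<eta> powi (- 3 * int (n j)) * exp (\<xi> i) / exp (\<xi> j) = exp (\<xi> i - \<xi> j - of_nat (n j) * K)"
      unfolding exp_power_int exp_add[symmetric] exp_diff[symmetric] by (rule exp_eqI) simp
    have 1: "exp (\<xi> i) * exp (\<xi> j) * exp \<eta> ^ (3 * n j) = exp (\<xi> i + \<xi> j + of_nat (n j) * K)"
      unfolding exp_of_nat_mult[symmetric] exp_add[symmetric] by (rule exp_eqI) simp
    have 2: "exp K * exp (\<xi> i) / exp (\<xi> j) = exp (\<xi> i - \<xi> j + 3 * \<eta>)"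
      unfolding exp_add[symmetric] exp_diff[symmetric] by (rule exp_eqI) simp
    show ?thesis
      unfolding e3 ell_facts_def list.map prod_list.Cons prod_list.Nil 0 1 2 ell_fact_exp
      unfolding s5_def exp_diff[of "_ + _"] exp_add[of "gauge _ _ _"] by (simp add: mult_ac)
  qed
  define s6 where "s6 = of_int (int M - 2 * int (e2 r k)) * \<eta>"
  have P6: "exp \<eta> powi (int M - 2 * int (e2 r k)) = exp s6"
    unfolding s6_def exp_power_int ..
  define T where "T = (?P s1) + s6 + (?P s2)
     + (\<Sum>i=1..r. s3 i) + s4 + (\<Sum>i=1..r. \<Sum>j=1..r. s5 i j)"
  have "summand r p (exp \<eta>) n (exp \<alpha>) (\<lambda>i. exp (\<xi> i)) k = exp T * cubic_term r \<xi> \<alpha> n k"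
    unfolding summand_def cubic_term_def M_def[symmetric] P1 P2 P3[unfolded u0_def u4_def u5_def u6_def] P4 P5 P6 T_def exp_add prod.distrib
      exp_sum[OF finite_atLeastAtMost] by (simp only: mult_ac)
  also have "T = 0"
  proof -
    define S2 where "S2 = (\<Sum>i=1..r. of_nat (k i) * of_nat (k i) :: complex)"
    define e where "e = (\<Sum>i=1..r. \<Sum>j\<in>{i<..r}. of_nat (k i) * of_nat (k j) :: complex)"
    have M: "of_nat M = (\<Sum>i=1..r. of_nat (k i) :: complex)" by (simp add: M_def weight_def)
    have e2: "of_nat (e2 r k) = e" by (simp add: e2_def e_def)
    have "of_nat M * of_nat M = (\<Sum>i=1..r. \<Sum>j=1..r. of_nat (k i) * of_nat (k j) :: complex)"
      unfolding M by (rule sum_product)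
    also have "\<dots> = S2 + (\<Sum>i=1..r. \<Sum>j\<in>{i<..r}. of_nat (k i) * of_nat (k j) + of_nat (k j) * of_nat (k i))"
      unfolding S2_def by (rule sum.square_pairs)
    also have "(\<Sum>i=1..r. \<Sum>j\<in>{i<..r}. of_nat (k i) * of_nat (k j) + of_nat (k j) * of_nat (k i)) = 2 * e"
      unfolding e_def sum_distrib_left by (intro sum.cong refl) simp
    finally have sq: "of_nat M * of_nat M = S2 + 2 * e" .
    \<comment> \<open>Within a pair i < j both orders of \<open>s5\<close> are needed for \<xi> and
      n to cancel; the diagonal of \<open>s5\<close> is combined with the single-index exponents
      instead.\<close>
    have pair: "s1 i j + s2 i j + (s5 i j + s5 j i) = - (3 / 2) * \<eta> * (of_nat (k i) * of_nat (k j))" for i j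
      unfolding s1_def s2_def s5_def gauge_def of_nat_add by (simp add: field_simps)
    have diag: "2 * s3 i + 2 * s5 i i - 2 * gauge (k i) (3 * \<alpha> + \<xi> i + 3 * \<eta>) K
       = (of_nat M * \<eta> - 2 * \<alpha> - (5 / 2) * \<eta>) * of_nat (k i) - (7 / 2) * \<eta> * (of_nat (k i) * of_nat (k i))" if i: "i \<in> {1..r}" for i
      unfolding s3_def u0_def u4_def u5_def u6_def s5_def gauge_def of_nat_diff[OF kM[OF i]] by (simp add: field_simps)
    have "(\<Sum>i=1..r. 2 * s3 i + 2 * s5 i i - 2 * gauge (k i) (3 * \<alpha> + \<xi> i + 3 * \<eta>) K)
       = (\<Sum>i=1..r. (of_nat M * \<eta> - 2 * \<alpha> - (5 / 2) * \<eta>) * of_nat (k i) - (7 / 2) * \<eta> * (of_nat (k i) * of_nat (k i)))"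
      by (intro sum.cong refl diag)
    also have "\<dots> = (of_nat M * \<eta> - 2 * \<alpha> - (5 / 2) * \<eta>) * of_nat M - (7 / 2) * \<eta> * S2"
      unfolding sum_subtractf sum_distrib_left[symmetric] M[symmetric] S2_def ..
    finally have D: "2 * (\<Sum>i=1..r. s3 i) + 2 * (\<Sum>i=1..r. s5 i i)
        - (\<Sum>i=1..r. 2 * gauge (k i) (3 * \<alpha> + \<xi> i + 3 * \<eta>) K)
      = (of_nat M * \<eta> - 2 * \<alpha> - (5 / 2) * \<eta>) * of_nat M - (7 / 2) * \<eta> * S2"
      by (simp add: sum_subtractf sum.distrib sum_distrib_left)
    have "(\<Sum>i=1..r. \<Sum>j\<in>{i<..r}. s1 i j + s2 i j + (s5 i j + s5 j i)) = - (3 / 2) * \<eta> * e"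
      unfolding pair sum_distrib_left[symmetric] e_def ..
    then have Q: "(?P s1) + (?P s2)
        + (\<Sum>i=1..r. \<Sum>j\<in>{i<..r}. s5 i j + s5 j i) = - (3 / 2) * \<eta> * e"
      by (simp only: sum.distrib)
    define A where "A = (\<Sum>i=1..r. 2 * gauge (k i) (3 * \<alpha> + \<xi> i + 3 * \<eta>) K)"
    have s4: "2 * s4 = 2 * \<alpha> * of_nat M + (5 / 2) * \<eta> * (of_nat M * of_nat M) + (1 / 2) * \<eta> * of_nat M - A"
      unfolding s4_def A_def sum_distrib_left[symmetric] by (simp add: gauge_def field_simps)
    have s6: "s6 = (of_nat M - 2 * e) * \<eta>" unfolding s6_def e2[symmetric] by simp
    have "2 * T = 2 * ((?P s1) + (?P s2)
        + (\<Sum>i=1..r. \<Sum>j\<in>{i<..r}. s5 i j + s5 j i)) + 2 * s6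
      + (2 * (\<Sum>i=1..r. s3 i) + 2 * (\<Sum>i=1..r. s5 i i) - A) + (2 * s4 + A)"
      unfolding T_def sum.square_pairs[of s5] by (simp add: algebra_simps)
    also have "\<dots> = (7 / 2) * \<eta> * (of_nat M * of_nat M - S2 - 2 * e)"
      unfolding Q D[folded A_def] s4 s6 by (simp add: field_simps)
    also have "\<dots> = 0" unfolding sq by simp
    finally show "T = 0" by simp
  qed
  finally show ?thesis by simp
qed

lemma sum_value_exp:
  "sum_value r p (exp \<eta>) n (exp \<alpha>) (\<lambda>i. exp (\<xi> i)) = (\<Prod>i=1..r. cubic_column (\<xi> i) \<alpha> (n i))"
  unfolding sum_value_def
proof (intro prod.cong refl)
  fix i
  have e3: "exp \<eta> ^ 3 = exp K" by (simp add: exp_of_nat_mult[symmetric])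
  have 0: "exp \<alpha> ^ 3 * exp (\<xi> i) * exp K = exp (3 * \<alpha> + \<xi> i + 3 * \<eta>)"
    by (simp add: exp_add exp_of_nat_mult[symmetric])
  have 1: "exp \<alpha> * exp (\<xi> i) * exp \<eta> = exp (\<alpha> + \<xi> i + \<eta>)" by (simp add: exp_add)
  have 2: "exp (\<xi> i) / exp \<alpha> ^ 3 = exp (\<xi> i - 3 * \<alpha>)"
    by (simp add: exp_diff exp_of_nat_mult[symmetric])
  have 3: "exp (\<xi> i) / exp \<alpha> = exp (\<xi> i - \<alpha>)" by (simp add: exp_diff)
  define a1 where "a1 = exp (gauge (3 * n i) (\<alpha> + \<xi> i + \<eta>) \<eta>)"
  define a2 where "a2 = exp (gauge (n i) (\<xi> i - 3 * \<alpha>) K)"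
  define a3 where "a3 = exp (gauge (3 * n i) (\<xi> i - \<alpha>) \<eta>)"
  define a4 where "a4 = exp (gauge (n i) (3 * \<alpha> + \<xi> i + 3 * \<eta>) K)"
  have a: "a1 * a2 = a3 * a4"
    unfolding a1_def a2_def a3_def a4_def exp_add[symmetric] by (rule exp_eqI) (simp add: gauge_def field_simps)
  have "a3 * a4 \<noteq> 0" by (simp add: a3_def a4_def)
  then have "(a1 * P1) * (a2 * P2) / ((a3 * P3) * (a4 * P4)) = P1 * P2 / (P3 * P4)" for P1 P2 P3 P4
  proof -
    have "(a1 * P1) * (a2 * P2) / ((a3 * P3) * (a4 * P4)) = (a1 * a2) * (P1 * P2) / ((a3 * a4) * (P3 * P4))"
      by (simp only: mult_ac)
    then show ?thesis unfolding a using \<open>a3 * a4 \<noteq> 0\<close> by simp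
  qed
  then show "ell_fact (exp \<eta>) p (exp \<alpha> * exp (\<xi> i) * exp \<eta>) (3 * n i) * ell_fact (exp \<eta> ^ 3) p (exp (\<xi> i) / exp \<alpha> ^ 3) (n i)
        / (ell_fact (exp \<eta>) p (exp (\<xi> i) / exp \<alpha>) (3 * n i) * ell_fact (exp \<eta> ^ 3) p (exp \<alpha> ^ 3 * exp (\<xi> i) * exp \<eta> ^ 3) (n i))
     = cubic_column (\<xi> i) \<alpha> (n i)"
    unfolding e3 0 1 2 3 ell_fact_exp a1_def[symmetric] a2_def[symmetric] a3_def[symmetric] a4_def[symmetric] cubic_column_def .
qed

lemma cubic_sum_exp:
  assumes "gen_params r \<xi> \<alpha>"
  shows "(\<Sum>k\<in>index_box r n. summand r p (exp \<eta>) n (exp \<alpha>) (\<lambda>i. exp (\<xi> i)) k)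
    = sum_value r p (exp \<eta>) n (exp \<alpha>) (\<lambda>i. exp (\<xi> i))"
proof -
  \<comment> \<open>\<open>cubic_sum_generic\<close> asks for an extensional tuple; restricting n
    changes neither side.\<close>
  define m where "m = restrict n {1..r}"
  have "index_box r n = box r m"
    unfolding index_box_def m_def by (intro PiE_cong) simp
  moreover have "cubic_term r \<xi> \<alpha> n k = cubic_term r \<xi> \<alpha> m k" for k
    unfolding cubic_term_def
    by (intro arg_cong2[where f = "(*)"] prod.cong refl) (simp_all add: m_def)
  moreover have "(\<Prod>i=1..r. cubic_column (\<xi> i) \<alpha> (n i)) = (\<Prod>i=1..r. cubic_column (\<xi> i) \<alpha> (m i))"
    by (intro prod.cong refl) (simp add: m_def)
  ultimately show ?thesis
    unfolding summand_exp sum_value_exp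
    using cubic_sum_generic[OF assms, of m] by (simp add: m_def)
qed

end

section \<open>Removal of the additional genericity by continuity\<close>

lemma isCont_ell_fact:
  assumes "norm p < 1" "q \<noteq> 0" "isCont f z" "f z \<noteq> 0"
  shows "isCont (\<lambda>w. ell_fact q p (f w) k) z"
  unfolding ell_fact_def
  using assms by (intro continuous_prod isCont_theta isCont_mult continuous_const) auto

lemma isCont_Delta:
  assumes "norm p < 1" "\<And>i. i \<in> {1..r} \<Longrightarrow> isCont (\<lambda>w. X w i) z" "\<And>i. i \<in> {1..r} \<Longrightarrow> X z i \<noteq> 0"
  shows "isCont (\<lambda>w. Delta r p (X w)) z"
  unfolding Delta_def
  using assms by (intro continuous_prod isCont_mult isCont_theta isCont_divide) auto

text \<open>The denominators of the term are among the quantities that \<open>generic\<close> keeps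
  nonzero. This yields continuity at the given parameters, whereas the inversion argument rests on
  \<open>gen_params\<close>.\<close>

lemma isCont_summand:
  assumes p: "norm p < 1" and q: "q \<noteq> 0" and A: "isCont A z" "A z \<noteq> 0"
    and X: "\<And>i. i \<in> {1..r} \<Longrightarrow> isCont (\<lambda>w. X w i) z" "\<And>i. i \<in> {1..r} \<Longrightarrow> X z i \<noteq> 0"
    and gnr: "generic r p q n (A z) (X z)" and k: "k \<in> index_box r n"
  shows "isCont (\<lambda>w. summand r p q n (A w) (X w) k) z"
proof -
  have q3: "q ^ 3 \<noteq> 0" using q by simp
  have n1: "Delta r p (X z) \<noteq> 0" using gnr unfolding generic_def by blast
  have n2: "theta p (A z * X z i) \<noteq> 0" if "i \<in> {1..r}" for i
    using gnr that unfolding generic_def by blast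
  have n3: "ell_fact (q ^ 3) p (X z i * X z j) (k i + k j) \<noteq> 0" if "i \<in> {1..r}" "j \<in> {i<..r}" for i j
    using gnr that k unfolding generic_def by blast
  have n4: "ell_facts q p [A z * X z i * q ^ (3 * n i + 1), A z * q powi (1 - 3 * int (n i)) / X z i] (weight r k) \<noteq> 0"
    "ell_fact q p (q powi (int (k i) - int (weight r k)) * X z i / A z) (2 * k i) \<noteq> 0"
    "ell_fact (q ^ 3) p (A z ^ 3 * X z i * q ^ 3) (k i) \<noteq> 0" if "i \<in> {1..r}" for i
    using gnr that k unfolding generic_def by blast+
  have n5: "ell_fact (q ^ 3) p (q ^ 3 * X z i / X z j) (k i) \<noteq> 0" if "i \<in> {1..r}" "j \<in> {1..r}" for i j
    using gnr that k unfolding generic_def by blast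
  have n4': "ell_fact q p (A z * X z i * q ^ (3 * n i + 1)) (weight r k) \<noteq> 0"
    "ell_fact q p (A z * q powi (1 - 3 * int (n i)) / X z i) (weight r k) \<noteq> 0" if "i \<in> {1..r}" for i
    using n4(1)[OF that] by (simp_all add: ell_facts_def)
  note nonzero = n1 n2 n3 n4(2,3) n4' n5
  show ?thesis
    unfolding summand_def ell_facts_def list.map prod_list.Cons prod_list.Nil mult_1_right
    by (intro isCont_mult isCont_divide continuous_prod continuous_const isCont_Delta[OF p] isCont_theta[OF p]
        isCont_ell_fact[OF p q] isCont_ell_fact[OF p q3] isCont_power A(1) X(1))
      (use A(2) X(2) q in \<open>auto simp: nonzero simp del: One_nat_def\<close>)
qed

lemma isCont_sum_value:
  assumes p: "norm p < 1" and q: "q \<noteq> 0" and A: "isCont A z" "A z \<noteq> 0"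
    and X: "\<And>i. i \<in> {1..r} \<Longrightarrow> isCont (\<lambda>w. X w i) z" "\<And>i. i \<in> {1..r} \<Longrightarrow> X z i \<noteq> 0"
    and gnr: "generic r p q n (A z) (X z)"
  shows "isCont (\<lambda>w. sum_value r p q n (A w) (X w)) z"
  unfolding sum_value_def
proof (intro continuous_prod)
  fix i assume i: "i \<in> {1..r}"
  have q3: "q ^ 3 \<noteq> 0" using q by simp
  have n: "ell_fact q p (X z i / A z) (3 * n i) \<noteq> 0" "ell_fact (q ^ 3) p (A z ^ 3 * X z i * q ^ 3) (n i) \<noteq> 0"
    using gnr i unfolding generic_def by blast+
  show "isCont (\<lambda>w. ell_fact q p (A w * X w i * q) (3 * n i) * ell_fact (q ^ 3) p (X w i / A w ^ 3) (n i)
        / (ell_fact q p (X w i / A w) (3 * n i) * ell_fact (q ^ 3) p (A w ^ 3 * X w i * q ^ 3) (n i))) z"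
    using A X[OF i] q q3 n
    by (intro isCont_divide isCont_mult isCont_ell_fact[OF p q] isCont_ell_fact[OF p q3] isCont_power continuous_const) auto
qed

context cubic_nome
begin

text \<open>If f \<tau> is not regular, some translate of it by a multiple of \<eta> is a zero of a
  nonconstant entire function. There are countably many zeros and translates, and f is injective as
  D is nonzero.\<close>

lemma countable_singular:
  fixes D :: int
  assumes f: "\<And>\<tau>. f \<tau> = u + of_int D * \<tau>" and D: "D \<noteq> 0"
  shows "countable {\<tau>. \<not> qregular (f \<tau>)}"
proof -
  define Z where "Z = {w. theta_add p w = 0}"
  have "\<not> theta_add p constant_on UNIV"
  proof
    assume "theta_add p constant_on UNIV"
    then have "theta_add p (of_int 1 * \<eta>) = theta_add p 0" unfolding constant_on_def by (metis UNIV_I)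
    then show False using nonper[of 1] by simp
  qed
  then have "countable {w \<in> UNIV. theta_add p w = 0}"
    by (intro holomorphic_countable_zeros theta_add_holomorphic[OF p]) (auto intro: fsigma_UNIV)
  then have Z: "countable Z" by (simp add: Z_def)
  have "{\<tau>. \<not> qregular (f \<tau>)} \<subseteq> (\<Union>t :: int. (\<lambda>w. (w - u - of_int t * \<eta>) / of_int D) ` Z)"
  proof
    fix \<tau> assume "\<tau> \<in> {\<tau>. \<not> qregular (f \<tau>)}"
    then obtain t :: int where t: "theta_add p (f \<tau> + of_int t * \<eta>) = 0" by (auto simp: qregular_def)
    have "\<tau> = (f \<tau> + of_int t * \<eta> - u - of_int t * \<eta>) / of_int D"
      using D by (simp add: f)
    then show "\<tau> \<in> (\<Union>t :: int. (\<lambda>w. (w - u - of_int t * \<eta>) / of_int D) ` Z)"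
      using t unfolding Z_def by blast
  qed
  moreover have "countable (\<Union>t :: int. (\<lambda>w. (w - u - of_int t * \<eta>) / of_int D) ` Z)"
    using Z by (intro countable_UN countable_image) auto
  ultimately show ?thesis by (rule countable_subset)
qed

text \<open>The slope \<open>4 * i\<close> makes every linear form occurring in \<open>gen_params\<close> nonconstant in \<open>\<tau>\<close>.\<close>

lemma countable_not_gen_params:
  "countable {\<tau>. \<not> gen_params r (\<lambda>i. \<xi> i + of_nat (4 * i) * \<tau>) (\<alpha> + \<tau>)}"
proof -
  let ?x = "\<lambda>\<tau> i. \<xi> i + of_nat (4 * i) * \<tau>" and ?a = "\<lambda>\<tau>. \<alpha> + \<tau>"
  let ?B = "\<lambda>f. {\<tau>. \<not> qregular (f \<tau>)}"
  define C1 where "C1 = ?B (\<lambda>\<tau>. 2 * ?a \<tau>) \<union> ?B (\<lambda>\<tau>. 4 * ?a \<tau>)"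
  define C2 where "C2 i = ?B (\<lambda>\<tau>. 2 * ?x \<tau> i) \<union> ?B (\<lambda>\<tau>. ?a \<tau> + ?x \<tau> i) \<union> ?B (\<lambda>\<tau>. ?x \<tau> i - ?a \<tau>)
     \<union> ?B (\<lambda>\<tau>. 3 * ?a \<tau> + ?x \<tau> i) \<union> ?B (\<lambda>\<tau>. ?x \<tau> i - 3 * ?a \<tau>)" for i
  define C3 where "C3 i j = ?B (\<lambda>\<tau>. ?x \<tau> i + ?x \<tau> j) \<union> ?B (\<lambda>\<tau>. ?x \<tau> i - ?x \<tau> j) \<union> ?B (\<lambda>\<tau>. ?x \<tau> i + ?x \<tau> j - 2 * ?a \<tau>)" for i j
  have "countable C1"
    unfolding C1_def
    by (intro countable_Un countable_singular[where D = 2 and u = "2 * \<alpha>"] countable_singular[where D = 4 and u = "4 * \<alpha>"])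
      (simp_all add: algebra_simps)
  moreover have "countable (C2 i)" if "i \<in> {1..r}" for i
  proof -
    have "countable (?B (\<lambda>\<tau>. 2 * ?x \<tau> i))"
      by (rule countable_singular[where D = "8 * int i" and u = "2 * \<xi> i"]) (use that in \<open>auto simp: algebra_simps\<close>)
    moreover have "countable (?B (\<lambda>\<tau>. ?a \<tau> + ?x \<tau> i))"
      by (rule countable_singular[where D = "4 * int i + 1" and u = "\<alpha> + \<xi> i"]) (auto simp: algebra_simps)
    moreover have "countable (?B (\<lambda>\<tau>. ?x \<tau> i - ?a \<tau>))"
      by (rule countable_singular[where D = "4 * int i - 1" and u = "\<xi> i - \<alpha>"]) (simp add: algebra_simps, presburger)
    moreover have "countable (?B (\<lambda>\<tau>. 3 * ?a \<tau> + ?x \<tau> i))"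
      by (rule countable_singular[where D = "4 * int i + 3" and u = "3 * \<alpha> + \<xi> i"]) (auto simp: algebra_simps)
    moreover have "countable (?B (\<lambda>\<tau>. ?x \<tau> i - 3 * ?a \<tau>))"
      by (rule countable_singular[where D = "4 * int i - 3" and u = "\<xi> i - 3 * \<alpha>"]) (simp add: algebra_simps, presburger)
    ultimately show ?thesis unfolding C2_def by (intro countable_Un)
  qed
  moreover have "countable (C3 i j)" if "i \<in> {1..r}" "j \<in> {1..r} - {i}" for i j
  proof -
    have "countable (?B (\<lambda>\<tau>. ?x \<tau> i + ?x \<tau> j))"
      by (rule countable_singular[where D = "4 * int i + 4 * int j" and u = "\<xi> i + \<xi> j"]) (use that in \<open>auto simp: algebra_simps\<close>)
    moreover have "countable (?B (\<lambda>\<tau>. ?x \<tau> i - ?x \<tau> j))"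
      by (rule countable_singular[where D = "4 * int i - 4 * int j" and u = "\<xi> i - \<xi> j"]) (use that in \<open>auto simp: algebra_simps\<close>)
    moreover have "countable (?B (\<lambda>\<tau>. ?x \<tau> i + ?x \<tau> j - 2 * ?a \<tau>))"
      by (rule countable_singular[where D = "4 * int i + 4 * int j - 2" and u = "\<xi> i + \<xi> j - 2 * \<alpha>"]) (simp add: algebra_simps, presburger)
    ultimately show ?thesis unfolding C3_def by (intro countable_Un)
  qed
  ultimately have "countable (C1 \<union> (\<Union>i\<in>{1..r}. C2 i \<union> (\<Union>j\<in>{1..r} - {i}. C3 i j)))"
    by (intro countable_Un countable_UN) auto
  moreover have "{\<tau>. \<not> gen_params r (?x \<tau>) (?a \<tau>)} \<subseteq> C1 \<union> (\<Union>i\<in>{1..r}. C2 i \<union> (\<Union>j\<in>{1..r} - {i}. C3 i j))"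
    unfolding C1_def C2_def C3_def gen_params_def by blast
  ultimately show ?thesis using countable_subset by blast
qed

end

text \<open>Continuous functions that differ at z differ on a ball around it, and a ball is
  uncountable.\<close>

lemma eq_at_of_eq_off_countable:
  fixes f g :: "complex \<Rightarrow> complex"
  assumes "isCont f z" "isCont g z" "countable {w. f w \<noteq> g w}"
  shows "f z = g z"
proof (rule ccontr)
  assume "f z \<noteq> g z"
  moreover have "isCont (\<lambda>w. f w - g w) z" using assms by (intro continuous_diff)
  ultimately obtain e where e: "e > 0" "\<And>w. dist z w < e \<Longrightarrow> f w - g w \<noteq> 0"
    using continuous_at_avoid[of z "\<lambda>w. f w - g w" 0] by auto
  then have "ball z e \<subseteq> {w. f w \<noteq> g w}" by auto
  then have "countable (ball z e)" using assms(3) countable_subset by blast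
  then show False using uncountable_ball[OF e(1)] by blast
qed

lemma Delta_cong: "(\<And>i. i \<in> {1..r} \<Longrightarrow> x i = y i) \<Longrightarrow> Delta r p x = Delta r p y"
  unfolding Delta_def by (intro prod.cong refl) auto

lemma generic_cong:
  assumes "\<And>i. i \<in> {1..r} \<Longrightarrow> x i = y i"
  shows "generic r p q n a x = generic r p q n a y"
proof -
  have "Delta r p x = Delta r p y" by (rule Delta_cong[OF assms])
  then show ?thesis
    unfolding generic_def by (intro conj_cong ball_cong refl) (simp_all add: assms)
qed

lemma summand_cong:
  assumes "\<And>i. i \<in> {1..r} \<Longrightarrow> x i = y i"
  shows "summand r p q n a x k = summand r p q n a y k"
proof -
  have "Delta r p (\<lambda>i. x i * q ^ (3 * k i)) = Delta r p (\<lambda>i. y i * q ^ (3 * k i))" "Delta r p x = Delta r p y"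
    using assms by (intro Delta_cong; simp)+
  then show ?thesis
    unfolding summand_def
    by (intro arg_cong2[where f = "(*)"] arg_cong2[where f = "(/)"] prod.cong refl) (use assms in auto)
qed

lemma sum_value_cong:
  assumes "\<And>i. i \<in> {1..r} \<Longrightarrow> x i = y i"
  shows "sum_value r p q n a x = sum_value r p q n a y"
  unfolding sum_value_def using assms by (intro prod.cong refl) auto

theorem theorem4p10:
  fixes p q a :: complex and r :: nat and n :: "nat \<Rightarrow> nat" and x :: "nat \<Rightarrow> complex"
  assumes "norm p < 1"
    and "q \<noteq> 0"
    and "\<forall>k>0. \<forall>m::int. q ^ k \<noteq> p powi m"
    and "r \<ge> 1"
    and "a \<noteq> 0"
    and "\<forall>i\<in>{1..r}. x i \<noteq> 0"
    and "generic r p q n a x"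
  shows "(\<Sum>k\<in>index_box r n.
      Delta r p (\<lambda>i. x i * q ^ (3 * k i)) / Delta r p x
      * q powi (int (weight r k) - 2 * int (e2 r k))
      * (\<Prod>i\<in>{1..r}. \<Prod>j\<in>{i<..r}. 1 / ell_fact (q ^ 3) p (x i * x j) (k i + k j))
      * (\<Prod>i\<in>{1..r}.
          theta p (a * x i * q ^ (weight r k + 3 * k i)) / theta p (a * x i)
          * (ell_fact q p (a * x i) (weight r k) * ell_fact q p (a * q / x i) (weight r k - k i)
             / (ell_facts q p [a * x i * q ^ (3 * n i + 1), a * q powi (1 - 3 * int (n i)) / x i]
                  (weight r k)
                * ell_fact q p (q powi (int (k i) - int (weight r k)) * x i / a) (2 * k i))))
      * (ell_fact q p (1 / a ^ 2) (weight r k) * ell_fact q p (a ^ 2 * q) (2 * weight r k)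
         / (\<Prod>i\<in>{1..r}. ell_fact (q ^ 3) p (a ^ 3 * x i * q ^ 3) (k i)))
      * (\<Prod>i\<in>{1..r}. \<Prod>j\<in>{1..r}.
          ell_facts (q ^ 3) p [q powi (- 3 * int (n j)) * x i / x j, x i * x j * q ^ (3 * n j)] (k i)
          / ell_fact (q ^ 3) p (q ^ 3 * x i / x j) (k i)))
    = (\<Prod>i\<in>{1..r}.
        ell_fact q p (a * x i * q) (3 * n i) * ell_fact (q ^ 3) p (x i / a ^ 3) (n i)
        / (ell_fact q p (x i / a) (3 * n i) * ell_fact (q ^ 3) p (a ^ 3 * x i * q ^ 3) (n i)))"
proof -
  define \<eta> where "\<eta> = Ln q"
  have q: "q = exp \<eta>" using assms(2) by (simp add: \<eta>_def)
  have nonper: "theta_add p (of_int t * \<eta>) \<noteq> 0" if "t \<noteq> 0" for t :: int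
  proof
    assume "theta_add p (of_int t * \<eta>) = 0"
    then obtain m where m: "q powi t = p powi m"
      using theta_add_eq_0[OF assms(1)] by (auto simp: q exp_power_int)
    \<comment> \<open>The assumption on q concerns positive exponents; for negative t both sides of
      \<open>m\<close> are inverted.\<close>
    have "q ^ nat \<bar>t\<bar> = p powi (if t \<ge> 0 then m else - m)"
    proof (cases "t \<ge> 0")
      case True
      then show ?thesis using m by (simp add: power_int_def)
    next
      case False
      then have "q ^ nat \<bar>t\<bar> = inverse (q powi t)" by (simp add: power_int_def power_inverse)
      then show ?thesis using False m by (simp add: power_int_minus)
    qed
    moreover have "nat \<bar>t\<bar> > 0" using that by simp
    ultimately show False using assms(3) by blast
  qed
  interpret cubic_nome p \<eta> by unfold_locales (use assms(1) nonper in auto)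
  \<comment> \<open>Outside {1..r} the given x is unrestricted and may vanish. The exponential form
    agrees with it on {1..r}, and the congruence lemmas bridge the difference.\<close>
  define \<xi> where "\<xi> i = (if i \<in> {1..r} then Ln (x i) else 0)" for i
  have x: "x i = exp (\<xi> i)" if "i \<in> {1..r}" for i using assms(6) that by (simp add: \<xi>_def)
  define A where "A \<tau> = exp (Ln a + \<tau>)" for \<tau>
  define X where "X \<tau> i = exp (\<xi> i + of_nat (4 * i) * \<tau>)" for \<tau> i
  have A0: "A 0 = a" using assms(5) by (simp add: A_def)
  have X0: "X 0 i = x i" if "i \<in> {1..r}" for i using x[OF that] by (simp add: X_def)
  have contA: "isCont A 0" unfolding A_def by (intro continuous_intros)
  have contX: "isCont (\<lambda>\<tau>. X \<tau> i) 0" for i unfolding X_def by (intro continuous_intros)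
  have gnr: "generic r p q n (A 0) (X 0)"
    using assms(7) generic_cong[of r "X 0" x p q n a, OF X0] by (simp only: A0)
  define f where "f \<tau> = (\<Sum>k\<in>index_box r n. summand r p q n (A \<tau>) (X \<tau>) k)" for \<tau>
  define g where "g \<tau> = sum_value r p q n (A \<tau>) (X \<tau>)" for \<tau>
  have "f 0 = g 0"
  proof (rule eq_at_of_eq_off_countable[where f = f and g = g and z = 0])
    show "isCont f 0"
      unfolding f_def[abs_def]
      by (intro continuous_sum isCont_summand[OF assms(1,2) contA _ contX _ gnr]) (auto simp: A_def X_def)
    show "isCont g 0"
      unfolding g_def[abs_def]
      by (intro isCont_sum_value[OF assms(1,2) contA _ contX _ gnr]) (auto simp: A_def X_def)
    have "f \<tau> = g \<tau>" if "gen_params r (\<lambda>i. \<xi> i + of_nat (4 * i) * \<tau>) (Ln a + \<tau>)" for \<tau>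
    proof -
      have "X \<tau> = (\<lambda>i. exp (\<xi> i + of_nat (4 * i) * \<tau>))" by (simp add: X_def fun_eq_iff)
      then show ?thesis
        unfolding f_def g_def A_def q by (simp only: cubic_sum_exp[OF that])
    qed
    then have "{\<tau>. f \<tau> \<noteq> g \<tau>} \<subseteq> {\<tau>. \<not> gen_params r (\<lambda>i. \<xi> i + of_nat (4 * i) * \<tau>) (Ln a + \<tau>)}"
      by blast
    then show "countable {\<tau>. f \<tau> \<noteq> g \<tau>}"
      using countable_not_gen_params countable_subset by blast
  qed
  moreover have "summand r p q n a (X 0) k = summand r p q n a x k" for k
    by (rule summand_cong) (rule X0)
  moreover have "sum_value r p q n a (X 0) = sum_value r p q n a x"
    by (rule sum_value_cong) (rule X0)
  ultimately have "(\<Sum>k\<in>index_box r n. summand r p q n a x k) = sum_value r p q n a x"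
    unfolding f_def g_def A0 by simp
  then show ?thesis unfolding summand_def sum_value_def .
qed

end
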